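(* If $a,b$ are positive integers with $\gcd(a,b)=1$ and the smaller of the two blocks $a,b$ has size at most $128$, then the Ooms spectrum of $W(a,b)$ is strictly internally log-concave. There is no bound on the larger block.
   Context: For positive integers $a,b$, let $$W(a,b)=\left\{\begin{pmatrix}X&Z\\0&Y\end{pmatrix}: X\in\operatorname{Mat}_a(\mathbb C),\ Y\in\operatorname{Mat}_b(\mathbb C),\ Z\in\operatorname{Mat}_{a\times b}(\mathbb C),\ \operatorname{tr}X+\operatorname{tr}Y=0\right\},$$ a Lie algebra under the commutator. A finite-dimensional complex Lie algebra $\mathfrak g$ is Frobenius if there is $\varphi\in\mathfrak g^*$ such that the bilinear form $B_\varphi(x,y)=\varphi([x,y])$ is nondegenerate; such $\varphi$ is called a Frobenius functional and determines a unique principal element $h\in\mathfrak g$ by $\varphi([h,x])=\varphi(x)$ for all $x\in\mathfrak g$. It is known that $W(a,b)$ is Frobenius exactly when $\gcd(a,b)=1$, and that the multiset of eigenvalues of $\operatorname{ad}h$ (with algebraic multiplicities) does not depend on the choice of Frobenius functional; this multiset is the Ooms spectrum. The distinct eigenvalues are integers forming an unbroken interval. The multiplicity sequence is the sequence of multiplicities, listed in order of increasing distinct eigenvalue. A positive sequence $(c_0,\ldots,c_t)$ is strictly internally log-concave if $c_j^2> c_{j-1}c_{j+1}$ for $1\le j<t$ (a two-term sequence has no internal inequality). An Ooms spectrum is called strictly internally log-concave if its multiplicity sequence is. *)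

theory Defs
  imports "Jordan_Normal_Form.Char_Poly"
begin

text \<open>Lie algebras are represented as linear subspaces \<open>L\<close> of the complex \<open>n \<times> n\<close> matrices that
  are closed under the commutator.\<close>

definition commutator :: "complex mat \<Rightarrow> complex mat \<Rightarrow> complex mat" where
  "commutator x y = x * y - y * x"

definition mat_trace :: "complex mat \<Rightarrow> complex" where
  "mat_trace A = (\<Sum>i<dim_row A. A $$ (i, i))"

definition W :: "nat \<Rightarrow> nat \<Rightarrow> complex mat set" where
  "W a b = {four_block_mat X Z (0\<^sub>m b a) Y | X Y Z.
     X \<in> carrier_mat a a \<and> Y \<in> carrier_mat b b \<and> Z \<in> carrier_mat a b \<and>
     mat_trace X + mat_trace Y = 0}"

text \<open>An element of the dual of \<open>L\<close> is a function on all matrices of which only the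
  values on \<open>L\<close> matter.\<close>

definition linear_functional :: "complex mat set \<Rightarrow> (complex mat \<Rightarrow> complex) \<Rightarrow> bool" where
  "linear_functional L \<phi> \<longleftrightarrow>
     (\<forall>x\<in>L. \<forall>y\<in>L. \<phi> (x + y) = \<phi> x + \<phi> y) \<and>
     (\<forall>c. \<forall>x\<in>L. \<phi> (c \<cdot>\<^sub>m x) = c * \<phi> x)"

text \<open>The form \<open>\<phi> [x, y]\<close> is alternating, so nondegeneracy means that its left radical is zero.\<close>

definition frobenius_functional ::
  "nat \<Rightarrow> complex mat set \<Rightarrow> (complex mat \<Rightarrow> complex) \<Rightarrow> bool" where
  "frobenius_functional n L \<phi> \<longleftrightarrow> linear_functional L \<phi> \<and>
     (\<forall>x\<in>L. (\<forall>y\<in>L. \<phi> (commutator x y) = 0) \<longrightarrow> x = 0\<^sub>m n n)"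

definition principal_element ::
  "complex mat set \<Rightarrow> (complex mat \<Rightarrow> complex) \<Rightarrow> complex mat \<Rightarrow> bool" where
  "principal_element L \<phi> h \<longleftrightarrow> h \<in> L \<and> (\<forall>x\<in>L. \<phi> (commutator h x) = \<phi> x)"

definition mat_lincomb :: "nat \<Rightarrow> complex mat list \<Rightarrow> complex vec \<Rightarrow> complex mat" where
  "mat_lincomb n bs c = mat n n (\<lambda>(i, j). \<Sum>k<length bs. c $ k * bs ! k $$ (i, j))"

definition ordered_basis :: "nat \<Rightarrow> complex mat set \<Rightarrow> complex mat list \<Rightarrow> bool" where
  "ordered_basis n L bs \<longleftrightarrow> set bs \<subseteq> L \<and>
     (\<forall>x\<in>L. \<exists>!c. c \<in> carrier_vec (length bs) \<and> mat_lincomb n bs c = x)"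

definition represents ::
  "nat \<Rightarrow> complex mat list \<Rightarrow> (complex mat \<Rightarrow> complex mat) \<Rightarrow> complex mat \<Rightarrow> bool" where
  "represents n bs f A \<longleftrightarrow> A \<in> carrier_mat (length bs) (length bs) \<and>
     (\<forall>j<length bs. f (bs ! j) = mat_lincomb n bs (col A j))"

text \<open>\<open>M\<close> is the multiset of eigenvalues of the endomorphism \<open>f\<close> of \<open>L\<close>, with algebraic
  multiplicities, i.e. the roots of its characteristic polynomial. The latter does not depend on
  the chosen basis.\<close>

definition eigenvalue_multiset ::
  "nat \<Rightarrow> complex mat set \<Rightarrow> (complex mat \<Rightarrow> complex mat) \<Rightarrow> complex multiset \<Rightarrow> bool" where
  "eigenvalue_multiset n L f M \<longleftrightarrow>
     (\<exists>bs A. ordered_basis n L bs \<and> represents n bs f A \<and> M = proots (char_poly A))"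

definition ooms_spectrum :: "nat \<Rightarrow> complex mat set \<Rightarrow> complex multiset \<Rightarrow> bool" where
  "ooms_spectrum n L M \<longleftrightarrow>
     (\<exists>\<phi> h. frobenius_functional n L \<phi> \<and> principal_element L \<phi> h \<and>
            eigenvalue_multiset n L (commutator h) M)"

text \<open>The list \<open>ks\<close> enumerates the distinct eigenvalues in increasing order; the relation
  fails if some eigenvalue is not an integer.\<close>

definition multiplicity_sequence :: "complex multiset \<Rightarrow> nat list \<Rightarrow> bool" where
  "multiplicity_sequence M c \<longleftrightarrow>
     (\<exists>ks :: int list. sorted_wrt (<) ks \<and> set_mset M = of_int ` set ks \<and>
        c = map (\<lambda>k. count M (of_int k)) ks)"

definition strictly_internally_log_concave :: "nat list \<Rightarrow> bool" where
  "strictly_internally_log_concave c \<longleftrightarrow>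
     (\<forall>m\<in>set c. 0 < m) \<and>
     (\<forall>j. 1 \<le> j \<and> j + 1 < length c \<longrightarrow> (c ! j)\<^sup>2 > c ! (j - 1) * c ! (j + 1))"

definition strictly_internally_log_concave_spectrum :: "complex multiset \<Rightarrow> bool" where
  "strictly_internally_log_concave_spectrum M \<longleftrightarrow>
     (\<exists>c. multiplicity_sequence M c \<and> strictly_internally_log_concave c)"

end

theory Submission
  imports Defs "Jordan_Normal_Form.Schur_Decomposition"
begin

text \<open>A functional on the block triangular matrices has the form \<open>x \<mapsto> tr (G x)\<close>, where \<open>G\<close> has
  diagonal blocks \<open>A\<close>, \<open>B\<close> and lower left block \<open>C\<close>. For \<open>a < b\<close> nondegeneracy makes \<open>C\<close> injective, and
  the cokernel of \<open>C\<close> carries a Frobenius functional of type \<open>(a, b - a)\<close> with the same eigenvalues of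
  the principal element, except that those of the first block are lowered by 1. Hence these
  eigenvalues follow the Euclidean algorithm.

  The multiplicities \<open>c\<close> of the differences satisfy \<open>c (k + 1) = c k - d k\<close> with
  \<open>d k = U k - U (- k)\<close>, and \<open>c\<close> is strictly log-concave once \<open>d\<close> is log-concave on the positive
  integers. If \<open>b = n a + r\<close>, then \<open>U\<close> is a shifted boundary term of \<open>(a, r)\<close> plus \<open>n\<close> translates of \<open>P\<close>.
  Only at the front where the boundary term meets the translates can log-concavity of \<open>d\<close> fail, and
  there it amounts, for all \<open>n\<close> at once, to finitely many inequalities depending on \<open>(a, r)\<close>. They
  are verified by computation along the tree of coprime pairs \<open>r < a \<le> 128\<close>.\<close>

section \<open>Multiplicities under the Euclidean algorithm\<close>

text \<open>The jump formula \<open>c (k + 1) = c k - d k\<close> is the symmetry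
  \<open>c (1 - k) = c k\<close> in disguise: the form \<open>\<phi> [x, y]\<close> pairs the
  eigenvalues k and 1 - k of ad h, and \<open>P\<close>, \<open>Q\<close> are even. The obstacle is
  that the larger block is unbounded. Let \<open>H\<close> count the differences within the smaller
  block. A sum of n consecutive translates of \<open>H\<close> is a difference of two tail sums, so
  with N = n + 1 one gets \<open>d k = X (k - N) + Y (k + N) - T k\<close>, where \<open>X\<close>,
  \<open>Y\<close>, \<open>T\<close> do not depend on n and \<open>X i + Y (- i)\<close> is
  constant. In the coordinates k and i = k - N the second argument is 2 k - i, and n has
  disappeared; finite support then bounds i and k. Behind the front (i < 0) \<open>X\<close> is
  traded for \<open>Y\<close> and d is concave; for i >= 0 the test accepts concavity or, failing
  that, the quadratic inequality itself. Monotonicity is needed only within parity classes: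
  \<open>H (k - j)\<close> is compared with \<open>H (- k - j)\<close>, and the second difference of
  \<open>T\<close> is \<open>H (k - 1) - H (k + 1)\<close>. The data of a node (a, r) decide the
  block size a + r, where the remainder of the larger block may be a or r; both are tested
  there.\<close>

definition parity_unimodal :: "(int \<Rightarrow> int) \<Rightarrow> bool" where
  "parity_unimodal P \<longleftrightarrow> (\<forall>x y. even (x - y) \<and> \<bar>x\<bar> \<le> \<bar>y\<bar> \<longrightarrow> P y \<le> P x)"

text \<open>With x = - y this gives \<open>U (- x) \<le> U x\<close> for x >= 0. The wider range of
  x makes the property survive a shift by one, because |x - 1| <= |x| + 1.\<close>

definition right_heavy :: "(int \<Rightarrow> int) \<Rightarrow> bool" where
  "right_heavy U \<longleftrightarrow> (\<forall>x y. even (x - y) \<and> \<bar>x\<bar> \<le> - y \<longrightarrow> U y \<le> U x)"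

text \<open>\<open>P k\<close>, \<open>Q k\<close>, \<open>U k\<close> count the differences \<open>k\<close> of two eigenvalues of a principal element, both
  from the first block, both from the second block, or one from each.\<close>

inductive state :: "nat \<Rightarrow> nat \<Rightarrow> (int \<Rightarrow> int) \<Rightarrow> (int \<Rightarrow> int) \<Rightarrow> (int \<Rightarrow> int) \<Rightarrow> bool" where
  unit: "state 1 1 (\<lambda>k. of_bool (k = 0)) (\<lambda>k. of_bool (k = 0)) (\<lambda>k. of_bool (k = 1))"
| left: "state a b P Q U \<Longrightarrow>
    state a (a + b) P (\<lambda>k. P k + Q k + U k + U (- k)) (\<lambda>k. P (k - 1) + U (k - 1))"
| right: "state a b P Q U \<Longrightarrow>
    state (a + b) b (\<lambda>k. P k + Q k + U k + U (- k)) Q (\<lambda>k. Q (k - 1) + U (k - 1))"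

lemma state_pos: "state a b P Q U \<Longrightarrow> 0 < a \<and> 0 < b"
  by (induction rule: state.induct) auto

text \<open>The map x to 1 - x exchanges the two blocks, and (1 - y) - (1 - x) = x - y; hence
  \<open>U\<close> stays the same while \<open>P\<close> and \<open>Q\<close> trade places.\<close>

lemma state_swap: "state a b P Q U \<Longrightarrow> state b a Q P U"
proof (induction rule: state.induct)
  case unit
  show ?case by (rule state.unit)
next
  case (left a b P Q U)
  from state.right[OF left.IH] show ?case by (simp add: add_ac)
next
  case (right a b P Q U)
  from state.left[OF right.IH] show ?case by (simp add: add_ac)
qed

lemma state_sym: "state a b P Q U \<Longrightarrow> (\<forall>k. P (- k) = P k) \<and> (\<forall>k. Q (- k) = Q k)"
  by (induction rule: state.induct) auto

lemma state_finite:
  "state a b P Q U \<Longrightarrow> \<exists>n. \<forall>k. \<bar>k\<bar> > n \<longrightarrow> P k = 0 \<and> Q k = 0 \<and> U k = 0"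
proof (induction rule: state.induct)
  case unit
  show ?case by (rule exI[of _ 1]) auto
next
  case (left a b P Q U)
  then obtain n where "\<forall>k. \<bar>k\<bar> > n \<longrightarrow> P k = 0 \<and> Q k = 0 \<and> U k = 0" by auto
  then show ?case by (intro exI[of _ "n + 1"]) auto
next
  case (right a b P Q U)
  then obtain n where "\<forall>k. \<bar>k\<bar> > n \<longrightarrow> P k = 0 \<and> Q k = 0 \<and> U k = 0" by auto
  then show ?case by (intro exI[of _ "n + 1"]) auto
qed

text \<open>Since \<open>P\<close> and \<open>Q\<close> are even, this says that the multiplicities
  of k + 1 and of - k agree, which is the duality of the Frobenius form. Here it comes out of the
  recursion: evenness matches the new terms on both sides, and the rest is the induction
  hypothesis.\<close>

lemma state_dim_step:
  assumes "state a b P Q U"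
  shows "P (k + 1) + Q (k + 1) + U (k + 1) - of_bool (k + 1 = 0) =
    P k + Q k + U k - of_bool (k = 0) + U (- k) - U k"
  using assms
proof (induction arbitrary: k rule: state.induct)
  case unit
  show ?case by auto
next
  case (left a b P Q U)
  have e: "- (k + 1) = - k - 1" by simp
  from state_sym[OF left.hyps] have "P (- k - 1) = P (k + 1)" by (metis e)
  then show ?case using left.IH[of k] unfolding e add_diff_cancel_right' by linarith
next
  case (right a b P Q U)
  have e: "- (k + 1) = - k - 1" by simp
  from state_sym[OF right.hyps] have "Q (- k - 1) = Q (k + 1)" by (metis e)
  then show ?case using right.IH[of k] unfolding e add_diff_cancel_right' by linarith
qed

lemma int_fun_const:
  fixes f :: "int \<Rightarrow> int"
  assumes "\<And>k. f (k + 1) = f k"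
  shows "f k = f 0"
proof (induction k rule: int_induct[of _ 0])
  case (step1 i)
  then show ?case using assms[of i] by simp
next
  case (step2 i)
  then show ?case using assms[of "i - 1"] by simp
qed simp

lemma state_left_cases:
  assumes "state a b P Q U" "a < b"
  obtains Q0 U0 where "state a (b - a) P Q0 U0" "Q = (\<lambda>k. P k + Q0 k + U0 k + U0 (- k))"
    "U = (\<lambda>k. P (k - 1) + U0 (k - 1))"
  using assms(1)
proof cases
  case unit
  then show ?thesis using assms by auto
next
  case (left b Q U)
  then show ?thesis using that by auto
next
  case (right a P U)
  then show ?thesis using assms(2) by auto
qed

text \<open>Both Euclidean steps produce blocks of different sizes, so equal blocks occur only at
  the start.\<close>

lemma state_diag:
  assumes "state a a P Q U"
  shows "a = 1 \<and> P = (\<lambda>k. of_bool (k = 0)) \<and> Q = (\<lambda>k. of_bool (k = 0)) \<and> U = (\<lambda>k. of_bool (k = 1))"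
  using assms
proof cases
  case unit
  then show ?thesis by auto
next
  case (left b Q U)
  then show ?thesis using state_pos by fastforce
next
  case (right a P U)
  then show ?thesis using state_pos by fastforce
qed

lemma state_one_left:
  assumes "state 1 b P Q U"
  shows "P = (\<lambda>k. of_bool (k = 0)) \<and> U = (\<lambda>k. of_bool (1 \<le> k \<and> k \<le> int b))"
  using assms
proof (induction b arbitrary: Q U rule: less_induct)
  case (less b)
  show ?case
  proof (cases "b = 1")
    case True
    with less.prems show ?thesis using state_diag[of 1 P Q U] by (auto simp: fun_eq_iff)
  next
    case False
    then have "1 < b" using state_pos[OF less.prems] by auto
    then obtain Q0 U0 where *: "state 1 (b - 1) P Q0 U0" "U = (\<lambda>k. P (k - 1) + U0 (k - 1))"
      using state_left_cases[OF less.prems] by metis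
    from less.IH[OF _ *(1)] \<open>1 < b\<close> have "P = (\<lambda>k. of_bool (k = 0))"
      "U0 = (\<lambda>k. of_bool (1 \<le> k \<and> k \<le> int (b - 1)))" by auto
    with * \<open>1 < b\<close> show ?thesis by (auto simp: fun_eq_iff of_nat_diff)
  qed
qed

text \<open>Each of the n steps to the left keeps \<open>P\<close>, shifts \<open>U\<close> by one
  and adds one more translate of \<open>P\<close>.\<close>

lemma state_run:
  assumes "state a b P Q U" "b = n * a + r" "0 < r"
  shows "\<exists>Q0 U0. state a r P Q0 U0 \<and> (\<forall>k. U k = U0 (k - int n) + (\<Sum>j=1..n. P (k - int j)))"
  using assms
proof (induction n arbitrary: b Q U)
  case 0
  then show ?case by auto
next
  case (Suc n)
  have ab: "a < b" using Suc.prems by simp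
  obtain Q1 U1 where 1: "state a (b - a) P Q1 U1" "U = (\<lambda>k. P (k - 1) + U1 (k - 1))"
    using state_left_cases[OF Suc.prems(1) ab] by metis
  have "b - a = n * a + r" using Suc.prems by simp
  from Suc.IH[OF 1(1) this Suc.prems(3)] obtain Q0 U0 where
    2: "state a r P Q0 U0" "\<And>k. U1 k = U0 (k - int n) + (\<Sum>j=1..n. P (k - int j))" by auto
  have "U k = U0 (k - int (Suc n)) + (\<Sum>j=1..Suc n. P (k - int j))" for k
  proof -
    have "(\<Sum>j=1..Suc n. P (k - int j)) = P (k - 1) + (\<Sum>j=Suc 1..Suc n. P (k - int j))"
      by (subst sum.atLeast_Suc_atMost) auto
    also have "(\<Sum>j=Suc 1..Suc n. P (k - int j)) = (\<Sum>j=1..n. P (k - 1 - int j))"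
      by (subst sum.shift_bounds_cl_Suc_ivl) (simp add: algebra_simps)
    finally have "(\<Sum>j=1..Suc n. P (k - int j)) = P (k - 1) + (\<Sum>j=1..n. P (k - 1 - int j))" .
    then show ?thesis unfolding 1(2) 2(2)[of "k - 1"] by (simp add: algebra_simps)
  qed
  with 2(1) show ?case by blast
qed

lemma parity_unimodalI:
  assumes sym: "\<And>k. H (- k) = H k" and dec: "\<And>k. 1 \<le> k \<Longrightarrow> H (k + 1) \<le> H (k - 1)"
  shows "parity_unimodal H"
  unfolding parity_unimodal_def
proof (intro allI impI)
  fix x y :: int
  assume *: "even (x - y) \<and> \<bar>x\<bar> \<le> \<bar>y\<bar>"
  have habs: "H k = H \<bar>k\<bar>" for k using sym[of k] by (simp add: abs_if)
  obtain s where s: "\<bar>y\<bar> = \<bar>x\<bar> + 2 * int s"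
  proof -
    have "even (\<bar>y\<bar> - \<bar>x\<bar>)" using * by simp
    then obtain z where "\<bar>y\<bar> - \<bar>x\<bar> = 2 * z" by blast
    with * that[of "nat z"] show ?thesis by simp
  qed
  have "H (\<bar>x\<bar> + 2 * int s) \<le> H \<bar>x\<bar>"
  proof (induction s)
    case (Suc s)
    from dec[of "\<bar>x\<bar> + 2 * int s + 1"] Suc show ?case by (simp add: algebra_simps)
  qed simp
  then show "H y \<le> H x" using s habs[of x] habs[of y] by simp
qed

text \<open>Strictness is spent on the single step from |x| to |x| + 2; weak monotonicity does the
  rest.\<close>

lemma parity_unimodal_strict:
  assumes u: "parity_unimodal H" and dec: "\<And>k. 1 \<le> k \<Longrightarrow> k \<le> w + 1 \<Longrightarrow> H (k + 1) < H (k - 1)"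
    and xy: "even (x - y)" "\<bar>x\<bar> < \<bar>y\<bar>" "\<bar>x\<bar> \<le> w"
  shows "H y < H x"
proof -
  have "even (\<bar>y\<bar> - \<bar>x\<bar>)" using xy by simp
  then have *: "\<bar>x\<bar> + 2 \<le> \<bar>y\<bar>" using xy by presburger
  have "H y \<le> H (\<bar>x\<bar> + 2)" using u * xy(1) unfolding parity_unimodal_def by auto
  also have "\<dots> < H \<bar>x\<bar>" using dec[of "\<bar>x\<bar> + 1"] xy by (simp add: algebra_simps)
  also have "\<dots> \<le> H x" using u unfolding parity_unimodal_def by simp
  finally show ?thesis .
qed

lemma right_heavy_step:
  assumes "parity_unimodal P" "right_heavy U"
  shows "right_heavy (\<lambda>k. P (k - 1) + U (k - 1))"
  unfolding right_heavy_def
proof (intro allI impI)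
  fix x y :: int
  assume *: "even (x - y) \<and> \<bar>x\<bar> \<le> - y"
  have "P (y - 1) \<le> P (x - 1)"
    using assms(1)[unfolded parity_unimodal_def, rule_format, of "x - 1" "y - 1"] * by auto
  moreover have "U (y - 1) \<le> U (x - 1)"
    using assms(2)[unfolded right_heavy_def, rule_format, of "x - 1" "y - 1"] * by auto
  ultimately show "P (y - 1) + U (y - 1) \<le> P (x - 1) + U (x - 1)" by simp
qed

text \<open>Satisfied by the jumps \<open>c k - c (k + 1)\<close>, \<open>k \<ge> 1\<close>, of the multiplicities \<open>c\<close> of the spectrum.\<close>

definition lc_profile :: "(int \<Rightarrow> int) \<Rightarrow> bool" where
  "lc_profile d \<longleftrightarrow> (\<exists>K\<ge>1. (\<forall>k. 1 \<le> k \<and> k \<le> K \<longrightarrow> 0 < d k) \<and> (\<forall>k>K. d k = 0)) \<and>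
     (\<forall>k\<ge>2. d (k - 1) * d (k + 1) \<le> (d k)\<^sup>2)"

lemma concave_imp_log_concave:
  fixes a b c :: int
  assumes "0 \<le> a" "0 \<le> c" "a + c \<le> 2 * b"
  shows "a * c \<le> b\<^sup>2"
proof -
  have "4 * (a * c) \<le> (a + c)\<^sup>2"
    using zero_le_power2[of "a - c"] by (simp add: power2_eq_square algebra_simps)
  also have "\<dots> \<le> (2 * b)\<^sup>2" using assms by (intro power_mono) auto
  finally show ?thesis by (simp add: power_mult_distrib)
qed

section \<open>Log-concavity of the jumps, for all run lengths at once\<close>

definition d2 :: "(int \<Rightarrow> int) \<Rightarrow> int \<Rightarrow> int" where
  "d2 f k = f (k - 1) + f (k + 1) - 2 * f k"

text \<open>With i = k - N the jump is \<open>d k = X i - T k + Y (2 * k - i)\<close>. The first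
  clause is concavity for i = - j < 0, where \<open>X i\<close> is a constant minus
  \<open>Y j\<close>. The second is log-concavity for i >= 0: N >= 2 gives i + 2 <= k, and at k = w
  + 2 the terms of \<open>Y\<close> and \<open>T\<close> have already vanished for every i <=
  w.\<close>

definition run_ok :: "int \<Rightarrow> (int \<Rightarrow> int) \<Rightarrow> (int \<Rightarrow> int) \<Rightarrow> (int \<Rightarrow> int) \<Rightarrow> bool" where
  "run_ok w X Y T \<longleftrightarrow>
     (\<forall>k\<ge>2. \<forall>j\<ge>1. d2 Y (2 * k + j) \<le> d2 T k + d2 Y j) \<and>
     (\<forall>i\<ge>0. \<forall>k. i + 2 \<le> k \<and> k \<le> w + 2 \<longrightarrow>
        d2 X i + d2 Y (2 * k - i) \<le> d2 T k \<or>
        (X (i - 1) - T (k - 1) + Y (2 * k - i - 1)) * (X (i + 1) - T (k + 1) + Y (2 * k - i + 1)) \<le>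
        (X i - T k + Y (2 * k - i))\<^sup>2)"

text \<open>Left of the moving front the profile is concave; on the front it is controlled by \<open>run_ok\<close>.\<close>

lemma run_log_concave:
  assumes ok: "run_ok w X Y T" and N: "2 \<le> N"
    and XY: "\<And>i. X i + Y (- i) = S" and T0: "\<And>k. w < k \<Longrightarrow> T k = 0"
    and X0: "\<And>i. w < i \<Longrightarrow> X i = 0" and Y0: "\<And>i. w < i \<Longrightarrow> Y i = 0"
    and d: "\<And>k. d k = X (k - N) + Y (k + N) - T k" and d0: "\<And>k. 1 \<le> k \<Longrightarrow> 0 \<le> d k"
    and k: "2 \<le> k"
  shows "d (k - 1) * d (k + 1) \<le> (d k)\<^sup>2"
proof -
  have ok1: "d2 Y (2 * k + j) \<le> d2 T k + d2 Y j" if "2 \<le> k" "1 \<le> j" for k j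
    using ok that unfolding run_ok_def by blast
  have ok2: "d2 X i + d2 Y (2 * k - i) \<le> d2 T k \<or>
    (X (i - 1) - T (k - 1) + Y (2 * k - i - 1)) * (X (i + 1) - T (k + 1) + Y (2 * k - i + 1)) \<le>
    (X i - T k + Y (2 * k - i))\<^sup>2"
    if "0 \<le> i" "i + 2 \<le> k" "k \<le> w + 2" for i k
    using ok that unfolding run_ok_def by blast
  define i where "i = k - N"
  have dd: "d (k - 1) = X (i - 1) - T (k - 1) + Y (2 * k - i - 1)"
    "d (k + 1) = X (i + 1) - T (k + 1) + Y (2 * k - i + 1)"
    "d k = X i - T k + Y (2 * k - i)"
    unfolding d i_def by (simp_all add: algebra_simps)
  have conc: "d (k - 1) * d (k + 1) \<le> (d k)\<^sup>2" if "d2 X i + d2 Y (2 * k - i) \<le> d2 T k"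
    by (rule concave_imp_log_concave)
      (use that d0[of "k - 1"] d0[of "k + 1"] k in \<open>simp_all add: d2_def dd\<close>)
  show ?thesis
  proof (cases "i < 0")
    case True
    have e: "- (i - 1) = - i + 1" "- (i + 1) = - i - 1" by simp_all
    have "d2 X i = - d2 Y (- i)"
      using XY[of "i - 1"] XY[of "i + 1"] XY[of i] unfolding d2_def e by linarith
    moreover have "d2 Y (2 * k + (- i)) \<le> d2 T k + d2 Y (- i)"
      by (rule ok1) (use True k in auto)
    ultimately show ?thesis by (intro conc) (simp add: algebra_simps)
  next
    case False
    then have ik: "i + 2 \<le> k" using N by (simp add: i_def)
    show ?thesis
    proof (cases "k \<le> w + 2")
      case True
      from ok2[OF _ ik True] False dd show ?thesis using conc by auto
    next
      case k': False
      show ?thesis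
      proof (cases "i \<le> w")
        case True
        \<comment> \<open>For larger k the terms of \<open>Y\<close> and \<open>T\<close> are zero,
          exactly as they are at w + 2, so this one instance speaks for all of them.\<close>
        let ?k = "w + 2"
        have z: "Y (2 * ?k - i - 1) = 0" "Y (2 * ?k - i) = 0" "Y (2 * ?k - i + 1) = 0"
          "T (?k - 1) = 0" "T ?k = 0" "T (?k + 1) = 0"
          using True by (auto intro!: T0 Y0)
        have z': "Y (2 * k - i - 1) = 0" "Y (2 * k - i) = 0" "Y (2 * k - i + 1) = 0"
          "T (k - 1) = 0" "T k = 0" "T (k + 1) = 0"
          using True k' by (auto intro!: T0 Y0)
        have "d2 X i \<le> 0 \<or> X (i - 1) * X (i + 1) \<le> (X i)\<^sup>2"
          using ok2[of i ?k] False True unfolding z d2_def[of Y] d2_def[of T] by simp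
        then show ?thesis
        proof
          assume "d2 X i \<le> 0"
          then show ?thesis using z' by (intro conc) (simp add: d2_def)
        next
          assume "X (i - 1) * X (i + 1) \<le> (X i)\<^sup>2"
          then show ?thesis unfolding dd using z' by simp
        qed
      next
        case False
        have "d (k + 1) = 0" unfolding dd
          using False k' ik by (simp add: X0 Y0 T0)
        then show ?thesis by simp
      qed
    qed
  qed
qed


text \<open>The cut-off \<open>w\<close> bounds the support of \<open>H\<close>; a sum of
  consecutive translates of \<open>H\<close> is then a difference of two tails.\<close>

definition tail :: "(int \<Rightarrow> int) \<Rightarrow> int \<Rightarrow> int \<Rightarrow> int" where
  "tail H w k = sum H {k..w}"

lemma tail_step:
  assumes "\<And>k. w < \<bar>k\<bar> \<Longrightarrow> H k = 0" "0 \<le> w"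
  shows "tail H w k = H k + tail H w (k + 1)"
proof (cases "k \<le> w")
  case True
  then have "{k..w} = insert k {k + 1..w}" by auto
  then show ?thesis by (simp add: tail_def)
next
  case False
  then show ?thesis using assms by (simp add: tail_def)
qed

text \<open>Here \<open>P\<close>, \<open>Q\<close>, \<open>U\<close> belong to the pair one
  Euclidean step before (a, r): \<open>H\<close> is the count for the block a, the boundary term of
  (a, r) is \<open>P (k - 1) + U (k - 1)\<close>, and \<open>U'\<close> belongs to (a, n a +
  r).\<close>

lemma node_profile:
  fixes P Q U H :: "int \<Rightarrow> int" and n :: nat and w :: int
  defines "H \<equiv> \<lambda>k. P k + Q k + U k + U (- k)"
  defines "X \<equiv> \<lambda>i. P i + U i + tail H w (i + 1)"
  defines "Y \<equiv> \<lambda>i. Q i + U i + tail H w (i + 1)"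
  defines "T \<equiv> \<lambda>k. tail H w k + tail H w (k + 1)"
  assumes P: "parity_unimodal P" and Q: "\<And>k. Q (- k) = Q k" and U: "right_heavy U" and w: "0 \<le> w"
    and H: "parity_unimodal H" and H0: "\<And>k. w < \<bar>k\<bar> \<Longrightarrow> H k = 0"
    and Hs: "\<And>k. 1 \<le> k \<Longrightarrow> k \<le> w + 1 \<Longrightarrow> H (k + 1) < H (k - 1)"
    and X0: "\<And>i. w < i \<Longrightarrow> X i = 0" and Y0: "\<And>i. w < i \<Longrightarrow> Y i = 0"
    and ok: "run_ok w X Y T" and n: "1 \<le> n"
    and U': "\<And>k. U' k = P (k - int n - 1) + U (k - int n - 1) + (\<Sum>j=1..n. H (k - int j))"
  shows "lc_profile (\<lambda>k. U' k - U' (- k))"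
proof -
  let ?t = "tail H w"
  have step: "?t k = H k + ?t (k + 1)" for k by (rule tail_step) (use H0 w in auto)
  have Psym: "P (- k) = P k" for k
    using P[unfolded parity_unimodal_def, rule_format, of k "- k"]
      P[unfolded parity_unimodal_def, rule_format, of "- k" k] by fastforce
  have Hsym: "H (- k) = H k" for k unfolding H_def using Psym Q by simp
  define S where "S = ?t 0 + ?t 1"
  \<comment> \<open>Summing the even function \<open>H\<close> from - k to \<open>w\<close> and from
    k + 1 to \<open>w\<close> covers its whole mass, plus the part from 1 to \<open>w\<close> once
    more.\<close>
  have tt: "?t (- k) + ?t (k + 1) = S" for k
  proof -
    have "?t (- (k + 1)) + ?t (k + 1 + 1) = ?t (- k) + ?t (k + 1)" for k
      using step[of "- (k + 1)"] step[of "k + 1"] Hsym[of "k + 1"] by simp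
    from int_fun_const[of "\<lambda>k. ?t (- k) + ?t (k + 1)", OF this] show ?thesis by (simp add: S_def)
  qed
  have XY: "X i + Y (- i) = S" for i
  proof -
    have "?t (- i + 1) = S - ?t i" using tt[of "i - 1"] by simp
    then show ?thesis unfolding X_def Y_def using step[of i] Q[of i] by (simp add: H_def)
  qed
  \<comment> \<open>The boundary term is shifted n times by the run and once by the step that
    created it.\<close>
  define N where "N = int n + 1"
  have window: "(\<Sum>j=1..m. H (k - int j)) = ?t (k - int m) - ?t k" for k m
  proof (induction m)
    case (Suc m)
    then show ?case using step[of "k - int m - 1"] by (simp add: algebra_simps)
  qed simp
  have UX: "U' k = X (k - N) - ?t k" for k
    unfolding U' window X_def N_def by (simp add: algebra_simps)
  define d where "d = (\<lambda>k. U' k - U' (- k))"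
  have d: "d k = X (k - N) + Y (k + N) - T k" for k
  proof -
    have "- (- k - N) = k + N" by simp
    with XY[of "- k - N"] have "X (- k - N) + Y (k + N) = S" by metis
    then show ?thesis using tt[of k] unfolding d_def UX T_def by simp
  qed
  have U1: "right_heavy (\<lambda>k. P (k - 1) + U (k - 1))" by (rule right_heavy_step[OF P U])
  have dsum: "d k = (P (k - int n - 1) + U (k - int n - 1) - (P (- k - int n - 1) + U (- k - int n - 1)))
      + (\<Sum>j=1..n. H (k - int j) - H (- k - int j))" for k
    unfolding d_def U' by (simp add: sum_subtractf)
  have U1k: "P (- k - int n - 1) + U (- k - int n - 1) \<le> P (k - int n - 1) + U (k - int n - 1)"
    if "0 \<le> k" for k
    using U1[unfolded right_heavy_def, rule_format, of "k - int n" "- k - int n"] that by auto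
  have Hk: "0 \<le> H (k - int j) - H (- k - int j)" if "0 \<le> k" for k j
    using H[unfolded parity_unimodal_def, rule_format, of "k - int j" "- k - int j"] that by auto
  have d0: "0 \<le> d k" if "0 \<le> k" for k
    unfolding dsum using U1k[OF that] Hk[OF that] by (simp add: sum_nonneg)
  have dpos: "0 < d k" if k: "1 \<le> k" "k \<le> int n + w" for k
  proof -
    \<comment> \<open>A translate whose centre lies within \<open>w\<close> of k; there
      \<open>H\<close> decreases strictly, so this one summand is positive.\<close>
    obtain j where j: "j \<in> {1..n}" "\<bar>k - int j\<bar> \<le> w"
    proof (cases "k \<le> w + 1")
      case True
      with that[of 1] n k show ?thesis by auto
    next
      case False
      then have "1 \<le> nat (k - w)" "nat (k - w) \<le> n" "int (nat (k - w)) = k - w" using k by linarith+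
      with that[of "nat (k - w)"] w show ?thesis by simp
    qed
    have "H (- k - int j) < H (k - int j)"
      by (rule parity_unimodal_strict[OF H Hs]) (use j k in auto)
    then have "0 < (\<Sum>j=1..n. H (k - int j) - H (- k - int j))"
      using j(1) Hk[of k] k by (intro sum_pos2[of _ j]) auto
    then show ?thesis unfolding dsum using U1k[of k] k by simp
  qed
  have T0: "T k = 0" if "w < k" for k using that by (simp add: T_def tail_def)
  have dz: "d k = 0" if "k > int n + w + 1" for k
    unfolding d using that w by (simp add: N_def X0 Y0 T0)
  have lc: "d (k - 1) * d (k + 1) \<le> (d k)\<^sup>2" if "2 \<le> k" for k
    by (rule run_log_concave[OF ok _ XY T0 X0 Y0 d]) (use n that d0 in \<open>auto simp: N_def\<close>)
  have "\<exists>K\<ge>1. (\<forall>k. 1 \<le> k \<and> k \<le> K \<longrightarrow> 0 < d k) \<and> (\<forall>k>K. d k = 0)"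
  \<comment> \<open>At this last possible position d equals the boundary value
    \<open>P w + U w\<close>, which may or may not vanish; the support ends accordingly.\<close>
  proof (cases "d (int n + w + 1) = 0")
    case True
    have "d k = 0" if "k > int n + w" for k
      using True dz[of k] that by (cases "k = int n + w + 1") auto
    then show ?thesis using dpos n w by (intro exI[of _ "int n + w"]) auto
  next
    case False
    then have "0 < d (int n + w + 1)" using d0[of "int n + w + 1"] w by simp
    then have "0 < d k" if "1 \<le> k" "k \<le> int n + w + 1" for k
      using dpos[of k] that by (cases "k = int n + w + 1") auto
    then show ?thesis using dz n w by (intro exI[of _ "int n + w + 1"]) auto
  qed
  with lc show ?thesis unfolding lc_profile_def d_def by blast
qed

section \<open>Lists as finitely supported functions, and executable tests on them\<close>

text \<open>The default 0 beyond the end lets lists of different lengths stand for functions of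
  finite support.\<close>

definition nz :: "int list \<Rightarrow> nat \<Rightarrow> int" where
  "nz xs k = (if k < length xs then xs ! k else 0)"

lemma nz_simps [simp]:
  "nz [] k = 0" "nz (x # xs) 0 = x" "nz (x # xs) (Suc k) = nz xs k"
  by (auto simp: nz_def)

lemma nz_tl [simp]: "nz (tl xs) k = nz xs (Suc k)"
  by (cases xs) auto

lemma nz_drop [simp]: "nz (drop i xs) k = nz xs (i + k)"
  by (auto simp: nz_def)

lemma nz_beyond: "length xs \<le> k \<Longrightarrow> nz xs k = 0"
  by (simp add: nz_def)

lemma nz_rev: "nz (rev xs) k = (if k < length xs then nz xs (length xs - 1 - k) else 0)"
  by (auto simp: nz_def rev_nth)

lemma nz_append: "nz (xs @ ys) k = (if k < length xs then nz xs k else nz ys (k - length xs))"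
  by (auto simp: nz_def nth_append)

fun hd0 :: "int list \<Rightarrow> int" where
  "hd0 [] = 0"
| "hd0 (x # xs) = x"

lemma hd0_eq [simp]: "hd0 xs = nz xs 0"
  by (cases xs) auto

fun add_list :: "int list \<Rightarrow> int list \<Rightarrow> int list" where
  "add_list [] ys = ys"
| "add_list (x # xs) [] = x # xs"
| "add_list (x # xs) (y # ys) = (x + y) # add_list xs ys"

lemma nz_add_list [simp]: "nz (add_list xs ys) k = nz xs k + nz ys k"
proof (induction xs ys arbitrary: k rule: add_list.induct)
  case (3 x xs y ys)
  then show ?case by (cases k) auto
qed auto

lemma length_add_list [simp]: "length (add_list xs ys) = max (length xs) (length ys)"
  by (induction xs ys rule: add_list.induct) auto

fun suffix_sums :: "int list \<Rightarrow> int list" where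
  "suffix_sums [] = []"
| "suffix_sums (x # xs) = (let s = suffix_sums xs in (x + hd0 s) # s)"

lemma length_suffix_sums [simp]: "length (suffix_sums xs) = length xs"
  by (induction xs) (auto simp: Let_def)

lemma nz_suffix_sums: "nz (suffix_sums xs) k = nz xs k + nz (suffix_sums xs) (Suc k)"
proof (induction xs arbitrary: k)
  case (Cons x xs)
  show ?case
  proof (cases k)
    case (Suc k')
    then show ?thesis using Cons.IH[of k'] by (simp add: Let_def)
  qed (simp add: Let_def)
qed simp

text \<open>One entry bounds a whole tail, so that a single comparison can settle a row of
  inequalities.\<close>

fun suffix_maxs :: "int list \<Rightarrow> int list" where
  "suffix_maxs [] = []"
| "suffix_maxs (x # xs) = (let s = suffix_maxs xs in max x (hd0 s) # s)"

lemma nz_suffix_maxs: "j \<le> k \<Longrightarrow> nz xs k \<le> nz (suffix_maxs xs) j"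
proof (induction xs arbitrary: j k)
  case (Cons x xs)
  show ?case
  proof (cases j)
    case 0
    show ?thesis
    proof (cases k)
      case (Suc k')
      then show ?thesis using 0 Cons.IH[of 0 k'] by (simp add: Let_def)
    qed (use 0 in \<open>simp add: Let_def\<close>)
  next
    case (Suc j')
    then show ?thesis using Cons by (cases k) (auto simp: Let_def)
  qed
qed simp

text \<open>The entry at k is the second difference centred at k + 1; the argument lists therefore
  begin with the value at - 1.\<close>

fun diffs2 :: "int list \<Rightarrow> int list" where
  "diffs2 [] = []"
| "diffs2 [a] = [a]"
| "diffs2 [a, b] = [a - (b + b), b]"
| "diffs2 (a # b # c # r) = (a + c - (b + b)) # diffs2 (b # c # r)"

lemma length_diffs2 [simp]: "length (diffs2 xs) = length xs"
  by (induction xs rule: diffs2.induct) auto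

lemma nz_diffs2: "nz (diffs2 xs) k = nz xs k + nz xs (k + 2) - 2 * nz xs (k + 1)"
proof (induction xs arbitrary: k rule: diffs2.induct)
  case (2 a)
  then show ?case by (cases k) auto
next
  case (3 a b)
  then show ?case by (cases k; cases "k - 1") auto
next
  case (4 a b c r)
  then show ?case by (cases k) (auto simp: numeral_2_eq_2)
qed auto

text \<open>Applied to \<open>H\<close> this lists the second differences of \<open>T\<close>: tail
  sums telescope, so \<open>d2 T (k + 1) = H k - H (k + 2)\<close>.\<close>

fun gaps :: "int list \<Rightarrow> int list" where
  "gaps [] = []"
| "gaps [a] = [a]"
| "gaps [a, b] = [a, b]"
| "gaps (a # b # c # r) = (a - c) # gaps (b # c # r)"

lemma length_gaps [simp]: "length (gaps xs) = length xs"
  by (induction xs rule: gaps.induct) auto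

lemma nz_gaps: "nz (gaps xs) k = nz xs k - nz xs (k + 2)"
proof (induction xs arbitrary: k rule: gaps.induct)
  case (2 a)
  then show ?case by (cases k) auto
next
  case (3 a b)
  then show ?case by (cases k; cases "k - 1") auto
next
  case (4 a b c r)
  then show ?case by (cases k) (auto simp: numeral_2_eq_2)
qed auto

fun decreasing :: "int list \<Rightarrow> bool" where
  "decreasing (a # b # r) \<longleftrightarrow> b \<le> a \<and> decreasing (b # r)"
| "decreasing [a] \<longleftrightarrow> True"
| "decreasing [] \<longleftrightarrow> True"

lemma decreasing_nth: "decreasing xs \<Longrightarrow> i \<le> j \<Longrightarrow> j < length xs \<Longrightarrow> xs ! j \<le> xs ! i"
proof (induction xs arbitrary: i j rule: decreasing.induct)
  case (1 a b r)
  show ?case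
  proof (cases i)
    case 0
    then show ?thesis using 1(1)[of 0 "j - 1"] 1(2-) by (cases j) auto
  next
    case (Suc i')
    then show ?thesis using 1(1)[of i' "j - 1"] 1(2-) by (cases j) auto
  qed
qed auto

fun unimodal :: "int list \<Rightarrow> bool" where
  "unimodal (a # b # r) \<longleftrightarrow> (if a \<le> b then unimodal (b # r) else decreasing (b # r))"
| "unimodal [a] \<longleftrightarrow> True"
| "unimodal [] \<longleftrightarrow> True"

text \<open>Lets a lower bound at the two ends of an interval of gaps hold throughout the
  interval.\<close>

lemma unimodal_nth:
  "unimodal xs \<Longrightarrow> i \<le> j \<Longrightarrow> j \<le> k \<Longrightarrow> k < length xs \<Longrightarrow> min (xs ! i) (xs ! k) \<le> xs ! j"
proof (induction xs arbitrary: i j k rule: unimodal.induct)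
  case (1 a b r)
  show ?case
  proof (cases "a \<le> b")
    case True
    have *: "min ((b # r) ! i') ((b # r) ! k') \<le> (b # r) ! j'"
      if "i' \<le> j'" "j' \<le> k'" "k' < length (b # r)" for i' j' k'
      using 1(1)[OF True _ that] 1(2) True by simp
    show ?thesis
    proof (cases j)
      case 0
      then show ?thesis using 1 by auto
    next
      case (Suc j')
      then obtain k' where k: "k = Suc k'" using 1 by (cases k) auto
      show ?thesis
      proof (cases i)
        case 0
        then show ?thesis using *[of 0 j' k'] 1 True Suc k by auto
      next
        case (Suc i')
        then show ?thesis using *[of i' j' k'] 1 \<open>j = Suc j'\<close> k by auto
      qed
    qed
  next
    case False
    then have "decreasing (a # b # r)" using 1 by simp
    from decreasing_nth[OF this, of j k] 1 show ?thesis by auto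
  qed
qed auto

fun dominated :: "int \<Rightarrow> int list \<Rightarrow> int list \<Rightarrow> bool" where
  "dominated p (u # us) (v # vs) \<longleftrightarrow> v \<le> p + u \<and> dominated p us vs"
| "dominated p us [] \<longleftrightarrow> True"
| "dominated p [] (v # vs) \<longleftrightarrow> False"

lemma dominated_nz:
  "dominated p us vs \<Longrightarrow> 0 \<le> p \<Longrightarrow> (\<And>j. 0 \<le> nz us j) \<Longrightarrow> nz vs j \<le> p + nz us j"
proof (induction p us vs arbitrary: j rule: dominated.induct)
  case (1 p u us v vs)
  have "0 \<le> nz us j" for j using 1(4)[of "Suc j"] by simp
  with 1 show ?case by (cases j) auto
qed auto

text \<open>Tests the first clause of \<open>run_ok\<close>, one k per row: \<open>p\<close> is
  \<open>d2 T k\<close>, \<open>ys\<close> starts at \<open>d2 Y 1\<close> and the third list at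
  \<open>d2 Y (2 * k + 1)\<close>. The next k moves that argument by two, hence the extra
  \<open>tl\<close>. If the maximum \<open>m\<close> of what remains is at most \<open>p\<close>,
  the row holds because \<open>ys\<close> is nonnegative.\<close>

fun left_concave :: "int list \<Rightarrow> int list \<Rightarrow> int list \<Rightarrow> int list \<Rightarrow> bool" where
  "left_concave (p # ps) ys (v # vs) (m # ms) \<longleftrightarrow>
     (if m \<le> p then True else dominated p ys (v # vs)) \<and> left_concave ps ys (tl vs) (tl ms)"
| "left_concave ps ys [] ms \<longleftrightarrow> True"
| "left_concave ps ys (v # vs) [] \<longleftrightarrow> True"
| "left_concave [] ys (v # vs) (m # ms) \<longleftrightarrow> False"

lemma left_concave_nz:
  assumes "left_concave ps ys vs ms" "\<And>j. 0 \<le> nz ys j" "\<And>j. 0 \<le> nz ps j"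
    "\<And>j k. j \<le> k \<Longrightarrow> nz vs k \<le> nz ms j"
  shows "nz vs (2 * s + j) \<le> nz ps s + nz ys j"
  using assms
proof (induction ps ys vs ms arbitrary: s rule: left_concave.induct)
  case (1 p ps ys v vs m ms)
  show ?case
  proof (cases s)
    case 0
    show ?thesis
    proof (cases "m \<le> p")
      case True
      then show ?thesis using 0 1(5)[of 0 j] 1(3)[of j] by simp
    next
      case False
      then have "dominated p ys (v # vs)" using 1(2) by simp
      from dominated_nz[OF this, of j] show ?thesis using 0 1(3) 1(4)[of 0] by simp
    qed
  next
    case (Suc s')
    have "nz (tl vs) (2 * s' + j) \<le> nz ps s' + nz ys j"
    proof (rule 1(1))
      show "0 \<le> nz ps j" for j using 1(4)[of "Suc j"] by simp
      show "nz (tl vs) k \<le> nz (tl ms) j" if "j \<le> k" for j k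
        using 1(5)[of "Suc (Suc j)" "Suc (Suc k)"] that by simp
    qed (use 1 in auto)
    then show ?thesis using Suc by simp
  qed
next
  case (2 ps ys ms)
  then show ?case by simp
next
  case (3 ps ys v vs)
  have "nz (v # vs) (2 * s + j) \<le> 0" using 3(4)[of "2 * s + j" "2 * s + j"] by simp
  then show ?case using 3(2)[of j] 3(3)[of s] by linarith
qed auto

text \<open>Tests the second clause of \<open>run_ok\<close> for one i, with k falling to i + 2 and
  \<open>fs\<close> as step counter. \<open>\<theta>\<close> bounds
  \<open>d2 X i + d2 Y (2 * k - i)\<close> for every k of the scan, \<open>p\<close> is the current
  \<open>d2 T k\<close> and \<open>q\<close> is \<open>d2 T (i + 2)\<close> at the far end. Since
  the gaps are unimodal, \<open>\<theta> \<le> p\<close> and \<open>\<theta> \<le> q\<close> settle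
  all remaining k. Otherwise concavity is tried, and then the product inequality. When k falls by
  one, 2 k - i falls by two, so \<open>zs\<close> and \<open>ws\<close> lose two entries.\<close>

fun scan_front :: "int list \<Rightarrow> int \<Rightarrow> int \<Rightarrow> int \<Rightarrow> int \<Rightarrow> int \<Rightarrow> int \<Rightarrow>
    int list \<Rightarrow> int list \<Rightarrow> int list \<Rightarrow> int list \<Rightarrow> bool" where
  "scan_front [] \<theta> q c x0 x1 x2 ps ts zs ws \<longleftrightarrow> True"
| "scan_front (f # fs) \<theta> q c x0 x1 x2 (p # ps) (t0 # t1 # t2 # ts) (z0 # z1 # z2 # zs) (w # ws) \<longleftrightarrow>
     (if \<theta> \<le> p \<and> \<theta> \<le> q then True
      else (if c + w \<le> p then True
            else (x0 - t2 + z2) * (x2 - t0 + z0) \<le> (x1 - t1 + z1) * (x1 - t1 + z1)) \<and>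
           scan_front fs \<theta> q c x0 x1 x2 ps (t1 # t2 # ts) (z2 # zs) (tl ws))"
| "scan_front (f # fs) \<theta> q c x0 x1 x2 _ _ _ _ \<longleftrightarrow> False"

lemma scan_front_nz:
  assumes "scan_front fs \<theta> q c x0 x1 x2 ps ts zs ws" "s < length fs"
  shows "(\<exists>s'\<le>s. \<theta> \<le> nz ps s' \<and> \<theta> \<le> q) \<or> c + nz ws (2 * s) \<le> nz ps s \<or>
    (x0 - nz ts (s + 2) + nz zs (2 * s + 2)) * (x2 - nz ts s + nz zs (2 * s)) \<le>
    (x1 - nz ts (s + 1) + nz zs (2 * s + 1))\<^sup>2"
  using assms
proof (induction fs \<theta> q c x0 x1 x2 ps ts zs ws arbitrary: s rule: scan_front.induct)
  case (2 f fs \<theta> q c x0 x1 x2 p ps t0 t1 t2 ts z0 z1 z2 zs w ws)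
  show ?case
  proof (cases "\<theta> \<le> p \<and> \<theta> \<le> q")
    case True
    then show ?thesis by (intro disjI1 exI[of _ 0]) simp
  next
    case False
    show ?thesis
    proof (cases s)
      case 0
      then show ?thesis using 2(2) False by (auto simp: power2_eq_square numeral_2_eq_2 split: if_splits)
    next
      case (Suc s')
      have "(\<exists>s''\<le>s'. \<theta> \<le> nz ps s'' \<and> \<theta> \<le> q) \<or> c + nz (tl ws) (2 * s') \<le> nz ps s' \<or>
        (x0 - nz (t1 # t2 # ts) (s' + 2) + nz (z2 # zs) (2 * s' + 2)) *
        (x2 - nz (t1 # t2 # ts) s' + nz (z2 # zs) (2 * s')) \<le>
        (x1 - nz (t1 # t2 # ts) (s' + 1) + nz (z2 # zs) (2 * s' + 1))\<^sup>2"
        by (rule 2(1)[OF False]) (use 2 False Suc in auto)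
      then show ?thesis
      proof (elim disjE)
        assume "\<exists>s''\<le>s'. \<theta> \<le> nz ps s'' \<and> \<theta> \<le> q"
        then obtain s'' where "s'' \<le> s'" "\<theta> \<le> nz ps s''" "\<theta> \<le> q" by blast
        then show ?thesis using Suc by (intro disjI1 exI[of _ "Suc s''"]) auto
      qed (simp_all add: Suc numeral_2_eq_2)
    qed
  qed
qed auto

text \<open>Runs through i = 0, 1, and so on. The remaining \<open>qs\<close> are the far ends of
  the later scans and also their step counter: a scan with a larger i is shorter.\<close>

fun scan_fronts :: "int list \<Rightarrow> int list \<Rightarrow> int list \<Rightarrow> int list \<Rightarrow> int list \<Rightarrow> int list \<Rightarrow>
    int list \<Rightarrow> int list \<Rightarrow> bool" where
  "scan_fronts [] xs cs ms ps ts zs ws \<longleftrightarrow> True"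
| "scan_fronts (q # qs) xs cs ms ps ts zs ws \<longleftrightarrow>
     scan_front (q # qs) (hd0 cs + hd0 ms) q (hd0 cs) (hd0 xs) (hd0 (tl xs)) (hd0 (tl (tl xs))) ps ts zs ws \<and>
     scan_fronts qs (tl xs) (tl cs) (tl ms) ps ts (tl zs) (tl ws)"

lemma scan_fronts_nth:
  assumes "scan_fronts qs xs cs ms ps ts zs ws" "i < length qs"
  shows "scan_front (drop i qs) (nz cs i + nz ms i) (qs ! i) (nz cs i) (nz xs i) (nz xs (i + 1))
    (nz xs (i + 2)) ps ts (drop i zs) (drop i ws)"
  using assms
proof (induction qs xs cs ms ps ts zs ws arbitrary: i rule: scan_fronts.induct)
  case (2 q qs xs cs ms ps ts zs ws)
  show ?case
  proof (cases i)
    case 0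
    then show ?thesis using 2 by (simp add: numeral_2_eq_2)
  next
    case (Suc i')
    then show ?thesis using 2(1)[of i'] 2(2-) by (simp add: drop_Suc)
  qed
qed auto

fun same_length :: "int list \<Rightarrow> int list \<Rightarrow> bool" where
  "same_length [] [] \<longleftrightarrow> True"
| "same_length (a # xs) (b # ys) \<longleftrightarrow> same_length xs ys"
| "same_length _ _ \<longleftrightarrow> False"

lemma same_length_iff [simp]: "same_length xs ys \<longleftrightarrow> length xs = length ys"
  by (induction xs ys rule: same_length.induct) auto

section \<open>Verification for small blocks\<close>

text \<open>The offsets are the least arguments that occur: \<open>p\<close> starts at
  \<open>d2 T 1\<close> but k >= 2; 2 k + j >= 5 for k >= 2 and j >= 1; and 2 k - i >= i + 4 for k
  >= i + 2. The zeros in front of the reversed lists let the scans begin at k = w + 2, beyond the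
  support of \<open>Y\<close>.\<close>

definition half_check :: "int list \<Rightarrow> int list \<Rightarrow> int list \<Rightarrow> int list \<Rightarrow> int list \<Rightarrow> int list \<Rightarrow> int list \<Rightarrow> bool" where
  "half_check X Y x y p pr tr \<longleftrightarrow>
    (let m = suffix_maxs y; y1 = tl y; zs = map (\<lambda>_. 0) X in
     list_all (\<lambda>v. 0 \<le> v) y1 \<and>
     left_concave (tl p) y1 (tl (tl (tl (tl y1)))) (tl (tl (tl (tl (tl m))))) \<and>
     scan_fronts (tl p) X x (tl (tl (tl (tl m)))) pr tr
       (zs @ 0 # 0 # 0 # rev (tl Y)) (zs @ 0 # rev y))"

lemma nz_zeros: "k < n \<Longrightarrow> nz (replicate n 0 @ xs) k = 0"
  by (simp add: nz_def nth_append)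

lemma half_check_run_ok:
  fixes X Y T :: "int \<Rightarrow> int"
  assumes chk: "half_check Xl Yl (diffs2 Xl) (diffs2 Yl) pl (rev pl) (0 # 0 # 0 # rev tl')"
    and X: "\<And>m. nz Xl m = X (int m - 1)" "length Xl = w + 2"
    and Y: "\<And>m. nz Yl m = Y (int m - 1)" "length Yl = w + 2"
    and T: "\<And>m. nz tl' m = T (int m + 1)" "length tl' = w"
    and p: "\<And>m. nz pl m = d2 T (int m + 1)" "length pl = w + 2"
    and p0: "\<And>m. 0 \<le> nz pl m" and uni: "unimodal pl"
  shows "run_ok (int w) X Y T"
proof -
  define x y where "x = diffs2 Xl" and "y = diffs2 Yl"
  have x: "nz x m = d2 X (int m)" for m
    unfolding x_def nz_diffs2 X d2_def by (simp add: algebra_simps)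
  have y: "nz y m = d2 Y (int m)" for m
    unfolding y_def nz_diffs2 Y d2_def by (simp add: algebra_simps)
  have leny: "length y = w + 2" by (simp add: y_def Y)
  define m where "m = suffix_maxs y"
  have mx: "nz y k \<le> nz m j" if "j \<le> k" for j k unfolding m_def by (rule nz_suffix_maxs[OF that])
  define zs :: "int list" where "zs = map (\<lambda>_. 0) Xl"
  have zs: "zs = replicate (w + 2) 0" unfolding zs_def using X(2) by (simp add: map_replicate_const)
  define Zl where "Zl = zs @ 0 # 0 # 0 # rev (tl Yl)"
  define Wl where "Wl = zs @ 0 # rev y"
  have c1: "list_all (\<lambda>v. 0 \<le> v) (tl y)"
    and c2: "left_concave (tl pl) (tl y) (tl (tl (tl (tl (tl y))))) (tl (tl (tl (tl (tl m)))))"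
    and c3: "scan_fronts (tl pl) Xl x (tl (tl (tl (tl m)))) (rev pl) (0 # 0 # 0 # rev tl') Zl Wl"
    using chk unfolding half_check_def Let_def x_def y_def m_def zs_def Zl_def Wl_def by auto
  have ypos: "0 \<le> nz y (Suc j)" for j
    using c1 leny by (cases "j < length (tl y)") (auto simp: nz_def list_all_length nth_tl)
  have Y0: "Y i = 0" if "int w < i" for i
    using Y(1)[of "nat (i + 1)"] Y(2) that by (simp add: nz_beyond)
  have T0: "T k = 0" if "int w < k" for k
    using T(1)[of "nat (k - 1)"] T(2) that by (simp add: nz_beyond)
  have pk: "nz pl (nat (k - 1)) = d2 T k" if "1 \<le> k" for k using p(1)[of "nat (k - 1)"] that by simp
  have "d2 Y (2 * k + j) \<le> d2 T k + d2 Y j" if kj: "2 \<le> k" "1 \<le> j" for k j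
  proof -
    have "nz (tl (tl (tl (tl (tl y))))) (2 * nat (k - 2) + nat (j - 1)) \<le> nz (tl pl) (nat (k - 2)) + nz (tl y) (nat (j - 1))"
    proof (rule left_concave_nz[OF c2])
      show "0 \<le> nz (tl y) j" for j using ypos[of j] by simp
      show "0 \<le> nz (tl pl) j" for j using p0[of "Suc j"] by simp
      show "nz (tl (tl (tl (tl (tl y))))) k \<le> nz (tl (tl (tl (tl (tl m))))) j" if "j \<le> k" for j k
        using mx[of "j + 5" "k + 5"] that by (simp add: eval_nat_numeral)
    qed
    then show ?thesis
      using kj y[of "Suc (Suc (Suc (Suc (Suc (2 * nat (k - 2) + nat (j - 1))))))"] y[of "Suc (nat (j - 1))"]
        p(1)[of "Suc (nat (k - 2))"] by (simp add: algebra_simps)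
  qed
  moreover have "d2 X i + d2 Y (2 * k - i) \<le> d2 T k \<or>
      (X (i - 1) - T (k - 1) + Y (2 * k - i - 1)) * (X (i + 1) - T (k + 1) + Y (2 * k - i + 1)) \<le>
      (X i - T k + Y (2 * k - i))\<^sup>2" if ik: "0 \<le> i" "i + 2 \<le> k" "k \<le> int w + 2" for i k
  proof -
    \<comment> \<open>The scan starts at k = w + 2 and goes down, so \<open>s\<close> is the
      position in the reversed lists.\<close>
    define a s where "a = nat i" and "s = nat (int w + 2 - k)"
    have i: "i = int a" and k: "k = int w + 2 - int s" and as: "a + s \<le> w"
      using ik by (auto simp: a_def s_def)
    have lp: "length (tl pl) = w + 1" using p by simp
    note sc = scan_fronts_nth[OF c3, of a]
    have tr: "nz (0 # 0 # 0 # rev tl') j = T (int w + 3 - int j)" if "j \<le> w + 2" for j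
    proof -
      have "j = 0 \<or> j = 1 \<or> j = 2 \<or> (\<exists>j'. j = j' + 3)" by presburger
      then show ?thesis
      proof (elim disjE exE)
        fix j' assume j: "j = j' + 3"
        then have "nz (0 # 0 # 0 # rev tl') j = nz tl' (w - 1 - j')"
          using that by (simp add: nz_rev T(2) eval_nat_numeral)
        also have "\<dots> = T (int w + 3 - int j)"
          unfolding T(1) by (rule arg_cong[of _ _ T]) (use j that in \<open>simp add: of_nat_diff\<close>)
        finally show ?thesis .
      qed (simp_all add: T0 numeral_2_eq_2)
    qed
    have Zn: "nz Zl j = Y (2 * int w + 5 - int j)" if "j \<le> 2 * w + 5" for j
    proof (cases "j < w + 5")
      case True
      have "Zl = replicate (w + 5) 0 @ rev (tl Yl)"
        unfolding Zl_def zs by (simp add: replicate_append_same[symmetric] eval_nat_numeral)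
      then have "nz Zl j = 0" using True by (simp only: nz_zeros)
      then show ?thesis using True by (simp add: Y0)
    next
      case False
      have "Zl = replicate (w + 5) 0 @ rev (tl Yl)"
        unfolding Zl_def zs by (simp add: replicate_append_same[symmetric] eval_nat_numeral)
      moreover have "j - (w + 5) < Suc w" using False that by linarith
      ultimately have "nz Zl j = nz (tl Yl) (w - (j - (w + 5)))"
        using False Y(2) by (simp add: nz_append nz_rev)
      also have "\<dots> = Y (2 * int w + 5 - int j)"
        unfolding nz_tl Y(1) by (rule arg_cong[of _ _ Y]) (use False that in \<open>simp add: of_nat_diff\<close>)
      finally show ?thesis .
    qed
    have Wn: "nz Wl j = d2 Y (2 * int w + 4 - int j)" if "j \<le> 2 * w + 4" for j
    proof (cases "j < w + 3")
      case True
      have "Wl = replicate (w + 3) 0 @ rev y"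
        unfolding Wl_def zs by (simp add: replicate_append_same[symmetric] eval_nat_numeral)
      then have "nz Wl j = 0" using True by (simp only: nz_zeros)
      then show ?thesis using True by (simp add: Y0 d2_def)
    next
      case False
      have "Wl = replicate (w + 3) 0 @ rev y"
        unfolding Wl_def zs by (simp add: replicate_append_same[symmetric] eval_nat_numeral)
      moreover have "j - (w + 3) < Suc (Suc w)" using False that by linarith
      ultimately have "nz Wl j = nz y (w + 1 - (j - (w + 3)))"
        using False leny by (simp add: nz_append nz_rev)
      also have "\<dots> = d2 Y (2 * int w + 4 - int j)"
        unfolding y by (rule arg_cong[of _ _ "d2 Y"]) (use False that in \<open>simp add: of_nat_diff\<close>)
      finally show ?thesis .
    qed
    have pr: "nz (rev pl) j = d2 T (int w + 2 - int j)" if "j \<le> w + 1" for j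
    proof -
      have "nz (rev pl) j = nz pl (w + 1 - j)" using that by (simp add: nz_rev p(2))
      also have "\<dots> = d2 T (int w + 2 - int j)"
        unfolding p(1) by (rule arg_cong[of _ _ "d2 T"]) (use that in \<open>simp add: of_nat_diff\<close>)
      finally show ?thesis .
    qed
    have pn: "pl ! (w + 1 - j) = d2 T (int w + 2 - int j)" if "j \<le> w + 1" for j
    proof -
      have "w + 1 - j < w + 2" by linarith
      then have "pl ! (w + 1 - j) = nz pl (w + 1 - j)" unfolding nz_def p(2) by (simp only: if_True)
      also have "\<dots> = d2 T (int w + 2 - int j)"
        unfolding p(1) by (rule arg_cong[of _ _ "d2 T"]) (use that in \<open>simp add: of_nat_diff\<close>)
      finally show ?thesis .
    qed
    have scan: "scan_front (drop a (tl pl)) (nz x a + nz (tl (tl (tl (tl m)))) a) (tl pl ! a) (nz x a)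
      (nz Xl a) (nz Xl (a + 1)) (nz Xl (a + 2)) (rev pl) (0 # 0 # 0 # rev tl') (drop a Zl) (drop a Wl)"
      by (rule sc) (use as lp in auto)
    have q: "tl pl ! a = d2 T (i + 2)"
      using p(1)[of "a + 1"] p(2) as by (simp add: nz_def nth_tl i algebra_simps)
    have Xs: "nz Xl a = X (i - 1)" "nz Xl (a + 1) = X i" "nz Xl (a + 2) = X (i + 1)"
      unfolding X i by (simp_all add: algebra_simps)
    have bound: "d2 X i + d2 Y (2 * k - i) \<le> nz x a + nz (tl (tl (tl (tl m)))) a"
    proof -
      have "nz y (nat (2 * k - i)) \<le> nz m (a + 4)" by (rule mx) (use ik i in linarith)
      then show ?thesis using ik by (simp add: x y i eval_nat_numeral)
    qed
    from scan_front_nz[OF scan, of s] as lp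
    have "(\<exists>s'\<le>s. nz x a + nz (tl (tl (tl (tl m)))) a \<le> nz (rev pl) s' \<and>
          nz x a + nz (tl (tl (tl (tl m)))) a \<le> tl pl ! a) \<or>
       nz x a + nz (drop a Wl) (2 * s) \<le> nz (rev pl) s \<or>
       (nz Xl a - nz (0 # 0 # 0 # rev tl') (s + 2) + nz (drop a Zl) (2 * s + 2)) *
       (nz Xl (a + 2) - nz (0 # 0 # 0 # rev tl') s + nz (drop a Zl) (2 * s)) \<le>
       (nz Xl (a + 1) - nz (0 # 0 # 0 # rev tl') (s + 1) + nz (drop a Zl) (2 * s + 1))\<^sup>2"
      by auto
    then show ?thesis
    proof (elim disjE)
      assume "\<exists>s'\<le>s. nz x a + nz (tl (tl (tl (tl m)))) a \<le> nz (rev pl) s' \<and>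
          nz x a + nz (tl (tl (tl (tl m)))) a \<le> tl pl ! a"
      then obtain s' where s': "s' \<le> s" "nz x a + nz (tl (tl (tl (tl m)))) a \<le> nz (rev pl) s'"
        "nz x a + nz (tl (tl (tl (tl m)))) a \<le> tl pl ! a" by blast
      \<comment> \<open>The scan may have stopped earlier, at \<open>s'\<close>; the present k lies
        between that place and the far end.\<close>
      have "min (pl ! (a + 1)) (pl ! (w + 1 - s')) \<le> pl ! (w + 1 - s)"
        by (rule unimodal_nth[OF uni]) (use as s' p in auto)
      moreover have "pl ! (a + 1) = d2 T (i + 2)" using q as lp by (simp add: nth_tl)
      moreover have "pl ! (w + 1 - s') = nz (rev pl) s'" using pn[of s'] pr[of s'] s' as by simp
      moreover have "pl ! (w + 1 - s) = d2 T k"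
        using pn[of s] as by (simp add: k)
      ultimately have "nz x a + nz (tl (tl (tl (tl m)))) a \<le> d2 T k" using s' q by auto
      with bound show ?thesis by linarith
    next
      assume "nz x a + nz (drop a Wl) (2 * s) \<le> nz (rev pl) s"
      moreover have "nz (drop a Wl) (2 * s) = d2 Y (2 * k - i)"
        using Wn[of "a + 2 * s"] as by (simp add: k i algebra_simps)
      moreover have "nz (rev pl) s = d2 T k" using pr[of s] as by (simp add: k)
      ultimately show ?thesis by (simp add: x i)
    next
      assume A: "(nz Xl a - nz (0 # 0 # 0 # rev tl') (s + 2) + nz (drop a Zl) (2 * s + 2)) *
       (nz Xl (a + 2) - nz (0 # 0 # 0 # rev tl') s + nz (drop a Zl) (2 * s)) \<le>
       (nz Xl (a + 1) - nz (0 # 0 # 0 # rev tl') (s + 1) + nz (drop a Zl) (2 * s + 1))\<^sup>2"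
      have B: "nz (0 # 0 # 0 # rev tl') (s + 2) = T (k - 1)" "nz (0 # 0 # 0 # rev tl') s = T (k + 1)"
        "nz (0 # 0 # 0 # rev tl') (s + 1) = T k"
        using tr[of "s + 2"] tr[of s] tr[of "s + 1"] as by (simp_all add: k algebra_simps)
      have C: "nz (drop a Zl) (2 * s + 2) = Y (2 * k - i - 1)" "nz (drop a Zl) (2 * s) = Y (2 * k - i + 1)"
        "nz (drop a Zl) (2 * s + 1) = Y (2 * k - i)"
        using Zn[of "a + (2 * s + 2)"] Zn[of "a + 2 * s"] Zn[of "a + (2 * s + 1)"] as
        unfolding nz_drop by (simp_all add: k i algebra_simps)
      show ?thesis using A unfolding Xs B C by blast
    qed
  qed
  ultimately show ?thesis unfolding run_ok_def by blast
qed


section \<open>The test at one pair and the traversal of the tree\<close>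

text \<open>The prepended values are those at - 1, obtained from
  \<open>X i + Y (- i) = X 0 + Y 0\<close>. The gap list has its last positive entry at
  \<open>w\<close>, followed by the 0 at \<open>w + 1\<close>; being unimodal with positive ends up
  to \<open>w\<close>, it is positive there. The two calls of \<open>half_check\<close> serve larger
  blocks with remainder a and with remainder r modulo a + r.\<close>

definition node_check :: "int list \<Rightarrow> int list \<Rightarrow> int list \<Rightarrow> int list \<Rightarrow> bool" where
  "node_check H T X0 Y0 \<longleftrightarrow>
    (let X = (hd0 X0 + hd0 Y0 - hd0 (tl Y0)) # X0; Y = (hd0 X0 + hd0 Y0 - hd0 (tl X0)) # Y0;
       x = diffs2 X; y = diffs2 Y; p = gaps H @ [0]; pr = rev p; tr = 0 # 0 # 0 # rev T in
     unimodal p \<and> same_length X0 H \<and> same_length Y0 H \<and> 1 \<le> hd0 p \<and> 1 \<le> hd0 (tl pr) \<and>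
     half_check X Y x y p pr tr \<and> half_check Y X y x p pr tr)"

text \<open>Nodes list the values of symmetric functions at \<open>0, 1, \<dots>\<close>, and those of \<open>U\<close>
  separately at \<open>1, 2, \<dots>\<close> and at \<open>0, -1, \<dots>\<close>.\<close>

fun tree_check :: "nat \<Rightarrow> int \<Rightarrow> int \<Rightarrow> int \<Rightarrow> int list \<Rightarrow> int list \<Rightarrow> int list \<Rightarrow> int list \<Rightarrow> bool" where
  "tree_check 0 m a r P Q U V \<longleftrightarrow> False"
| "tree_check (Suc n) m a r P Q U V \<longleftrightarrow> (if m < a + r then True else
    (let H = add_list (add_list P Q) (add_list (hd0 V # U) V);
       pu = add_list P (hd0 V # U); qu = add_list Q (hd0 V # U);
       t = tl (suffix_sums H); T = add_list t (tl t) in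
     node_check H T (add_list pu t) (add_list qu t) \<and>
     tree_check n m (a + r) a H P pu (add_list (tl P) (tl V)) \<and>
     tree_check n m (a + r) r H Q qu (add_list (tl Q) (tl V))))"

definition node_good :: "(int \<Rightarrow> int) \<Rightarrow> (int \<Rightarrow> int) \<Rightarrow> (int \<Rightarrow> int) \<Rightarrow> bool" where
  "node_good P Q U \<longleftrightarrow> (let H = \<lambda>k. P k + Q k + U k + U (- k) in
     \<exists>w\<ge>0. (\<forall>k. w < \<bar>k\<bar> \<longrightarrow> H k = 0) \<and> (\<forall>k. 1 \<le> k \<and> k \<le> w + 1 \<longrightarrow> H (k + 1) < H (k - 1)) \<and>
       (\<forall>i>w. P i + U i = 0 \<and> Q i + U i = 0) \<and>
       run_ok w (\<lambda>i. P i + U i + tail H w (i + 1)) (\<lambda>i. Q i + U i + tail H w (i + 1))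
         (\<lambda>k. tail H w k + tail H w (k + 1)) \<and>
       run_ok w (\<lambda>i. Q i + U i + tail H w (i + 1)) (\<lambda>i. P i + U i + tail H w (i + 1))
         (\<lambda>k. tail H w k + tail H w (k + 1)))"

lemma node_check_good:
  assumes P: "\<And>k. nz Pl k = P (int k)" "\<And>k. P (- k) = P k"
    and Q: "\<And>k. nz Ql k = Q (int k)" "\<And>k. Q (- k) = Q k"
    and U: "\<And>k. nz Ul k = U (int k + 1)" and V: "\<And>k. nz Vl k = U (- int k)"
  defines "Hl \<equiv> add_list (add_list Pl Ql) (add_list (hd0 Vl # Ul) Vl)"
  defines "tl' \<equiv> tl (suffix_sums Hl)"
  assumes chk: "node_check Hl (add_list tl' (tl tl')) (add_list (add_list Pl (hd0 Vl # Ul)) tl')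
    (add_list (add_list Ql (hd0 Vl # Ul)) tl')"
  shows "node_good P Q U"
proof -
  define H where "H = (\<lambda>k. P k + Q k + U k + U (- k))"
  define w where "w = length Hl - 1"
  have Hne: "length Hl = w + 1" unfolding w_def Hl_def by simp
  have UV: "nz (hd0 Vl # Ul) k = U (int k)" for k
    using U V by (cases k) (simp_all add: algebra_simps)
  have Hl: "nz Hl k = H (int k)" for k
    unfolding Hl_def nz_add_list UV P Q V H_def by simp
  have Hsym: "H (- k) = H k" for k unfolding H_def P Q by simp
  have H0: "H k = 0" if "int w < \<bar>k\<bar>" for k
  proof -
    have "H \<bar>k\<bar> = 0" using Hl[of "nat \<bar>k\<bar>"] Hne that by (simp add: nz_beyond)
    then show ?thesis using Hsym[of k] by (simp add: abs_if split: if_splits)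
  qed
  let ?t = "tail H (int w)"
  have step: "?t k = H k + ?t (k + 1)" for k by (rule tail_step) (use H0 in auto)
  have ss: "nz (suffix_sums Hl) k = ?t (int k)" for k
  proof (induction "Suc w - k" arbitrary: k)
    case 0
    then show ?case using Hne by (simp add: nz_beyond tail_def)
  next
    case (Suc n)
    then have "nz (suffix_sums Hl) (Suc k) = ?t (int (Suc k))" by simp
    then show ?case using nz_suffix_sums[of Hl k] step[of "int k"] Hl[of k] by (simp add: algebra_simps)
  qed
  have t: "nz tl' k = ?t (int k + 1)" for k unfolding tl'_def by (simp add: ss algebra_simps)
  define X where "X = (\<lambda>i. P i + U i + ?t (i + 1))"
  define Y where "Y = (\<lambda>i. Q i + U i + ?t (i + 1))"
  define T where "T = (\<lambda>k. ?t k + ?t (k + 1))"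
  define X0 Y0 Tl where "X0 = add_list (add_list Pl (hd0 Vl # Ul)) tl'"
    and "Y0 = add_list (add_list Ql (hd0 Vl # Ul)) tl'" and "Tl = add_list tl' (tl tl')"
  have X0: "nz X0 k = X (int k)" for k unfolding X0_def nz_add_list UV P(1) t X_def by simp
  have Y0: "nz Y0 k = Y (int k)" for k unfolding Y0_def nz_add_list UV Q(1) t Y_def by simp
  have Tl: "nz Tl k = T (int k + 1)" for k
    unfolding Tl_def nz_add_list nz_tl t T_def by (simp add: algebra_simps)
  have lenT: "length Tl = w" using Hne by (simp add: Tl_def tl'_def)
  define Xl Yl pl where "Xl = (hd0 X0 + hd0 Y0 - hd0 (tl Y0)) # X0"
    and "Yl = (hd0 X0 + hd0 Y0 - hd0 (tl X0)) # Y0" and "pl = gaps Hl @ [0]"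
  have c: "unimodal pl" "length X0 = w + 1" "length Y0 = w + 1" "1 \<le> nz pl 0" "1 \<le> nz (rev pl) 1"
    "half_check Xl Yl (diffs2 Xl) (diffs2 Yl) pl (rev pl) (0 # 0 # 0 # rev Tl)"
    "half_check Yl Xl (diffs2 Yl) (diffs2 Xl) pl (rev pl) (0 # 0 # 0 # rev Tl)"
    using chk Hne unfolding node_check_def Let_def Xl_def Yl_def pl_def X0_def Y0_def Tl_def by auto
  have XY: "X i + Y (- i) = ?t 0 + ?t 1" for i
  proof -
    have "?t (- (k + 1)) + ?t (k + 1 + 1) = ?t (- k) + ?t (k + 1)" for k
      using step[of "- (k + 1)"] step[of "k + 1"] Hsym[of "k + 1"] by simp
    from int_fun_const[of "\<lambda>k. ?t (- k) + ?t (k + 1)" "i - 1", OF this]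
    have "?t (- i + 1) + ?t i = ?t 0 + ?t 1" by simp
    then show ?thesis unfolding X_def Y_def using step[of i] Q(2)[of i] by (simp add: H_def)
  qed
  \<comment> \<open>The case \<open>m = 0\<close> is the argument - 1, whose value comes from
    \<open>XY\<close> instead of the lists.\<close>
  have Xl: "nz Xl m = X (int m - 1)" for m
    using XY[of "- 1"] XY[of 0] by (cases m) (simp_all add: Xl_def X0 Y0)
  have Yl: "nz Yl m = Y (int m - 1)" for m
    using XY[of 1] XY[of 0] by (cases m) (simp_all add: Yl_def X0 Y0)
  have d2T: "d2 T k = H (k - 1) - H (k + 1)" for k
    unfolding d2_def T_def using step[of "k - 1"] step[of k] step[of "k + 1"] by (simp add: algebra_simps)
  have pl: "nz pl m = d2 T (int m + 1)" for m
  proof (cases "m \<le> w")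
    case True
    then show ?thesis unfolding pl_def d2T by (simp add: nz_append nz_gaps Hl Hne algebra_simps)
  next
    case False
    then have "nz pl m = 0" unfolding pl_def nz_append using Hne by (cases "m - (w + 1)") auto
    then show ?thesis using False by (simp add: d2T H0)
  qed
  have lenp: "length pl = w + 2" by (simp add: pl_def Hne)
  have "nz (rev pl) 1 = nz pl w" by (simp add: nz_rev lenp)
  then have pw: "1 \<le> pl ! w" using c(5) lenp by (simp add: nz_def)
  \<comment> \<open>Positive gaps mean that \<open>H\<close> decreases strictly along both parity
    classes up to the end of its support.\<close>
  have ppos: "1 \<le> nz pl m" if "m \<le> w" for m
  proof -
    have "min (pl ! 0) (pl ! w) \<le> pl ! m" by (rule unimodal_nth[OF c(1)]) (use that lenp in auto)
    then show ?thesis using c(4) pw that lenp by (auto simp: nz_def)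
  qed
  have p0: "0 \<le> nz pl m" for m
  proof (cases "m \<le> w")
    case False
    then show ?thesis unfolding pl d2T by (simp add: H0)
  qed (use ppos[of m] in auto)
  have Hs: "H (k + 1) < H (k - 1)" if "1 \<le> k" "k \<le> int w + 1" for k
  proof -
    have "nat (k - 1) \<le> w" using that by linarith
    then show ?thesis using ppos[of "nat (k - 1)"] pl[of "nat (k - 1)"] that by (simp add: d2T)
  qed
  have Z: "P i + U i = 0 \<and> Q i + U i = 0" if "int w < i" for i
  proof -
    have "X i = 0" "Y i = 0"
      using X0[of "nat i"] Y0[of "nat i"] c(2,3) that by (simp_all add: nz_beyond)
    then show ?thesis using that by (simp add: X_def Y_def tail_def)
  qed
  have "run_ok (int w) X Y T"
    by (rule half_check_run_ok[OF c(6) Xl _ Yl _ Tl lenT pl lenp p0 c(1)])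
      (use c in \<open>simp_all add: Xl_def Yl_def\<close>)
  moreover have "run_ok (int w) Y X T"
    by (rule half_check_run_ok[OF c(7) Yl _ Xl _ Tl lenT pl lenp p0 c(1)])
      (use c in \<open>simp_all add: Xl_def Yl_def\<close>)
  ultimately show ?thesis
    unfolding node_good_def Let_def H_def[symmetric] X_def Y_def T_def
    using H0 Hs Z by (intro exI[of _ "int w"]) auto
qed

lemma node_good_swap: "node_good P Q U \<Longrightarrow> node_good Q P U"
  unfolding node_good_def Let_def by (auto simp: add.commute[of "Q _" "P _"])

lemma node_good_unimodal:
  assumes "node_good P Q U" "\<And>k. P (- k) = P k" "\<And>k. Q (- k) = Q k"
  shows "parity_unimodal (\<lambda>k. P k + Q k + U k + U (- k))"
proof -
  obtain w where w: "0 \<le> w" "\<And>k. w < \<bar>k\<bar> \<Longrightarrow> P k + Q k + U k + U (- k) = 0"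
    "\<And>k. 1 \<le> k \<Longrightarrow> k \<le> w + 1 \<Longrightarrow> P (k + 1) + Q (k + 1) + U (k + 1) + U (- (k + 1)) <
       P (k - 1) + Q (k - 1) + U (k - 1) + U (- (k - 1))"
    using assms(1) unfolding node_good_def Let_def by blast
  show ?thesis
  proof (rule parity_unimodalI)
    fix k :: int assume "1 \<le> k"
    then show "P (k + 1) + Q (k + 1) + U (k + 1) + U (- (k + 1)) \<le>
       P (k - 1) + Q (k - 1) + U (k - 1) + U (- (k - 1))"
      using w(2)[of "k + 1"] w(2)[of "k - 1"] w(3)[of k] by (cases "k \<le> w + 1") auto
  qed (simp add: assms)
qed

text \<open>The lists and the fuel are hidden, since only their existence matters. The three
  monotonicity properties are carried along because \<open>node_profile\<close> requires them; they
  pass from a pair to its children.\<close>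

definition checked :: "nat \<Rightarrow> nat \<Rightarrow> (int \<Rightarrow> int) \<Rightarrow> (int \<Rightarrow> int) \<Rightarrow> (int \<Rightarrow> int) \<Rightarrow> bool" where
  "checked a r P Q U \<longleftrightarrow> (\<exists>n Pl Ql Ul Vl. tree_check n 128 (int a) (int r) Pl Ql Ul Vl \<and>
     (\<forall>k. nz Pl k = P (int k)) \<and> (\<forall>k. nz Ql k = Q (int k)) \<and> (\<forall>k. nz Ul k = U (int k + 1)) \<and>
     (\<forall>k. nz Vl k = U (- int k))) \<and> parity_unimodal P \<and> parity_unimodal Q \<and> right_heavy U"

text \<open>Unimodality of \<open>H\<close> for the children is not inherited but read off from the
  check at the node itself.\<close>

lemma checked_step:
  assumes c: "checked a r P Q U" and ar: "a + r \<le> 128"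
    and sym: "\<And>k. P (- k) = P k" "\<And>k. Q (- k) = Q k"
  defines "H \<equiv> \<lambda>k. P k + Q k + U k + U (- k)"
  shows "node_good P Q U" "checked (a + r) a H P (\<lambda>k. P (k - 1) + U (k - 1))"
    "checked (a + r) r H Q (\<lambda>k. Q (k - 1) + U (k - 1))"
proof -
  obtain n Pl Ql Ul Vl where t: "tree_check n 128 (int a) (int r) Pl Ql Ul Vl"
    and r: "\<And>k. nz Pl k = P (int k)" "\<And>k. nz Ql k = Q (int k)" "\<And>k. nz Ul k = U (int k + 1)"
      "\<And>k. nz Vl k = U (- int k)"
    and pu: "parity_unimodal P" "parity_unimodal Q" "right_heavy U"
    using c unfolding checked_def by blast
  obtain n' where n: "n = Suc n'" using t by (cases n) auto
  define Hl where "Hl = add_list (add_list Pl Ql) (add_list (hd0 Vl # Ul) Vl)"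
  define t' where "t' = tl (suffix_sums Hl)"
  have chk: "node_check Hl (add_list t' (tl t')) (add_list (add_list Pl (hd0 Vl # Ul)) t')
      (add_list (add_list Ql (hd0 Vl # Ul)) t')"
    and t1: "tree_check n' 128 (int a + int r) (int a) Hl Pl (add_list Pl (hd0 Vl # Ul)) (add_list (tl Pl) (tl Vl))"
    and t2: "tree_check n' 128 (int a + int r) (int r) Hl Ql (add_list Ql (hd0 Vl # Ul)) (add_list (tl Ql) (tl Vl))"
    using t ar unfolding n Hl_def t'_def by (simp_all add: Let_def)
  show good: "node_good P Q U"
    by (rule node_check_good[where Pl = Pl and Ql = Ql and Ul = Ul and Vl = Vl])
      (use r sym chk in \<open>simp_all add: Hl_def t'_def\<close>)
  have UV: "nz (hd0 Vl # Ul) k = U (int k)" for k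
    using r(3,4) by (cases k) (simp_all add: algebra_simps)
  have Hl: "nz Hl k = H (int k)" for k
    unfolding Hl_def nz_add_list UV r H_def by simp
  have puH: "parity_unimodal H" unfolding H_def by (rule node_good_unimodal[OF good sym])
  have e: "- int k - 1 = - (1 + int k)" for k by simp
  have V: "nz (add_list (tl Rl) (tl Vl)) k = R (- int k - 1) + U (- int k - 1)"
    if "\<And>k. nz Rl k = R (int k)" "\<And>k. R (- k) = R k" for R Rl k
    unfolding nz_add_list nz_tl that(1) r(4) e that(2) by simp
  have W: "nz (add_list Rl (hd0 Vl # Ul)) k = R (int k + 1 - 1) + U (int k + 1 - 1)"
    if "\<And>k. nz Rl k = R (int k)" for R Rl k
    unfolding nz_add_list UV that by simp
  show "checked (a + r) a H P (\<lambda>k. P (k - 1) + U (k - 1))"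
    unfolding checked_def using t1 Hl r(1) puH pu right_heavy_step[OF pu(1,3)] V[OF r(1) sym(1)] W[OF r(1)]
    by (intro conjI exI[of _ n'] exI[of _ Hl] exI[of _ Pl] exI[of _ "add_list Pl (hd0 Vl # Ul)"]
      exI[of _ "add_list (tl Pl) (tl Vl)"]) (auto simp del: nz_add_list)
  show "checked (a + r) r H Q (\<lambda>k. Q (k - 1) + U (k - 1))"
    unfolding checked_def using t2 Hl r(2) puH pu right_heavy_step[OF pu(2,3)] V[OF r(2) sym(2)] W[OF r(2)]
    by (intro conjI exI[of _ n'] exI[of _ Hl] exI[of _ Ql] exI[of _ "add_list Ql (hd0 Vl # Ul)"]
      exI[of _ "add_list (tl Ql) (tl Vl)"]) (auto simp del: nz_add_list)
qed

lemma tree_check_mono: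
  "tree_check n m a r P Q U V \<Longrightarrow> tree_check (Suc n) m a r P Q U V"
proof (induction n arbitrary: a r P Q U V)
  case (Suc n)
  show ?case
  proof (cases "m < a + r")
    case False
    with Suc.prems Suc.IH show ?thesis
      unfolding tree_check.simps(2)[of "Suc n"] tree_check.simps(2)[of n] Let_def if_not_P[OF False]
      by blast
  qed simp
qed simp

lemma tree_check_mono': "n \<le> n' \<Longrightarrow> tree_check n m a r P Q U V \<Longrightarrow> tree_check n' m a r P Q U V"
  by (induction n' rule: dec_induct) (blast intro: tree_check_mono)+

section \<open>Splitting the computation into pieces\<close>

type_synonym node = "int \<times> int \<times> int list \<times> int list \<times> int list \<times> int list"

text \<open>The nodes at which a traversal with bound \<open>c\<close> stops. The empty list on
  exhausted fuel does no harm: \<open>tree_check_frontier\<close> also assumes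
  \<open>tree_check\<close> with the same fuel, which then fails.\<close>

fun frontier :: "nat \<Rightarrow> int \<Rightarrow> int \<Rightarrow> int \<Rightarrow> int list \<Rightarrow> int list \<Rightarrow> int list \<Rightarrow> int list \<Rightarrow>
    node list" where
  "frontier 0 c a r P Q U V = []"
| "frontier (Suc n) c a r P Q U V = (if c < a + r then [(a, r, P, Q, U, V)] else
    (let H = add_list (add_list P Q) (add_list (hd0 V # U) V);
       pu = add_list P (hd0 V # U); qu = add_list Q (hd0 V # U) in
     frontier n c (a + r) a H P pu (add_list (tl P) (tl V)) @
     frontier n c (a + r) r H Q qu (add_list (tl Q) (tl V))))"

text \<open>Every level raises a + r by at least 1, so fuel 130 suffices to exceed 128.\<close>

definition subtree_check :: "node \<Rightarrow> bool" where
  "subtree_check = (\<lambda>(a, r, P, Q, U, V). tree_check 130 128 a r P Q U V)"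

definition subtree_ok :: "node \<Rightarrow> bool" where
  "subtree_ok = (\<lambda>(a, r, P, Q, U, V). \<exists>n. tree_check n 128 a r P Q U V)"

lemma subtree_check_ok: "list_all subtree_check xs \<Longrightarrow> list_all subtree_ok xs"
  by (auto simp: list_all_iff subtree_check_def subtree_ok_def)

lemma tree_check_frontier:
  "tree_check n c a r P Q U V \<Longrightarrow> list_all subtree_ok (frontier n c a r P Q U V) \<Longrightarrow>
    subtree_ok (a, r, P, Q, U, V)"
proof (induction n arbitrary: a r P Q U V)
  case (Suc n)
  show ?case
  proof (cases "c < a + r")
    case True
    then show ?thesis using Suc.prems by simp
  next
    case False
    define H where "H = add_list (add_list P Q) (add_list (hd0 V # U) V)"
    have "subtree_ok (a + r, a, H, P, add_list P (hd0 V # U), add_list (tl P) (tl V))"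
      "subtree_ok (a + r, r, H, Q, add_list Q (hd0 V # U), add_list (tl Q) (tl V))"
      using Suc.prems unfolding tree_check.simps frontier.simps Let_def if_not_P[OF False] list_all_append H_def
      by (blast intro: Suc.IH)+
    then obtain k l where
      "tree_check k 128 (a + r) a H P (add_list P (hd0 V # U)) (add_list (tl P) (tl V))"
      "tree_check l 128 (a + r) r H Q (add_list Q (hd0 V # U)) (add_list (tl Q) (tl V))"
      unfolding subtree_ok_def by blast
    then have "tree_check (max k l) 128 (a + r) a H P (add_list P (hd0 V # U)) (add_list (tl P) (tl V))"
      "tree_check (max k l) 128 (a + r) r H Q (add_list Q (hd0 V # U)) (add_list (tl Q) (tl V))"
      using tree_check_mono'[of k "max k l"] tree_check_mono'[of l "max k l"] by auto
    then have "tree_check (Suc (max k l)) 128 a r P Q U V"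
      using Suc.prems(1) unfolding tree_check.simps Let_def if_not_P[OF False] H_def
      by (simp only: if_True simp_thms split: if_split)
    then show ?thesis unfolding subtree_ok_def by blast
  qed
qed simp

text \<open>The arguments describe the pair (2, 1). Cutting at 14 leaves 32 nodes, the last of which
  is (14, 1).\<close>

abbreviation "root_frontier \<equiv> frontier 20 14 2 1 [2, 1] [1] [1, 1] []"

lemma trunk: "tree_check 20 14 2 1 [2, 1] [1] [1, 1] []"
  by code_simp

lemma subtree_ok_leaf: "128 < fst x + fst (snd x) \<Longrightarrow> subtree_ok x"
  unfolding subtree_ok_def by (cases x) (auto intro!: exI[of _ "Suc 0"])

text \<open>The nodes \<open>(n, 1)\<close> carry the longest lists; their path is cut so that the pieces of the
  computation have similar cost.\<close>

definition spine :: "nat \<Rightarrow> node" where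
  "spine n = (int n, 1, rev (map int [1..<Suc n]), [1], replicate n 1, [])"

definition subtree_to :: "(node \<Rightarrow> bool) \<Rightarrow> int \<Rightarrow>
    node \<Rightarrow> bool" where
  "subtree_to leaf c = (\<lambda>(a, r, P, Q, U, V). tree_check 60 c a r P Q U V \<and>
     list_all leaf (frontier 60 c a r P Q U V))"

lemma subtree_to_ok:
  assumes "subtree_to leaf c x" and "\<And>y. leaf y \<Longrightarrow> subtree_ok y"
  shows "subtree_ok x"
proof -
  obtain a r P Q U V where x: "x = (a, r, P, Q, U, V)" by (cases x)
  then have "tree_check 60 c a r P Q U V" "list_all leaf (frontier 60 c a r P Q U V)"
    using assms(1) by (auto simp: subtree_to_def)
  moreover from this(2) have "list_all subtree_ok (frontier 60 c a r P Q U V)"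
    using assms(2) by (simp add: list_all_iff)
  ultimately show ?thesis using tree_check_frontier unfolding x by blast
qed

text \<open>The children of (n, 1) are (n + 1, 1) and (n + 1, n). The latter has sum 2 n + 1, which
  exceeds 128 from n = 64 on, so there every leaf is either out of range or the next chosen node of
  the path.\<close>

definition spine_leaf :: "nat \<Rightarrow> node \<Rightarrow> bool" where
  "spine_leaf n y = (if 128 < fst y + fst (snd y) then True else y = spine n)"

lemma spine_leaf_ok: "subtree_ok (spine n) \<Longrightarrow> spine_leaf n y \<Longrightarrow> subtree_ok y"
  using subtree_ok_leaf by (auto simp: spine_leaf_def split: if_splits)

lemma spine_104: "subtree_to (spine_leaf 117) 117 (spine 104)"
  by code_simp

lemma spine_117: "subtree_check (spine 117)"
  by code_simp

lemma spine_88: "subtree_to (spine_leaf 104) 104 (spine 88)"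
  by code_simp

lemma spine_64: "subtree_to (spine_leaf 88) 88 (spine 64)"
  by code_simp

text \<open>Below n = 64 the side branches still reach into the range, so every leaf other than (64,
  1) is checked in full.\<close>

lemma spine_14: "subtree_to (\<lambda>y. if y = spine 64 then True else subtree_check y) 64 (spine 14)"
  by code_simp

lemma pieces_0: "list_all subtree_check (take 5 (drop 0 root_frontier))"
  by code_simp

lemma pieces_5: "list_all subtree_check (take 5 (drop 5 root_frontier))"
  by code_simp

lemma pieces_10: "list_all subtree_check (take 1 (drop 10 root_frontier))"
  by code_simp

lemma pieces_11: "list_all subtree_check (take 4 (drop 11 root_frontier))"
  by code_simp

lemma pieces_15: "list_all subtree_check (take 4 (drop 15 root_frontier))"
  by code_simp

lemma pieces_19: "list_all subtree_check (take 3 (drop 19 root_frontier))"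
  by code_simp

lemma pieces_22: "list_all subtree_check (take 4 (drop 22 root_frontier))"
  by code_simp

lemma pieces_26: "list_all subtree_check (take 5 (drop 26 root_frontier))"
  by code_simp

lemma spine_top: "drop 31 root_frontier = [spine 14]"
  by code_simp

lemma spine_ok: "subtree_ok (spine 14)"
proof -
  have "subtree_ok (spine 117)"
    using spine_117 by (auto simp: subtree_check_def subtree_ok_def split: prod.splits)
  then have "subtree_ok (spine 104)" using subtree_to_ok[OF spine_104] spine_leaf_ok by blast
  then have "subtree_ok (spine 88)" using subtree_to_ok[OF spine_88] spine_leaf_ok by blast
  then have s: "subtree_ok (spine 64)" using subtree_to_ok[OF spine_64] spine_leaf_ok by blast
  show ?thesis
    by (rule subtree_to_ok[OF spine_14])
      (use s subtree_check_ok[of "[_]"] in \<open>auto split: if_splits\<close>)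
qed

lemma pieces: "list_all subtree_ok root_frontier"
proof -
  have join: "list_all f (drop i xs)" if "list_all f (take m (drop i xs))" "list_all f (drop (i + m) xs)"
    for f i m and xs :: "'c list"
    using that by (metis append_take_drop_id drop_drop add.commute list_all_append)
  have "list_all subtree_ok (drop 31 root_frontier)" unfolding spine_top using spine_ok by simp
  from join[OF subtree_check_ok[OF pieces_26]] this have "list_all subtree_ok (drop 26 root_frontier)" by simp
  from join[OF subtree_check_ok[OF pieces_22]] this have "list_all subtree_ok (drop 22 root_frontier)" by simp
  from join[OF subtree_check_ok[OF pieces_19]] this have "list_all subtree_ok (drop 19 root_frontier)" by simp
  from join[OF subtree_check_ok[OF pieces_15]] this have "list_all subtree_ok (drop 15 root_frontier)" by simp
  from join[OF subtree_check_ok[OF pieces_11]] this have "list_all subtree_ok (drop 11 root_frontier)" by simp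
  from join[OF subtree_check_ok[OF pieces_10]] this have "list_all subtree_ok (drop 10 root_frontier)" by simp
  from join[OF subtree_check_ok[OF pieces_5]] this have "list_all subtree_ok (drop 5 root_frontier)" by simp
  from join[OF subtree_check_ok[OF pieces_0]] this have "list_all subtree_ok (drop 0 root_frontier)" by simp
  then show ?thesis by (simp only: drop_0)
qed

lemma tree_root: "\<exists>n. tree_check n 128 2 1 [2, 1] [1] [1, 1] []"
  using tree_check_frontier[OF trunk pieces] by (simp add: subtree_ok_def)

lemma unit_node: "tree_check 2 2 1 1 [1] [1] [1] []"
  by code_simp

text \<open>The pair (1, 1) lies above the root, since r < a fails for it; its check decides the
  block size 2.\<close>

lemma unit_good:
  "node_good (\<lambda>k. of_bool (k = 0)) (\<lambda>k. of_bool (k = 0)) (\<lambda>k. of_bool (k = 1))"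
  by (rule node_check_good[where Pl = "[1]" and Ql = "[1]" and Ul = "[1]" and Vl = "[]"])
    (use unit_node in \<open>auto simp: numeral_2_eq_2 Let_def nz_def\<close>)

lemma checked_root:
  "checked 2 1 (\<lambda>k. of_bool (k = 0) + of_bool (k = 0) + of_bool (k = 1) + of_bool (- k = 1))
    (\<lambda>k. of_bool (k = 0)) (\<lambda>k. of_bool (k - 1 = 0) + of_bool (k - 1 = 1))"
  (is "checked 2 1 ?P ?Q ?U")
proof -
  have u: "parity_unimodal ?Q" by (rule parity_unimodalI) auto
  have "parity_unimodal ?P"
    by (rule node_good_unimodal[OF unit_good]) auto
  moreover have "right_heavy (\<lambda>k. of_bool (k = 1) :: int)"
    unfolding right_heavy_def by auto
  from right_heavy_step[OF u this] have "right_heavy ?U" .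
  moreover have "nz [2, 1] k = ?P (int k)" for k by (auto simp: nz_def nth_Cons' less_Suc_eq numeral_2_eq_2)
  moreover have "nz [1] k = ?Q (int k)" for k by (auto simp: nz_def)
  moreover have "nz [1, 1] k = ?U (int k + 1)" for k by (auto simp: nz_def nth_Cons' less_Suc_eq numeral_2_eq_2)
  moreover have "nz [] k = ?U (- int k)" for k by auto
  moreover obtain n where "tree_check n 128 2 1 [2, 1] [1] [1, 1] []" using tree_root by blast
  ultimately show ?thesis unfolding checked_def using u by (intro conjI exI[of _ n] exI[of _ "[2, 1]"]
      exI[of _ "[1]"] exI[of _ "[1, 1]"] exI[of _ "[]"]) auto
qed

section \<open>All smaller blocks up to 128\<close>

text \<open>The predecessor (r, a - r) is a node of the tree, the swap of a node, or (1, 1). Its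
  data are returned as well, because the profile of (a, n a + r) is expressed through them.\<close>

lemma state_checked:
  assumes "state a r P Q U" "r < a" "a \<le> 128"
  shows "checked a r P Q U \<and> (\<exists>Q0 U0. node_good Q Q0 U0 \<and> (\<forall>k. Q0 (- k) = Q0 k) \<and>
    right_heavy U0 \<and> P = (\<lambda>k. Q k + Q0 k + U0 k + U0 (- k)) \<and> U = (\<lambda>k. Q (k - 1) + U0 (k - 1)))"
  using assms
proof (induction a arbitrary: r P Q U rule: less_induct)
  case (less a)
  obtain Q0 U0 where s: "state r (a - r) Q Q0 U0" and P: "P = (\<lambda>k. Q k + Q0 k + U0 k + U0 (- k))"
    and U: "U = (\<lambda>k. Q (k - 1) + U0 (k - 1))"
    by (rule state_left_cases[OF state_swap[OF less.prems(1)] less.prems(2)])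
  have sym: "Q (- k) = Q k" "Q0 (- k) = Q0 k" for k using state_sym[OF s] by auto
  have pos: "0 < r" "0 < a - r" using state_pos[OF s] by auto
  consider "r = a - r" | "a - r < r" | "r < a - r" by linarith
  then show ?case
  proof cases
    case 1
    with s have "state r r Q Q0 U0" by simp
    from state_diag[OF this] have r: "r = 1" "Q = (\<lambda>k. of_bool (k = 0))" "Q0 = (\<lambda>k. of_bool (k = 0))"
      "U0 = (\<lambda>k. of_bool (k = 1))" by auto
    with 1 less.prems have a: "a = 2" by simp
    have "right_heavy U0" unfolding right_heavy_def r by auto
    then show ?thesis using checked_root unit_good sym unfolding P U a r by blast
  next
    case 2
    from less.IH[OF _ s 2] less.prems have "checked r (a - r) Q Q0 U0" by auto
    from checked_step[OF this _ sym] less.prems pos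
    have "node_good Q Q0 U0" "checked a r P Q U" unfolding P U by auto
    moreover have "right_heavy U0" using \<open>checked r (a - r) Q Q0 U0\<close> unfolding checked_def by blast
    ultimately show ?thesis using sym P U by blast
  next
    case 3
    from less.IH[OF _ state_swap[OF s] 3] pos less.prems have c: "checked (a - r) r Q0 Q U0" by auto
    from checked_step[OF c _ sym(2) sym(1)] less.prems pos
    have "node_good Q0 Q U0" "checked a r P Q U" unfolding P U by (auto simp: add.commute)
    moreover have "right_heavy U0" using c unfolding checked_def by blast
    ultimately show ?thesis using sym P U node_good_swap by blast
  qed
qed

lemma state_profile:
  assumes st: "state a b P Q U" and ab: "a \<le> b" "a \<le> 128"
  shows "lc_profile (\<lambda>k. U k - U (- k))"
proof (cases "a = 1")
  case True
  with st have U: "U = (\<lambda>k. of_bool (1 \<le> k \<and> k \<le> int b))" using state_one_left by blast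
  have "0 < b" using state_pos[OF st] by simp
  then show ?thesis unfolding lc_profile_def U by (intro conjI exI[of _ "int b"]) auto
next
  case False
  have apos: "0 < a" using state_pos[OF st] by simp
  have "a \<noteq> b" using st state_diag False by blast
  with ab have "a < b" by simp
  \<comment> \<open>A zero remainder would make the run start from (a, a), which exists only for a =
    1.\<close>
  have r0: "b mod a \<noteq> 0"
  proof
    assume "b mod a = 0"
    then obtain q where q: "b = q * a" by (metis dvd_eq_mod_eq_0 dvd_def mult.commute)
    with \<open>a < b\<close> obtain q' where "q = Suc q'" by (cases q) auto
    with q have "b = q' * a + a" by simp
    from state_run[OF st this apos] show False using state_diag False by blast
  qed
  define n r where "n = b div a" and "r = b mod a"
  have b: "b = n * a + r" unfolding n_def r_def by simp
  have n: "1 \<le> n" unfolding n_def using \<open>a < b\<close> apos by (simp add: div_greater_zero_iff Suc_le_eq)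
  have r: "0 < r" "r < a" using r0 apos by (auto simp: r_def)
  obtain Q1 U1 where s: "state a r P Q1 U1"
    and Ueq: "\<And>k. U k = U1 (k - int n) + (\<Sum>j=1..n. P (k - int j))"
    using state_run[OF st b r(1)] by blast
  from state_checked[OF s r(2) ab(2)] obtain Q0 U0 where c: "checked a r P Q1 U1"
    and g: "node_good Q1 Q0 U0" "\<And>k. Q0 (- k) = Q0 k" "right_heavy U0"
    and P: "P = (\<lambda>k. Q1 k + Q0 k + U0 k + U0 (- k))" and U1: "U1 = (\<lambda>k. Q1 (k - 1) + U0 (k - 1))" by blast
  have pu: "parity_unimodal P" "parity_unimodal Q1" using c unfolding checked_def by auto
  obtain w where w: "0 \<le> w" "\<And>k. w < \<bar>k\<bar> \<Longrightarrow> P k = 0"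
      "\<And>k. 1 \<le> k \<Longrightarrow> k \<le> w + 1 \<Longrightarrow> P (k + 1) < P (k - 1)"
      "\<And>i. w < i \<Longrightarrow> Q1 i + U0 i = 0 \<and> Q0 i + U0 i = 0"
    and ok: "run_ok w (\<lambda>i. Q1 i + U0 i + tail P w (i + 1)) (\<lambda>i. Q0 i + U0 i + tail P w (i + 1))
         (\<lambda>k. tail P w k + tail P w (k + 1))"
    using g(1) unfolding node_good_def Let_def P[symmetric] by blast
  show ?thesis
  proof (rule node_profile[where w = w and P = Q1 and Q = Q0 and U = U0 and n = n])
    show "U k = Q1 (k - int n - 1) + U0 (k - int n - 1) +
       (\<Sum>j=1..n. Q1 (k - int j) + Q0 (k - int j) + U0 (k - int j) + U0 (- (k - int j)))" for k
      unfolding Ueq U1 P by simp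
    show "run_ok w (\<lambda>i. Q1 i + U0 i + tail (\<lambda>k. Q1 k + Q0 k + U0 k + U0 (- k)) w (i + 1))
      (\<lambda>i. Q0 i + U0 i + tail (\<lambda>k. Q1 k + Q0 k + U0 k + U0 (- k)) w (i + 1))
      (\<lambda>k. tail (\<lambda>k. Q1 k + Q0 k + U0 k + U0 (- k)) w k + tail (\<lambda>k. Q1 k + Q0 k + U0 k + U0 (- k)) w (k + 1))"
      using ok unfolding P .
    show "parity_unimodal (\<lambda>k. Q1 k + Q0 k + U0 k + U0 (- k))" using pu(1) unfolding P .
    show "Q1 k + Q0 k + U0 k + U0 (- k) = 0" if "w < \<bar>k\<bar>" for k using w(2)[OF that] unfolding P .
    show "Q1 (k + 1) + Q0 (k + 1) + U0 (k + 1) + U0 (- (k + 1)) <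
        Q1 (k - 1) + Q0 (k - 1) + U0 (k - 1) + U0 (- (k - 1))" if "1 \<le> k" "k \<le> w + 1" for k
      using w(3)[OF that] unfolding P .
    show "Q1 i + U0 i + tail (\<lambda>k. Q1 k + Q0 k + U0 k + U0 (- k)) w (i + 1) = 0"
      "Q0 i + U0 i + tail (\<lambda>k. Q1 k + Q0 k + U0 k + U0 (- k)) w (i + 1) = 0" if "w < i" for i
      using w(4)[OF that] that by (auto simp: tail_def)
  qed (use pu g w n in auto)
qed

section \<open>Reduction of Frobenius functionals\<close>

lemma mat_dims:
  fixes A B C :: "'a :: comm_ring_1 mat"
  shows mat_assoc: "dim_col A = dim_row B \<Longrightarrow> dim_col B = dim_row C \<Longrightarrow> A * B * C = A * (B * C)"
    and mat_addl: "dim_row B = dim_row C \<Longrightarrow> dim_col B = dim_col C \<Longrightarrow> dim_col A = dim_row B \<Longrightarrow>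
      A * (B + C) = A * B + A * C"
    and mat_addr: "dim_row A = dim_row B \<Longrightarrow> dim_col A = dim_col B \<Longrightarrow> dim_col A = dim_row C \<Longrightarrow>
      (A + B) * C = A * C + B * C"
    and mat_subl: "dim_row B = dim_row C \<Longrightarrow> dim_col B = dim_col C \<Longrightarrow> dim_col A = dim_row B \<Longrightarrow>
      A * (B - C) = A * B - A * C"
    and mat_subr: "dim_row A = dim_row B \<Longrightarrow> dim_col A = dim_col B \<Longrightarrow> dim_col A = dim_row C \<Longrightarrow>
      (A - B) * C = A * C - B * C"
proof -
  show "A * B * C = A * (B * C)" if "dim_col A = dim_row B" "dim_col B = dim_row C"
    by (rule assoc_mult_mat[of A "dim_row A" "dim_row B" B "dim_row C" C "dim_col C"]) (use that in auto)
  show "A * (B + C) = A * B + A * C"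
    if "dim_row B = dim_row C" "dim_col B = dim_col C" "dim_col A = dim_row B"
    by (rule mult_add_distrib_mat[of A "dim_row A" "dim_row B" B "dim_col B" C]) (use that in auto)
  show "(A + B) * C = A * C + B * C"
    if "dim_row A = dim_row B" "dim_col A = dim_col B" "dim_col A = dim_row C"
    by (rule add_mult_distrib_mat[of A "dim_row A" "dim_row C" B C "dim_col C"]) (use that in auto)
  show "A * (B - C) = A * B - A * C"
    if "dim_row B = dim_row C" "dim_col B = dim_col C" "dim_col A = dim_row B"
    by (rule mult_minus_distrib_mat[of A "dim_row A" "dim_row B" B "dim_col B" C]) (use that in auto)
  show "(A - B) * C = A * C - B * C"
    if "dim_row A = dim_row B" "dim_col A = dim_col B" "dim_col A = dim_row C"
    by (rule minus_mult_distrib_mat[of A "dim_row A" "dim_row C" B C "dim_col C"]) (use that in auto)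
qed

section \<open>The equations of a principal element and their reduction\<close>

text \<open>The equation G h - h G = e G for G with rows (A, 0), (C, B) and h with rows (P, R), (0,
  Q), read in the two diagonal blocks and the lower left one, which are the blocks that the trace
  form pairs with block upper triangular matrices. e = 1 describes principal elements, e = 0 the
  radical.\<close>

definition adjoint_system :: "nat \<Rightarrow> nat \<Rightarrow> complex mat \<Rightarrow> complex mat \<Rightarrow> complex mat \<Rightarrow>
    complex mat \<Rightarrow> complex mat \<Rightarrow> complex mat \<Rightarrow> complex \<Rightarrow> bool" where
  "adjoint_system a b A B C P Q R e \<longleftrightarrow>
     P \<in> carrier_mat a a \<and> Q \<in> carrier_mat b b \<and> R \<in> carrier_mat a b \<and>
     A * P - P * A - R * C = e \<cdot>\<^sub>m A \<and> C * P - Q * C = e \<cdot>\<^sub>m C \<and> C * R + (B * Q - Q * B) = e \<cdot>\<^sub>m B"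

text \<open>Without the trace condition the radical always contains the scalars; nondegeneracy on
  \<open>W\<close> means that it contains nothing else.\<close>

definition nondegenerate :: "nat \<Rightarrow> nat \<Rightarrow> complex mat \<Rightarrow> complex mat \<Rightarrow> complex mat \<Rightarrow> bool" where
  "nondegenerate a b A B C \<longleftrightarrow>
     A \<in> carrier_mat a a \<and> B \<in> carrier_mat b b \<and> C \<in> carrier_mat b a \<and>
     (\<forall>P Q R. adjoint_system a b A B C P Q R 0 \<longrightarrow>
        (\<exists>c. P = c \<cdot>\<^sub>m 1\<^sub>m a \<and> Q = c \<cdot>\<^sub>m 1\<^sub>m b) \<and> R = 0\<^sub>m a b)"

lemma mat_eqD: "X = Y \<Longrightarrow> X $$ ij = Y $$ ij" by simp

section \<open>Passing to the cokernel of C: D is a left inverse of C, L the projection to the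
  cokernel, K a section of L\<close>

context
  fixes a d :: nat and A B C D L K :: "complex mat"
  assumes A: "A \<in> carrier_mat a a" and B: "B \<in> carrier_mat (a + d) (a + d)" and C: "C \<in> carrier_mat (a + d) a"
    and D: "D \<in> carrier_mat a (a + d)" and L: "L \<in> carrier_mat d (a + d)" and K: "K \<in> carrier_mat (a + d) d"
    and DC: "D * C = 1\<^sub>m a" and LC: "L * C = 0\<^sub>m d a" and LK: "L * K = 1\<^sub>m d" and DK: "D * K = 0\<^sub>m a d"
    and CD: "C * D + K * L = 1\<^sub>m (a + d)"
begin

lemmas dims = carrier_matD[OF A] carrier_matD[OF B] carrier_matD[OF C] carrier_matD[OF D]
  carrier_matD[OF L] carrier_matD[OF K]

lemma cancel:
  assumes "dim_row X = a"
  shows "D * (C * X) = X" "L * (C * X) = 0\<^sub>m d (dim_col X)"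
  using mat_assoc[of D C X] mat_assoc[of L C X] assms by (auto simp: dims DC LC)

lemma cancel':
  assumes "dim_row X = d"
  shows "L * (K * X) = X" "D * (K * X) = 0\<^sub>m a (dim_col X)"
  using mat_assoc[of L K X] mat_assoc[of D K X] assms by (auto simp: dims LK DK)

lemma expand:
  assumes "dim_row X = a + d"
  shows "X = C * (D * X) + K * (L * X)"
proof -
  have "X = (C * D + K * L) * X" using assms by (simp add: CD)
  also have "\<dots> = C * (D * X) + K * (L * X)" using assms by (simp add: mat_addr mat_assoc dims)
  finally show ?thesis .
qed

text \<open>In the decomposition of the second space into the images of \<open>C\<close> and
  \<open>K\<close>, these are blocks of \<open>B\<close>. The block \<open>D * (B * C)\<close> joins
  \<open>A\<close> because \<open>C\<close> identifies the first space with its image; the fourth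
  block \<open>D * (B * K)\<close> falls into the upper right corner, which the trace form does not
  see.\<close>

definition "A' = A + D * (B * C)"
definition "B' = L * (B * K)"
definition "C' = L * (B * C)"

text \<open>The second equation says \<open>Q * C = C * (P - 1)\<close>: \<open>Q\<close> preserves
  the image of \<open>C\<close> and acts there as \<open>P - 1\<close>, hence the lowering by 1.
  Multiplying the third equation by \<open>L\<close> from the left kills \<open>C * R\<close> and
  yields the equations for \<open>C'\<close> and \<open>B'\<close>. Its part between
  \<open>D\<close> and \<open>C\<close> expresses \<open>R * C\<close>, which is then eliminated
  from the first equation.\<close>

lemma reduce_system:
  assumes s: "adjoint_system a (a + d) A B C P Q R 1"
  shows "adjoint_system a d A' B' C' (P - 1\<^sub>m a) (L * (Q * K)) (D * (Q * K)) 1"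
    and "D * (Q * C) = P - 1\<^sub>m a" "L * (Q * C) = 0\<^sub>m d a"
proof -
  have P: "P \<in> carrier_mat a a" and Q: "Q \<in> carrier_mat (a + d) (a + d)" and R: "R \<in> carrier_mat a (a + d)"
    and e1: "A * P - P * A - R * C = A" and e2: "C * P - Q * C = C" and e3: "C * R + (B * Q - Q * B) = B"
    using s A B C by (auto simp: adjoint_system_def)
  note dm = dims carrier_matD[OF P] carrier_matD[OF Q] carrier_matD[OF R]
  note ex = mat_addl mat_addr mat_subl mat_subr mat_assoc dm
  have QC: "Q * C = C * (P - 1\<^sub>m a)"
  proof (rule eq_matI)
    fix i j assume "i < dim_row (C * (P - 1\<^sub>m a))" "j < dim_col (C * (P - 1\<^sub>m a))"
    then show "(Q * C) $$ (i, j) = (C * (P - 1\<^sub>m a)) $$ (i, j)"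
      using mat_eqD[OF e2, of "(i, j)"] C by (simp add: ex algebra_simps del: index_mult_mat(1))
  qed (auto simp: dm)
  have Pd: "dim_row (P - 1\<^sub>m a) = a" "dim_col (P - 1\<^sub>m a) = a" by (auto simp: dm)
  show DQC: "D * (Q * C) = P - 1\<^sub>m a" unfolding QC using cancel(1)[OF Pd(1)] .
  show LQC: "L * (Q * C) = 0\<^sub>m d a" unfolding QC using cancel(2)[OF Pd(1)] Pd by simp
  define p where "p = P - 1\<^sub>m a"
  have pc: "p \<in> carrier_mat a a" unfolding p_def by (rule carrier_matI) (simp_all add: dm)
  note QC' = QC[folded p_def]
  note dp = carrier_matD[OF pc]
  have AP: "A * p - p * A = A * P - P * A"
    unfolding p_def using P A by (intro eq_matI) (auto simp: ex simp del: index_mult_mat(1))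
  define q r where "q = L * (Q * K)" and "r = D * (Q * K)"
  have qr: "q \<in> carrier_mat d d" "r \<in> carrier_mat a d" unfolding q_def r_def using L D Q K by auto
  have QX: "L * (Q * X) = q * (L * X)" "D * (Q * X) = p * (D * X) + r * (L * X)"
    if "dim_row X = a + d" for X
  proof -
    have "L * (Q * X) = L * (Q * (C * (D * X) + K * (L * X)))" using expand[OF that] by simp
    also have "\<dots> = L * (Q * C) * (D * X) + q * (L * X)" using that by (simp add: ex q_def)
    also have "\<dots> = q * (L * X)" unfolding LQC using that qr
      by (intro eq_matI) (auto simp: dm simp del: index_mult_mat(1) simp: left_mult_zero_mat)
    finally show "L * (Q * X) = q * (L * X)" .
    have "D * (Q * X) = D * (Q * (C * (D * X) + K * (L * X)))" using expand[OF that] by simp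
    also have "\<dots> = D * (Q * C) * (D * X) + r * (L * X)" using that by (simp add: ex r_def)
    finally show "D * (Q * X) = p * (D * X) + r * (L * X)" unfolding DQC p_def .
  qed
  have XQ: "X * (Q * C) = X * (C * p)" "X * (Q * K) = X * (C * r) + X * (K * q)" if "dim_col X = a + d" for X
  proof -
    show "X * (Q * C) = X * (C * p)" unfolding QC' ..
    have "Q * K = C * r + K * q" using expand[of "Q * K"] unfolding r_def q_def by (simp add: dm)
    then show "X * (Q * K) = X * (C * r) + X * (K * q)" using that qr by (simp add: ex)
  qed
  have m: "X * (C * R + (B * Q - Q * B)) * Y = X * (B * Y)"
    if "dim_col X = a + d" "dim_row Y = a + d" for X Y unfolding e3 using that by (simp add: ex)
  have m': "(X * C) * (R * Y) + ((X * B) * (Q * Y) - X * (Q * (B * Y))) = X * (B * Y)"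
    if "dim_col X = a + d" "dim_row Y = a + d" for X Y using m[OF that] that by (simp add: ex)
  have "C' * p - q * C' = C'"
  proof -
    have "(L * C) * (R * C) + ((L * B) * (Q * C) - L * (Q * (B * C))) = L * (B * C)" by (rule m') (auto simp: dm)
    then have e: "0\<^sub>m d a + ((L * B) * (C * p) - q * (L * (B * C))) = L * (B * C)"
      unfolding LC QC' using QX(1)[of "B * C"] qr pc R C L B by (simp add: dm)
    show ?thesis unfolding C'_def
    proof (rule eq_matI)
      fix i j assume "i < dim_row (L * (B * C))" "j < dim_col (L * (B * C))"
      then show "(L * (B * C) * p - q * (L * (B * C))) $$ (i, j) = (L * (B * C)) $$ (i, j)"
        using mat_eqD[OF e, of "(i, j)"] pc qr by (simp add: ex dp del: index_mult_mat(1))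
    qed (use pc qr in \<open>auto simp: dm\<close>)
  qed
  moreover have "A' * p - p * A' - r * C' = A'"
  proof -
    have e: "(D * C) * (R * C) + ((D * B) * (Q * C) - D * (Q * (B * C))) = D * (B * C)" by (rule m') (auto simp: dm)
    have f: "R * C + (D * (B * C) * p - (p * (D * (B * C)) + r * C')) = D * (B * C)"
      using e unfolding DC QC' C'_def using QX(2)[of "B * C"] pc R C by (simp add: ex dp)
    show ?thesis
    proof (rule eq_matI)
      fix i j assume "i < dim_row A'" "j < dim_col A'"
      then have ij: "i < a" "j < a" by (auto simp: A'_def dm)
      show "(A' * p - p * A' - r * C') $$ (i, j) = A' $$ (i, j)"
        using mat_eqD[OF e1[folded AP], of "(i, j)"] mat_eqD[OF f, of "(i, j)"] ij qr pc
        unfolding AP[symmetric] A'_def C'_def by (simp add: ex dp algebra_simps del: index_mult_mat(1))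
    qed (use qr pc in \<open>auto simp: A'_def C'_def dm\<close>)
  qed
  moreover have "C' * r + (B' * q - q * B') = B'"
  proof -
    have e: "(L * C) * (R * K) + ((L * B) * (Q * K) - L * (Q * (B * K))) = L * (B * K)" by (rule m') (auto simp: dm)
    have f: "0\<^sub>m d a * (R * K) + (L * B * (C * r) + L * B * (K * q) - q * (L * (B * K))) = L * (B * K)"
      using e QX(1)[of "B * K"] XQ(2)[of "L * B"] unfolding LC by (simp add: dm)
    show ?thesis unfolding C'_def B'_def
    proof (rule eq_matI)
      fix i j assume "i < dim_row (L * (B * K))" "j < dim_col (L * (B * K))"
      moreover have "0\<^sub>m d a * (R * K) = 0\<^sub>m d d" using R K by (intro left_mult_zero_mat) auto
      ultimately show "(L * (B * C) * r + (L * (B * K) * q - q * (L * (B * K)))) $$ (i, j) = (L * (B * K)) $$ (i, j)"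
        using mat_eqD[OF f, of "(i, j)"] pc qr by (simp add: ex dp algebra_simps del: index_mult_mat(1))
    qed (use pc qr in \<open>auto simp: dm\<close>)
  qed
  moreover have "A' \<in> carrier_mat a a" "B' \<in> carrier_mat d d" "C' \<in> carrier_mat d a"
    unfolding A'_def B'_def C'_def using A B C D K L by auto
  ultimately show "adjoint_system a d A' B' C' (P - 1\<^sub>m a) (L * (Q * K)) (D * (Q * K)) 1"
    unfolding adjoint_system_def q_def[symmetric] r_def[symmetric] p_def[symmetric] using pc qr by auto
qed

lemma expand_right:
  assumes "dim_col X = a + d"
  shows "X = X * (C * D) + X * (K * L)"
proof -
  have "X = X * (C * D + K * L)" using assms by (simp add: CD)
  also have "\<dots> = X * (C * D) + X * (K * L)" using assms by (simp add: mat_addl dims)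
  finally show ?thesis .
qed

text \<open>A radical element (p, q, r) of the reduced pair lifts: \<open>Q\<close> gets the blocks
  p, r, 0, q with respect to the images of \<open>C\<close> and \<open>K\<close>. Then
  \<open>W = Q * B - B * Q\<close> satisfies \<open>L * W = 0\<close>, so it factors as
  \<open>C * R\<close>. The lift is scalar by assumption, hence so are p and q, and r = 0.\<close>

lemma reduce_nondegenerate:
  assumes nd: "nondegenerate a (a + d) A B C"
  shows "nondegenerate a d A' B' C'"
  unfolding nondegenerate_def
proof (intro conjI allI impI)
  show "A' \<in> carrier_mat a a" "B' \<in> carrier_mat d d" "C' \<in> carrier_mat d a"
    unfolding A'_def B'_def C'_def using A B C D K L by auto
next
  fix p q r assume s: "adjoint_system a d A' B' C' p q r 0"
  have pc: "p \<in> carrier_mat a a" and qc: "q \<in> carrier_mat d d" and rc: "r \<in> carrier_mat a d"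
    using s by (auto simp: adjoint_system_def)
  note dm = dims carrier_matD[OF pc] carrier_matD[OF qc] carrier_matD[OF rc]
  note ex = mat_addl mat_addr mat_subl mat_subr mat_assoc dm
  have z: "0 \<cdot>\<^sub>m X = 0\<^sub>m (dim_row X) (dim_col X)" for X :: "complex mat" by (rule eq_matI) auto
  have s1: "A' * p - p * A' - r * C' = 0\<^sub>m a a" and s2: "C' * p - q * C' = 0\<^sub>m d a"
    and s3: "C' * r + (B' * q - q * B') = 0\<^sub>m d d"
    using s by (auto simp: adjoint_system_def z A'_def B'_def C'_def dm)
  define Q where "Q = C * (p * D) + C * (r * L) + K * (q * L)"
  have Q: "Q \<in> carrier_mat (a + d) (a + d)" unfolding Q_def by (rule carrier_matI) (simp_all add: dm)
  note dQ = carrier_matD[OF Q]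
  have QC: "Q * C = C * p"
  proof -
    have "Q * C = C * (p * 1\<^sub>m a) + C * (r * 0\<^sub>m d a) + K * (q * 0\<^sub>m d a)"
      unfolding Q_def by (simp add: ex DC LC)
    then show ?thesis using pc qc rc C K by simp
  qed
  have QK: "Q * K = C * r + K * q"
  proof -
    have "Q * K = C * (p * 0\<^sub>m a d) + C * (r * 1\<^sub>m d) + K * (q * 1\<^sub>m d)"
      unfolding Q_def by (simp add: ex DK LK)
    then show ?thesis using pc qc rc C K by simp
  qed
  have LQ: "L * (Q * X) = q * (L * X)" and DQ: "D * (Q * X) = p * (D * X) + r * (L * X)"
    if "dim_row X = a + d" for X
  proof -
    have "L * (Q * X) = 0\<^sub>m d (dim_col X) + 0\<^sub>m d (dim_col X) + q * (L * X)"
      unfolding Q_def using that by (simp add: ex cancel cancel')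
    also have "\<dots> = q * (L * X)" using qc L that by (intro eq_matI) (auto simp: dm simp del: index_mult_mat(1))
    finally show "L * (Q * X) = q * (L * X)" .
    have "D * (Q * X) = p * (D * X) + r * (L * X) + 0\<^sub>m a (dim_col X)"
      unfolding Q_def using that by (simp add: ex cancel cancel')
    also have "\<dots> = p * (D * X) + r * (L * X)"
      using qc L that by (intro eq_matI) (auto simp: dm simp del: index_mult_mat(1))
    finally show "D * (Q * X) = p * (D * X) + r * (L * X)" .
  qed
  define W where "W = Q * B - B * Q"
  have W: "W \<in> carrier_mat (a + d) (a + d)" unfolding W_def by (rule carrier_matI) (simp_all add: dm dQ)
  note dW = carrier_matD[OF W]
  have LWC: "L * (W * C) = 0\<^sub>m d a"
  proof (rule eq_matI)
    fix i j assume "i < dim_row (0\<^sub>m d a :: complex mat)" "j < dim_col (0\<^sub>m d a :: complex mat)"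
    then show "(L * (W * C)) $$ (i, j) = 0\<^sub>m d a $$ (i, j)"
      using mat_eqD[OF s2, of "(i, j)"] LQ[of "B * C"] unfolding W_def C'_def
      by (simp add: ex dQ QC del: index_mult_mat(1))
  qed (auto simp: dm dW)
  have LWK: "L * (W * K) = 0\<^sub>m d d"
  proof (rule eq_matI)
    fix i j assume "i < dim_row (0\<^sub>m d d :: complex mat)" "j < dim_col (0\<^sub>m d d :: complex mat)"
    then show "(L * (W * K)) $$ (i, j) = 0\<^sub>m d d $$ (i, j)"
      using mat_eqD[OF s3, of "(i, j)"] LQ[of "B * K"] unfolding W_def C'_def B'_def
      by (simp add: ex dQ QK algebra_simps del: index_mult_mat(1))
  qed (auto simp: dm dW)
  have DWC: "D * (W * C) = A * p - p * A"
  proof (rule eq_matI)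
    fix i j assume "i < dim_row (A * p - p * A)" "j < dim_col (A * p - p * A)"
    then show "(D * (W * C)) $$ (i, j) = (A * p - p * A) $$ (i, j)"
      using mat_eqD[OF s1, of "(i, j)"] DQ[of "B * C"] unfolding W_def C'_def A'_def
      by (simp add: ex dQ QC algebra_simps del: index_mult_mat(1))
  qed (auto simp: dm dW)
  \<comment> \<open>This is \<open>D * W\<close>, with its part on the image of \<open>C\<close>
    written as \<open>A * p - p * A\<close>, the value that \<open>R * C\<close> must have.\<close>
  define R where "R = (A * p - p * A) * D + D * (W * (K * L))"
  have R: "R \<in> carrier_mat a (a + d)" unfolding R_def by (rule carrier_matI) (simp_all add: dm dW)
  note dR = carrier_matD[OF R]
  have LW: "L * W = 0\<^sub>m d (a + d)"
  proof -
    have "L * W = L * (W * C) * D + L * (W * K) * L"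
      using expand_right[of "L * W"] by (simp add: ex dW)
    also have "\<dots> = 0\<^sub>m d (a + d)" unfolding LWC LWK using D L by simp
    finally show ?thesis .
  qed
  have DW: "D * W = R"
  proof -
    have "D * W = D * (W * C) * D + D * (W * (K * L))"
      using expand_right[of "D * W"] by (simp add: ex dW)
    then show ?thesis unfolding DWC R_def .
  qed
  have "W = C * R + K * 0\<^sub>m d (a + d)" using expand[of W] unfolding LW DW by (simp add: dW)
  then have CR: "C * R = W" using K C R by simp
  have RC: "R * C = A * p - p * A"
  proof -
    have "R * C = (A * p - p * A) * 1\<^sub>m a + D * (W * (K * 0\<^sub>m d a))"
      unfolding R_def by (simp add: ex dW DC LC)
    also have "\<dots> = A * p - p * A" using A pc D W K
      by simp (intro eq_matI, auto simp del: index_mult_mat(1))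
    finally show ?thesis .
  qed
  have "adjoint_system a (a + d) A B C p Q R 0"
    unfolding adjoint_system_def z RC QC CR W_def using pc Q R A B C
    by (auto intro!: eq_matI simp del: index_mult_mat(1))
  then obtain c where c: "p = c \<cdot>\<^sub>m 1\<^sub>m a" "Q = c \<cdot>\<^sub>m 1\<^sub>m (a + d)"
    using nd unfolding nondegenerate_def by blast
  have q: "q = c \<cdot>\<^sub>m 1\<^sub>m d"
  proof -
    have "q = L * (Q * K)" using LQ[of K] qc by (simp add: dm LK)
    also have "\<dots> = L * (c \<cdot>\<^sub>m K)" unfolding c(2) using K by (simp add: mult_smult_assoc_mat[of _ "a + d" "a + d" _ d])
    also have "\<dots> = c \<cdot>\<^sub>m 1\<^sub>m d" using L K LK by (simp add: mult_smult_distrib[of _ d "a + d" _ d])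
    finally show ?thesis .
  qed
  have r: "r = 0\<^sub>m a d"
  proof -
    have "0\<^sub>m a d + r = D * (Q * K)" using DQ[of K] rc pc by (simp add: dm LK DK)
    also have "\<dots> = D * (c \<cdot>\<^sub>m K)" unfolding c(2) using K by (simp add: mult_smult_assoc_mat[of _ "a + d" "a + d" _ d])
    also have "\<dots> = c \<cdot>\<^sub>m 0\<^sub>m a d" using D K DK by (simp add: mult_smult_distrib[of _ a "a + d" _ d])
    finally show ?thesis using rc by simp
  qed
  show "\<exists>c. p = c \<cdot>\<^sub>m 1\<^sub>m a \<and> q = c \<cdot>\<^sub>m 1\<^sub>m d" using c(1) q by blast
  show "r = 0\<^sub>m a d" by (rule r)
qed

end

section \<open>Splitting off the image of an injective matrix\<close>

text \<open>At the first column j whose pivot is not in row j, all rows from j on vanish up to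
  column j, so this column is a combination of the earlier unit columns. That relation is a kernel
  vector.\<close>

lemma echelon_trivial_kernel:
  fixes N :: "complex mat"
  assumes N: "N \<in> carrier_mat b a" and e: "row_echelon_form N"
    and ker: "\<And>v. v \<in> carrier_vec a \<Longrightarrow> N *\<^sub>v v = 0\<^sub>v b \<Longrightarrow> v = 0\<^sub>v a"
  shows "a \<le> b" "N = mat b a (\<lambda>(i, j). if i = j then 1 else 0)"
proof -
  have dN: "dim_row N = b" "dim_col N = a" using N by auto
  from e obtain f where f: "pivot_fun N f a" unfolding row_echelon_form_def dN by auto
  note p = pivot_funD[OF dN(1) f]
  have piv: "j < b \<and> f j = j" if "j < a" for j
    using that
  proof (induction j rule: less_induct)
    case (less j)
    show ?case
    proof (rule ccontr)
      assume n: "\<not> (j < b \<and> f j = j)"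
      have fi: "j < f i" if i: "j \<le> i" "i < b" for i
      proof -
        have jb: "j < b" using i by simp
        have "f (0 + j) = a \<or> f (0 + j) \<ge> j + f 0" by (rule pivot_bound[OF dN(1) f]) (use jb in simp)
        then have "j < f j" using n jb less.prems by auto
        moreover have "f (j + (i - j)) = a \<or> f (j + (i - j)) \<ge> (i - j) + f j"
          by (rule pivot_bound[OF dN(1) f]) (use i in simp)
        ultimately show ?thesis using i less.prems by auto
      qed
      define v where "v = vec a (\<lambda>k. if k = j then 1 else if k < j then - N $$ (k, j) else 0)"
      have v: "v \<in> carrier_vec a" unfolding v_def by simp
      have "N *\<^sub>v v = 0\<^sub>v b"
      proof (rule eq_vecI)
        fix i assume "i < dim_vec (0\<^sub>v b :: complex vec)"
        then have i: "i < b" by simp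
        have "(N *\<^sub>v v) $ i = (\<Sum>k<a. N $$ (i, k) * v $ k)"
          using i dN v by (simp add: scalar_prod_def row_def atLeast0LessThan)
        also have "\<dots> = 0"
        proof (cases "i < j")
          case True
          have fi': "f i = i" using less.IH[OF True] True less.prems by auto
          have z: "N $$ (i, k) = 0" if "k < j" "k \<noteq> i" for k
          proof -
            have "k < b \<and> f k = k" using less.IH[of k] that less.prems by auto
            then show ?thesis using p(5)[of k i] that i less.prems by auto
          qed
          have "N $$ (i, k) * v $ k = (if k = i then - N $$ (i, j) else 0) + (if k = j then N $$ (i, j) else 0)"
            if "k < a" for k
            using that True z[of k] p(4)[of i] fi' i less.prems unfolding v_def by auto
          then have "(\<Sum>k<a. N $$ (i, k) * v $ k) =
              (\<Sum>k<a. (if k = i then - N $$ (i, j) else 0) + (if k = j then N $$ (i, j) else 0))"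
            by (intro sum.cong) auto
          then show ?thesis using True less.prems by (simp add: sum.distrib)
        next
          case False
          have z: "N $$ (i, k) = 0" if "k \<le> j" for k
            using p(2)[OF i, of k] fi[of i] False i that by auto
          show ?thesis by (rule sum.neutral) (auto simp: v_def z)
        qed
        finally show "(N *\<^sub>v v) $ i = 0\<^sub>v b $ i" using i by simp
      qed (use dN in auto)
      from ker[OF v this] have "v $ j = 0" using less.prems by simp
      then show False using less.prems by (simp add: v_def)
    qed
  qed
  show "a \<le> b"
  proof (rule ccontr)
    assume "\<not> a \<le> b"
    then show False using piv[of b] by simp
  qed
  show "N = mat b a (\<lambda>(i, j). if i = j then 1 else 0)"
  proof (rule eq_matI)
    fix i j assume "i < dim_row (mat b a (\<lambda>(i, j). if i = j then 1 else 0 :: complex))"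
      "j < dim_col (mat b a (\<lambda>(i, j). if i = j then 1 else 0 :: complex))"
    then have ij: "i < b" "j < a" by auto
    from piv[OF ij(2)] have "j < b" "f j = j" by auto
    then show "N $$ (i, j) = mat b a (\<lambda>(i, j). if i = j then 1 else 0) $$ (i, j)"
      using ij p(4)[of j] p(5)[of j i] by auto
  qed (use dN in auto)
qed

lemma sum_split_nat: "(\<Sum>k<a + d. g k) = (\<Sum>k<a. g k) + (\<Sum>k<d. g (k + a :: nat) :: 'a :: comm_monoid_add)"
  by (induction d) (simp_all add: add_ac)

text \<open>A matrix with trivial kernel is, up to a change of basis of the target, the inclusion of the
  first coordinates; \<open>D\<close>, \<open>L\<close> are the rows of the base change, \<open>C\<close>, \<open>K\<close> the columns of its inverse.\<close>

lemma trivial_kernel_split: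
  fixes C :: "complex mat"
  assumes C: "C \<in> carrier_mat b a"
    and ker: "\<And>v. v \<in> carrier_vec a \<Longrightarrow> C *\<^sub>v v = 0\<^sub>v b \<Longrightarrow> v = 0\<^sub>v a"
  obtains d D L K where "b = a + d" "D \<in> carrier_mat a b" "L \<in> carrier_mat d b" "K \<in> carrier_mat b d"
    "D * C = 1\<^sub>m a" "L * C = 0\<^sub>m d a" "L * K = 1\<^sub>m d" "D * K = 0\<^sub>m a d" "C * D + K * L = 1\<^sub>m b"
    "\<And>X. X \<in> carrier_mat b b \<Longrightarrow> similar_mat X
       (four_block_mat (D * (X * C)) (D * (X * K)) (L * (X * C)) (L * (X * K)))"
proof -
  define N where "N = gauss_jordan_single C"
  note gj = gauss_jordan_single[OF C N_def[symmetric]]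
  from gj(4) obtain G H where GH: "N = G * C" "G \<in> carrier_mat b b" "H \<in> carrier_mat b b"
    "G * H = 1\<^sub>m b" "H * G = 1\<^sub>m b" by blast
  have "v = 0\<^sub>v a" if "v \<in> carrier_vec a" "N *\<^sub>v v = 0\<^sub>v b" for v
    using gj(1)[OF that(1)] ker[OF that(1)] that(2) by auto
  note N = echelon_trivial_kernel[OF gj(2,3) this]
  obtain d where b: "b = a + d" using N(1) le_Suc_ex by blast
  have CH: "C = H * N" unfolding GH(1) using GH C by (simp add: assoc_mult_mat[symmetric, of _ b b _ b _ a])
  have Nent: "N $$ (k, j) = (if k = j then 1 else 0)" if "k < b" "j < a" for k j
    using that arg_cong[OF N(2), of "\<lambda>M. M $$ (k, j)"] by simp
  have Cent: "C $$ (i, j) = H $$ (i, j)" if "i < b" "j < a" for i j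
  proof -
    have "C $$ (i, j) = (\<Sum>k<b. H $$ (i, k) * N $$ (k, j))"
      unfolding CH using that GH(3) gj(2) by (simp add: scalar_prod_def atLeast0LessThan)
    also have "\<dots> = (\<Sum>k<b. if k = j then H $$ (i, j) else 0)"
      using that Nent by (intro sum.cong) auto
    also have "\<dots> = H $$ (i, j)" using that b by simp
    finally show ?thesis .
  qed
  define D where "D = mat a b (\<lambda>(i, j). G $$ (i, j))"
  define L where "L = mat d b (\<lambda>(i, j). G $$ (i + a, j))"
  define K where "K = mat b d (\<lambda>(i, j). H $$ (i, j + a))"
  have car: "D \<in> carrier_mat a b" "L \<in> carrier_mat d b" "K \<in> carrier_mat b d"
    by (auto simp: D_def L_def K_def)
  have blk: "G * X * H = four_block_mat (D * (X * C)) (D * (X * K)) (L * (X * C)) (L * (X * K))"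
    if X: "X \<in> carrier_mat b b" for X
  proof (rule eq_matI)
    fix i j
    assume ij: "i < dim_row (four_block_mat (D * (X * C)) (D * (X * K)) (L * (X * C)) (L * (X * K)))"
      "j < dim_col (four_block_mat (D * (X * C)) (D * (X * K)) (L * (X * C)) (L * (X * K)))"
    then have ij: "i < b" "j < b" using C car b by auto
    have colC: "col C j = col H j" if "j < a" for j
      by (rule eq_vecI) (use that C GH(3) Cent b in auto)
    have colK: "col K j = col H (j + a)" if "j < d" for j
      by (rule eq_vecI) (use that car GH(3) b in \<open>auto simp: K_def\<close>)
    have rowD: "row D i = row G i" if "i < a" for i
      by (rule eq_vecI) (use that car GH(2) b in \<open>auto simp: D_def\<close>)
    have rowL: "row L i = row G (i + a)" if "i < d" for i
      by (rule eq_vecI) (use that car GH(2) b in \<open>auto simp: L_def\<close>)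
    have XC: "col (X * C) j = X *\<^sub>v col C j" if "j < a" for j using X C that by (intro col_mult2)
    have XK: "col (X * K) j = X *\<^sub>v col K j" if "j < d" for j using X car that by (intro col_mult2)
    have XH: "col (X * H) j = X *\<^sub>v col H j" if "j < b" for j using X GH that by (intro col_mult2)
    have "(G * X * H) $$ (i, j) = row G i \<bullet> (X *\<^sub>v col H j)"
      unfolding XH[OF ij(2), symmetric] assoc_mult_mat[OF GH(2) X GH(3)] using ij X GH(2,3) by simp
    then show "(G * X * H) $$ (i, j) =
      four_block_mat (D * (X * C)) (D * (X * K)) (L * (X * C)) (L * (X * K)) $$ (i, j)"
      using ij car C X b by (auto simp: rowD rowL colC colK XC XK mult_mat_vec_def)
  qed (use C car X GH b in auto)
  \<comment> \<open>The block formula at the identity matrix contains four of the five product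
    identities.\<close>
  have one: "four_block_mat (D * C) (D * K) (L * C) (L * K) = 1\<^sub>m b"
    using blk[of "1\<^sub>m b"] GH C car by simp
  have ent: "(D * C) $$ (i, j) = 1\<^sub>m b $$ (i, j)" if "i < a" "j < a" for i j
    using arg_cong[OF one, of "\<lambda>M. M $$ (i, j)"] that car C b by (simp del: index_mult_mat(1) index_one_mat(1))
  have ent2: "(D * K) $$ (i, j) = 1\<^sub>m b $$ (i, j + a)" if "i < a" "j < d" for i j
    using arg_cong[OF one, of "\<lambda>M. M $$ (i, j + a)"] that car C b by (simp del: index_mult_mat(1) index_one_mat(1))
  have ent3: "(L * C) $$ (i, j) = 1\<^sub>m b $$ (i + a, j)" if "i < d" "j < a" for i j
    using arg_cong[OF one, of "\<lambda>M. M $$ (i + a, j)"] that car C b by (simp del: index_mult_mat(1) index_one_mat(1))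
  have ent4: "(L * K) $$ (i, j) = 1\<^sub>m b $$ (i + a, j + a)" if "i < d" "j < d" for i j
    using arg_cong[OF one, of "\<lambda>M. M $$ (i + a, j + a)"] that car C b by (simp del: index_mult_mat(1) index_one_mat(1))
  have "D * C = 1\<^sub>m a" by (rule eq_matI) (use ent car C b in \<open>auto simp del: index_mult_mat(1)\<close>)
  moreover have "D * K = 0\<^sub>m a d" by (rule eq_matI) (use ent2 car C b in \<open>auto simp del: index_mult_mat(1)\<close>)
  moreover have "L * C = 0\<^sub>m d a" by (rule eq_matI) (use ent3 car C b in \<open>auto simp del: index_mult_mat(1)\<close>)
  moreover have "L * K = 1\<^sub>m d" by (rule eq_matI) (use ent4 car C b in \<open>auto simp del: index_mult_mat(1)\<close>)
  moreover have "C * D + K * L = 1\<^sub>m b"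
  proof (rule eq_matI)
    fix i j assume "i < dim_row (1\<^sub>m b :: complex mat)" "j < dim_col (1\<^sub>m b :: complex mat)"
    then have ij: "i < b" "j < b" by auto
    have "(C * D + K * L) $$ (i, j) = (\<Sum>k<a. H $$ (i, k) * G $$ (k, j)) + (\<Sum>k<d. H $$ (i, k + a) * G $$ (k + a, j))"
      using ij car C Cent by (simp add: scalar_prod_def atLeast0LessThan D_def L_def K_def)
    also have "\<dots> = (\<Sum>k<b. H $$ (i, k) * G $$ (k, j))" unfolding b sum_split_nat ..
    also have "\<dots> = (H * G) $$ (i, j)" using ij GH(2,3) by (simp add: scalar_prod_def atLeast0LessThan)
    finally show "(C * D + K * L) $$ (i, j) = 1\<^sub>m b $$ (i, j)" unfolding GH(5) .
  qed (use car C in auto)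
  moreover have "similar_mat X (four_block_mat (D * (X * C)) (D * (X * K)) (L * (X * C)) (L * (X * K)))"
    if X: "X \<in> carrier_mat b b" for X
    unfolding blk[OF X, symmetric]
  proof (rule similar_matI)
    show "{X, G * X * H, H, G} \<subseteq> carrier_mat b b" using X GH by auto
    have "H * (G * X * H) * G = (H * G) * X * (H * G)"
      using X GH(2,3) by (simp add: mat_assoc)
    then show "X = H * (G * X * H) * G" unfolding GH(5) using X by simp
  qed (use GH in auto)
  ultimately show ?thesis using that[OF b car] by blast
qed

section \<open>Eigenvalues of the diagonal blocks, and duality\<close>

definition has_eigenvalues :: "complex mat \<Rightarrow> complex multiset \<Rightarrow> bool" where
  "has_eigenvalues M E \<longleftrightarrow> char_poly M = (\<Prod>x\<in>#E. [:- x, 1:])"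

lemma triangular_form:
  assumes M: "M \<in> carrier_mat n n" and E: "has_eigenvalues M E"
  obtains B S T where "similar_mat_wit M B S T" "upper_triangular B" "mset (diag_mat B) = E"
proof -
  obtain es where es: "mset es = E" using ex_mset by blast
  have cp: "char_poly M = (\<Prod>e\<leftarrow>es. [:- e, 1:])"
    using E unfolding has_eigenvalues_def es[symmetric] by (simp add: prod_mset_prod_list[symmetric] flip: mset_map)
  obtain B S T where "schur_decomposition M es = (B, S, T)" by (cases "schur_decomposition M es") auto
  from schur_decomposition[OF M cp this] show ?thesis using that es by auto
qed

lemma upper_triangular_eigenvalues:
  assumes "B \<in> carrier_mat n n" "upper_triangular B"
  shows "has_eigenvalues B (mset (diag_mat B))"
  unfolding has_eigenvalues_def char_poly_upper_triangular[OF assms]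
  by (simp add: prod_mset_prod_list[symmetric] flip: mset_map)

lemma has_eigenvalues_similar: "similar_mat A B \<Longrightarrow> has_eigenvalues A E \<longleftrightarrow> has_eigenvalues B E"
  unfolding has_eigenvalues_def by (simp add: char_poly_similar)

lemma has_eigenvalues_affine:
  assumes M: "M \<in> carrier_mat n n" and E: "has_eigenvalues M E"
  shows "has_eigenvalues (c \<cdot>\<^sub>m M + k \<cdot>\<^sub>m 1\<^sub>m n) (image_mset (\<lambda>x. c * x + k) E)"
proof -
  obtain B S T where B: "similar_mat_wit M B S T" "upper_triangular B" "mset (diag_mat B) = E"
    by (rule triangular_form[OF M E])
  note w = similar_mat_witD2[OF M B(1)]
  have w1: "S * T = 1\<^sub>m n" "T * S = 1\<^sub>m n" "M = S * B * T" "B \<in> carrier_mat n n" "S \<in> carrier_mat n n" "T \<in> carrier_mat n n"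
    using w by auto
  let ?B = "c \<cdot>\<^sub>m B + k \<cdot>\<^sub>m 1\<^sub>m n"
  have "c \<cdot>\<^sub>m M + k \<cdot>\<^sub>m 1\<^sub>m n = S * ?B * T"
  proof -
    have "S * ?B * T = S * (c \<cdot>\<^sub>m B) * T + S * (k \<cdot>\<^sub>m 1\<^sub>m n) * T"
      using w1 by (simp add: mat_addl mat_addr)
    also have "S * (c \<cdot>\<^sub>m B) = c \<cdot>\<^sub>m (S * B)" using w1 by (simp add: mult_smult_distrib)
    also have "c \<cdot>\<^sub>m (S * B) * T = c \<cdot>\<^sub>m M" using w1 by (simp add: mult_smult_assoc_mat[of _ n n])
    also have "S * (k \<cdot>\<^sub>m 1\<^sub>m n) = k \<cdot>\<^sub>m S" using w1 mult_smult_distrib[of S n n "1\<^sub>m n" n k] by simp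
    also have "k \<cdot>\<^sub>m S * T = k \<cdot>\<^sub>m 1\<^sub>m n" using w1 by (simp add: mult_smult_assoc_mat[of _ n n])
    finally show ?thesis by simp
  qed
  then have sim: "similar_mat (c \<cdot>\<^sub>m M + k \<cdot>\<^sub>m 1\<^sub>m n) ?B"
    by (intro similar_matI[of _ _ S T n]) (use w1 M in auto)
  have ev: "has_eigenvalues ?B (mset (diag_mat ?B))"
    by (rule upper_triangular_eigenvalues[of _ n]) (use w1 B(2) in \<open>auto simp: upper_triangular_def\<close>)
  have ms: "mset (diag_mat ?B) = image_mset (\<lambda>x. c * x + k) E"
    unfolding B(3)[symmetric] mset_map[symmetric]
    by (rule arg_cong[of _ _ mset], rule nth_equalityI) (use w1 in \<open>auto simp: diag_mat_def\<close>)
  show ?thesis using has_eigenvalues_similar[OF sim] ev unfolding ms by simp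
qed

lemma has_eigenvalues_transpose:
  "M \<in> carrier_mat n n \<Longrightarrow> has_eigenvalues (transpose_mat M) E \<longleftrightarrow> has_eigenvalues M E"
  unfolding has_eigenvalues_def by simp

lemma has_eigenvalues_block:
  assumes "A \<in> carrier_mat n n" "B \<in> carrier_mat n m" "D \<in> carrier_mat m m"
    and "has_eigenvalues A E" "has_eigenvalues D F"
  shows "has_eigenvalues (four_block_mat A B (0\<^sub>m m n) D) (E + F)"
proof -
  have "char_poly (four_block_mat A B (0\<^sub>m m n) D) = char_poly A * char_poly D"
    by (rule char_poly_0_block[OF refl _ _ assms(1-3)]) (use char_poly_factorized assms in blast)+
  then show ?thesis using assms unfolding has_eigenvalues_def by simp
qed

text \<open>The eigenvalues, up to a common shift, of the two diagonal blocks of a principal element.\<close>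

inductive heights :: "nat \<Rightarrow> nat \<Rightarrow> int multiset \<Rightarrow> int multiset \<Rightarrow> bool" where
  unit: "heights 1 1 {#1#} {#0#}"
| left: "heights a b E F \<Longrightarrow> heights a (a + b) (image_mset (\<lambda>x. x + 1) E) (E + F)"
| right: "heights a b E F \<Longrightarrow> heights (a + b) b (E + F) (image_mset (\<lambda>x. x - 1) F)"

lemma heights_dual:
  "heights a b E F \<Longrightarrow> heights b a (image_mset (\<lambda>x. 1 - x) F) (image_mset (\<lambda>x. 1 - x) E)"
proof (induction rule: heights.induct)
  case unit
  from heights.unit show ?case by simp
next
  case (left a b E F)
  from heights.right[OF left.IH] show ?case by (simp add: multiset.map_comp comp_def add_ac)
next
  case (right a b E F)
  from heights.left[OF right.IH] show ?case by (simp add: multiset.map_comp comp_def add_ac)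
qed

lemma mat_uminus:
  fixes A B :: "'a :: comm_ring_1 mat"
  assumes "dim_col A = dim_row B"
  shows mat_uminusl: "(- A) * B = - (A * B)" and mat_uminusr: "A * (- B) = - (A * B)"
  using assms by (auto intro!: eq_matI simp: scalar_prod_def sum_negf)

text \<open>Minus transposition reverses the block order and respects commutators. On the equations
  it acts by transposing: the first and third change places and e is unchanged.\<close>

lemma adjoint_system_dual:
  assumes s: "adjoint_system a b A B C P Q R e"
    and A: "A \<in> carrier_mat a a" and B: "B \<in> carrier_mat b b" and C: "C \<in> carrier_mat b a"
  shows "adjoint_system b a (transpose_mat B) (transpose_mat A) (transpose_mat C)
    (- transpose_mat Q) (- transpose_mat P) (- transpose_mat R) e"
proof -
  have P: "P \<in> carrier_mat a a" and Q: "Q \<in> carrier_mat b b" and R: "R \<in> carrier_mat a b"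
    and e: "A * P - P * A - R * C = e \<cdot>\<^sub>m A" "C * P - Q * C = e \<cdot>\<^sub>m C" "C * R + (B * Q - Q * B) = e \<cdot>\<^sub>m B"
    using s by (auto simp: adjoint_system_def)
  note dm = carrier_matD[OF A] carrier_matD[OF B] carrier_matD[OF C]
    carrier_matD[OF P] carrier_matD[OF Q] carrier_matD[OF R]
  have tm: "transpose_mat X * transpose_mat Y = transpose_mat (Y * X)" if "dim_col Y = dim_row X"
    for X Y :: "complex mat"
    by (rule transpose_mult[symmetric, of Y "dim_row Y" "dim_row X" X "dim_col X"]) (use that in auto)
  show ?thesis unfolding adjoint_system_def
  proof (intro conjI)
    show "transpose_mat B * - transpose_mat Q - - transpose_mat Q * transpose_mat B
        - - transpose_mat R * transpose_mat C = e \<cdot>\<^sub>m transpose_mat B"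
      (is "?l = _")
    proof (rule eq_matI)
      fix i j assume "i < dim_row (e \<cdot>\<^sub>m transpose_mat B)" "j < dim_col (e \<cdot>\<^sub>m transpose_mat B)"
      then show "?l $$ (i, j) = (e \<cdot>\<^sub>m transpose_mat B) $$ (i, j)"
        using mat_eqD[OF e(3), of "(j, i)"] by (simp add: mat_uminus tm dm add_ac del: index_mult_mat(1))
    qed (auto simp: dm)
    show "transpose_mat C * - transpose_mat Q - - transpose_mat P * transpose_mat C = e \<cdot>\<^sub>m transpose_mat C"
      (is "?l = _")
    proof (rule eq_matI)
      fix i j assume "i < dim_row (e \<cdot>\<^sub>m transpose_mat C)" "j < dim_col (e \<cdot>\<^sub>m transpose_mat C)"
      then show "?l $$ (i, j) = (e \<cdot>\<^sub>m transpose_mat C) $$ (i, j)"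
        using mat_eqD[OF e(2), of "(j, i)"] by (simp add: mat_uminus tm dm del: index_mult_mat(1))
    qed (auto simp: dm)
    show "transpose_mat C * - transpose_mat R
        + (transpose_mat A * - transpose_mat P - - transpose_mat P * transpose_mat A) = e \<cdot>\<^sub>m transpose_mat A"
      (is "?l = _")
    proof (rule eq_matI)
      fix i j assume "i < dim_row (e \<cdot>\<^sub>m transpose_mat A)" "j < dim_col (e \<cdot>\<^sub>m transpose_mat A)"
      then show "?l $$ (i, j) = (e \<cdot>\<^sub>m transpose_mat A) $$ (i, j)"
        using mat_eqD[OF e(1), of "(j, i)"] by (simp add: mat_uminus tm dm del: index_mult_mat(1))
    qed (auto simp: dm)
  qed (use P Q R in auto)
qed

lemma nondegenerate_dual:
  assumes nd: "nondegenerate a b A B C"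
  shows "nondegenerate b a (transpose_mat B) (transpose_mat A) (transpose_mat C)"
  unfolding nondegenerate_def
proof (intro conjI allI impI)
  have A: "A \<in> carrier_mat a a" and B: "B \<in> carrier_mat b b" and C: "C \<in> carrier_mat b a"
    using nd by (auto simp: nondegenerate_def)
  then show "transpose_mat B \<in> carrier_mat b b" "transpose_mat A \<in> carrier_mat a a"
    "transpose_mat C \<in> carrier_mat a b" by auto
next
  fix P Q R
  have A: "A \<in> carrier_mat a a" and B: "B \<in> carrier_mat b b" and C: "C \<in> carrier_mat b a"
    using nd by (auto simp: nondegenerate_def)
  assume s: "adjoint_system b a (transpose_mat B) (transpose_mat A) (transpose_mat C) P Q R 0"
  then have P: "P \<in> carrier_mat b b" and Q: "Q \<in> carrier_mat a a" and R: "R \<in> carrier_mat b a"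
    by (auto simp: adjoint_system_def)
  from adjoint_system_dual[OF s] A B C
  have "adjoint_system a b A B C (- transpose_mat Q) (- transpose_mat P) (- transpose_mat R) 0" by simp
  then obtain c where c: "- transpose_mat Q = c \<cdot>\<^sub>m 1\<^sub>m a" "- transpose_mat P = c \<cdot>\<^sub>m 1\<^sub>m b"
    and r: "- transpose_mat R = 0\<^sub>m a b" using nd unfolding nondegenerate_def by blast
  have "X = (- c) \<cdot>\<^sub>m 1\<^sub>m n" if "- transpose_mat X = c \<cdot>\<^sub>m 1\<^sub>m n" "X \<in> carrier_mat n n" for X n
  proof (rule eq_matI)
    fix i j assume "i < dim_row ((- c) \<cdot>\<^sub>m 1\<^sub>m n)" "j < dim_col ((- c) \<cdot>\<^sub>m 1\<^sub>m n)"
    then show "X $$ (i, j) = ((- c) \<cdot>\<^sub>m 1\<^sub>m n) $$ (i, j)"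
      using mat_eqD[OF that(1), of "(j, i)"] that(2) by (auto simp: minus_equation_iff)
  qed (use that in auto)
  from this[OF c(1) Q] this[OF c(2) P] show "\<exists>c. P = c \<cdot>\<^sub>m 1\<^sub>m b \<and> Q = c \<cdot>\<^sub>m 1\<^sub>m a" by blast
  show "R = 0\<^sub>m b a"
  proof (rule eq_matI)
    fix i j assume "i < dim_row (0\<^sub>m b a :: complex mat)" "j < dim_col (0\<^sub>m b a :: complex mat)"
    then show "R $$ (i, j) = 0\<^sub>m b a $$ (i, j)" using mat_eqD[OF r, of "(j, i)"] R by auto
  qed (use R in auto)
qed

text \<open>If v is in the kernel of \<open>C\<close> and w in the kernel of its transpose, the rank
  one matrix \<open>R\<close> with entries \<open>v $ i * w $ j\<close> satisfies
  \<open>C * R = 0\<close> and \<open>R * C = 0\<close>, so (0, 0, R) lies in the radical.\<close>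

lemma nondegenerate_trivial_kernel:
  assumes nd: "nondegenerate a b A B C" and ab: "a < b" and v: "v \<in> carrier_vec a" "C *\<^sub>v v = 0\<^sub>v b"
  shows "v = 0\<^sub>v a"
proof (rule ccontr)
  assume nz: "v \<noteq> 0\<^sub>v a"
  have A: "A \<in> carrier_mat a a" and B: "B \<in> carrier_mat b b" and C: "C \<in> carrier_mat b a"
    using nd by (auto simp: nondegenerate_def)
  \<comment> \<open>Otherwise the transpose of \<open>C\<close> would be injective from dimension b
    to the smaller dimension a.\<close>
  have "\<exists>w. w \<in> carrier_vec b \<and> transpose_mat C *\<^sub>v w = 0\<^sub>v a \<and> w \<noteq> 0\<^sub>v b"
  proof (rule ccontr)
    assume no: "\<not> ?thesis"
    show False
      by (rule trivial_kernel_split[of "transpose_mat C" a b]) (use C no ab in auto)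
  qed
  then obtain w where w: "w \<in> carrier_vec b" "transpose_mat C *\<^sub>v w = 0\<^sub>v a" "w \<noteq> 0\<^sub>v b" by blast
  define R where "R = mat a b (\<lambda>(i, j). v $ i * w $ j)"
  have CR: "C * R = 0\<^sub>m b b"
  proof (rule eq_matI)
    fix i j assume ij: "i < dim_row (0\<^sub>m b b :: complex mat)" "j < dim_col (0\<^sub>m b b :: complex mat)"
    then have "(C * R) $$ (i, j) = (C *\<^sub>v v) $ i * w $ j" using C v(1)
      by (simp add: R_def scalar_prod_def sum_distrib_right mult.assoc)
    then show "(C * R) $$ (i, j) = 0\<^sub>m b b $$ (i, j)" using ij v(2) by simp
  qed (use C in \<open>auto simp: R_def\<close>)
  have RC: "R * C = 0\<^sub>m a a"
  proof (rule eq_matI)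
    fix i j assume ij: "i < dim_row (0\<^sub>m a a :: complex mat)" "j < dim_col (0\<^sub>m a a :: complex mat)"
    then have "(R * C) $$ (i, j) = v $ i * (transpose_mat C *\<^sub>v w) $ j" using C w(1)
      by (simp add: R_def scalar_prod_def sum_distrib_left mult_ac)
    then show "(R * C) $$ (i, j) = 0\<^sub>m a a $$ (i, j)" using ij w(2) by simp
  qed (use C in \<open>auto simp: R_def\<close>)
  have z: "0 \<cdot>\<^sub>m X = 0\<^sub>m (dim_row X) (dim_col X)" for X :: "complex mat" by (rule eq_matI) auto
  have "adjoint_system a b A B C (0\<^sub>m a a) (0\<^sub>m b b) R 0"
    unfolding adjoint_system_def z CR RC using A B C by (auto simp: R_def)
  then have R0: "R = 0\<^sub>m a b" using nd unfolding nondegenerate_def by blast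
  have vw: "v $ i * w $ j = 0" if "i < a" "j < b" for i j
    using mat_eqD[OF R0, of "(i, j)"] that by (simp add: R_def del: mult_eq_0_iff)
  have "\<exists>i<a. v $ i \<noteq> 0" using nz v(1) by (metis carrier_vecD eq_vecI index_zero_vec)
  moreover have "\<exists>j<b. w $ j \<noteq> 0" using w(1,3) by (metis carrier_vecD eq_vecI index_zero_vec)
  ultimately show False using vw by (metis mult_eq_0_iff)
qed

lemma has_eigenvalues_one:
  assumes "M \<in> carrier_mat 1 1"
  shows "has_eigenvalues M {#M $$ (0, 0)#}"
  using upper_triangular_eigenvalues[of M 1] assms by (auto simp: diag_mat_def upper_triangular_def)

text \<open>Only the eigenvalues up to a common shift \<open>s\<close> are tracked, as ad h depends
  on their differences alone.\<close>

theorem principal_heights: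
  assumes "nondegenerate a b A B C" "adjoint_system a b A B C P Q R 1" "a > 0" "b > 0" "coprime a b"
  shows "\<exists>s E F. heights a b E F \<and> has_eigenvalues P (image_mset (\<lambda>x. s + of_int x) E) \<and>
    has_eigenvalues Q (image_mset (\<lambda>x. s + of_int x) F)"
  using assms
\<comment> \<open>Duality keeps a + b and clears the indicator; the reduction lowers a + b, and the
  factor 2 outweighs a possible rise of the indicator.\<close>
proof (induction "2 * (a + b) + of_bool (b < a)" arbitrary: a b A B C P Q R rule: less_induct)
  case less
  note nd = less.prems(1) and s = less.prems(2)
  have A: "A \<in> carrier_mat a a" and B: "B \<in> carrier_mat b b" and C: "C \<in> carrier_mat b a"
    using nd by (auto simp: nondegenerate_def)
  have P: "P \<in> carrier_mat a a" and Q: "Q \<in> carrier_mat b b" and R: "R \<in> carrier_mat a b"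
    using s by (auto simp: adjoint_system_def)
  consider "a = b" | "a < b" | "b < a" by linarith
  then show ?case
  proof cases
    case 1
    then have ab: "a = 1" "b = 1" using less.prems by auto
    note c1 = A[unfolded ab] B[unfolded ab] C[unfolded ab] P[unfolded ab] Q[unfolded ab]
    have C0: "C $$ (0, 0) \<noteq> 0"
    proof
      assume "C $$ (0, 0) = 0"
      then have C0: "C = 0\<^sub>m 1 1" using c1 by (intro eq_matI) auto
      have z: "0 \<cdot>\<^sub>m X = 0\<^sub>m (dim_row X) (dim_col X)" for X :: "complex mat" by (rule eq_matI) auto
      have "adjoint_system 1 1 A B C (0\<^sub>m 1 1) (0\<^sub>m 1 1) (1\<^sub>m 1) 0"
        unfolding adjoint_system_def z C0 using c1 by auto
      then have "(1\<^sub>m 1 :: complex mat) = 0\<^sub>m 1 1" using nd unfolding nondegenerate_def ab by blast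
      from mat_eqD[OF this, of "(0, 0)"] show False by simp
    qed
    have "C * P - Q * C = 1 \<cdot>\<^sub>m C" using s by (simp add: adjoint_system_def)
    from mat_eqD[OF this, of "(0, 0)"] have "C $$ (0, 0) * (P $$ (0, 0) - Q $$ (0, 0) - 1) = 0"
      using c1 by (simp add: scalar_prod_def algebra_simps)
    then have "P $$ (0, 0) - Q $$ (0, 0) - 1 = 0" using C0 by (simp only: mult_eq_0_iff simp_thms)
    then have PQ: "P $$ (0, 0) = Q $$ (0, 0) + 1" by (simp add: algebra_simps)
    show ?thesis
      using heights.unit has_eigenvalues_one[OF c1(4)] has_eigenvalues_one[OF c1(5)] unfolding ab PQ
      by (intro exI[of _ "Q $$ (0, 0)"] exI[of _ "{#1#}"] exI[of _ "{#0#}"]) simp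
  next
    case 2
    obtain d D L K where bd: "b = a + d" and DLK: "D \<in> carrier_mat a b" "L \<in> carrier_mat d b" "K \<in> carrier_mat b d"
      "D * C = 1\<^sub>m a" "L * C = 0\<^sub>m d a" "L * K = 1\<^sub>m d" "D * K = 0\<^sub>m a d" "C * D + K * L = 1\<^sub>m b"
      and sim: "\<And>X. X \<in> carrier_mat b b \<Longrightarrow> similar_mat X
         (four_block_mat (D * (X * C)) (D * (X * K)) (L * (X * C)) (L * (X * K)))"
      by (rule trivial_kernel_split[OF C]) (use nondegenerate_trivial_kernel[OF nd 2] in auto)
    note ctx = A B[unfolded bd] C[unfolded bd] DLK[unfolded bd]
    note rs = reduce_system[OF ctx s[unfolded bd]] and rn = reduce_nondegenerate[OF ctx nd[unfolded bd]]
    have "\<exists>s E F. heights a d E F \<and> has_eigenvalues (P - 1\<^sub>m a) (image_mset (\<lambda>x. s + of_int x) E) \<and>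
        has_eigenvalues (L * (Q * K)) (image_mset (\<lambda>x. s + of_int x) F)"
      by (rule less.hyps[OF _ rn rs(1)]) (use 2 less.prems in \<open>auto simp: bd coprime_iff_gcd_eq_1\<close>)
    then obtain s E F where sEF: "heights a d E F" "has_eigenvalues (P - 1\<^sub>m a) (image_mset (\<lambda>x. s + of_int x) E)"
        "has_eigenvalues (L * (Q * K)) (image_mset (\<lambda>x. s + of_int x) F)" by blast
    have Pc: "P - 1\<^sub>m a \<in> carrier_mat a a" using P by auto
    have "1 \<cdot>\<^sub>m (P - 1\<^sub>m a) + 1 \<cdot>\<^sub>m 1\<^sub>m a = P" using P by (intro eq_matI) auto
    with has_eigenvalues_affine[OF Pc sEF(2), of 1 1]
    have "has_eigenvalues P (image_mset (\<lambda>x. s + of_int x) (image_mset (\<lambda>x. x + 1) E))"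
      by (simp add: multiset.map_comp comp_def add_ac)
    moreover have "has_eigenvalues Q (image_mset (\<lambda>x. s + of_int x) (E + F))"
    proof -
      have "similar_mat Q (four_block_mat (P - 1\<^sub>m a) (D * (Q * K)) (0\<^sub>m d a) (L * (Q * K)))"
        using sim[OF Q] rs(2,3) by simp
      moreover have "has_eigenvalues (four_block_mat (P - 1\<^sub>m a) (D * (Q * K)) (0\<^sub>m d a) (L * (Q * K)))
          (image_mset (\<lambda>x. s + of_int x) E + image_mset (\<lambda>x. s + of_int x) F)"
        by (rule has_eigenvalues_block[OF Pc _ _ sEF(2,3)]) (use DLK Q in auto)
      ultimately show ?thesis using has_eigenvalues_similar by simp
    qed
    ultimately show ?thesis using heights.left[OF sEF(1)] unfolding bd by blast
  next
    case 3
    have "\<exists>s E F. heights b a E F \<and> has_eigenvalues (- transpose_mat Q) (image_mset (\<lambda>x. s + of_int x) E) \<and>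
        has_eigenvalues (- transpose_mat P) (image_mset (\<lambda>x. s + of_int x) F)"
      by (rule less.hyps[OF _ nondegenerate_dual[OF nd] adjoint_system_dual[OF s A B C]])
        (use 3 less.prems in \<open>auto simp: coprime_commute\<close>)
    then obtain s E F where sEF: "heights b a E F"
        "has_eigenvalues (- transpose_mat Q) (image_mset (\<lambda>x. s + of_int x) E)"
        "has_eigenvalues (- transpose_mat P) (image_mset (\<lambda>x. s + of_int x) F)" by blast
    \<comment> \<open>The shift is forced by \<open>heights_dual\<close>, which uses 1 - x: indeed -
      (s + x) = (- s - 1) + (1 - x).\<close>
    have neg: "has_eigenvalues X (image_mset (\<lambda>x. (- s - 1) + of_int x) (image_mset (\<lambda>x. 1 - x) G))"
      if X: "X \<in> carrier_mat n n" and e: "has_eigenvalues (- transpose_mat X) (image_mset (\<lambda>x. s + of_int x) G)"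
      for X n G
    proof -
      have "- transpose_mat X \<in> carrier_mat n n" using X by auto
      from has_eigenvalues_affine[OF this e, of "- 1" 0]
      have "has_eigenvalues (- 1 \<cdot>\<^sub>m (- transpose_mat X) + 0 \<cdot>\<^sub>m 1\<^sub>m n) (image_mset (\<lambda>x. - 1 * (s + of_int x) + 0) G)"
        by (simp add: multiset.map_comp comp_def)
      moreover have "- 1 \<cdot>\<^sub>m (- transpose_mat X) + 0 \<cdot>\<^sub>m 1\<^sub>m n = transpose_mat X" using X by (intro eq_matI) auto
      ultimately show ?thesis using has_eigenvalues_transpose[OF X]
        by (simp add: multiset.map_comp comp_def algebra_simps)
    qed
    from heights_dual[OF sEF(1)] neg[OF P sEF(3)] neg[OF Q sEF(2)] show ?thesis by blast
  qed
qed

section \<open>The block triangular algebra and its trace form\<close>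

text \<open>This is \<open>W\<close> without the trace condition. It differs from \<open>W\<close>
  only by scalars, which commute with everything, and it has a basis of matrix units.\<close>

definition parabolic :: "nat \<Rightarrow> nat \<Rightarrow> complex mat set" where
  "parabolic a b = {M \<in> carrier_mat (a + b) (a + b). \<forall>i j. a \<le> i \<and> i < a + b \<and> j < a \<longrightarrow> M $$ (i, j) = 0}"

lemma parabolic_carrier: "M \<in> parabolic a b \<Longrightarrow> M \<in> carrier_mat (a + b) (a + b)"
  by (simp add: parabolic_def)

lemma parabolic_block:
  "X \<in> carrier_mat a a \<Longrightarrow> Y \<in> carrier_mat b b \<Longrightarrow> Z \<in> carrier_mat a b \<Longrightarrow>
    four_block_mat X Z (0\<^sub>m b a) Y \<in> parabolic a b"
  by (auto simp: parabolic_def)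

lemma parabolic_cases:
  assumes "M \<in> parabolic a b"
  obtains X Y Z where "X \<in> carrier_mat a a" "Y \<in> carrier_mat b b" "Z \<in> carrier_mat a b"
    "M = four_block_mat X Z (0\<^sub>m b a) Y"
proof -
  let ?X = "mat a a (($$) M)" and ?Z = "mat a b (\<lambda>(i, j). M $$ (i, j + a))"
    and ?Y = "mat b b (\<lambda>(i, j). M $$ (i + a, j + a))"
  have "M = four_block_mat ?X ?Z (0\<^sub>m b a) ?Y"
    using assms unfolding parabolic_def by (intro eq_matI) auto
  then show ?thesis using that[of ?X ?Y ?Z] by auto
qed

lemma parabolic_closed:
  assumes "M \<in> parabolic a b" "N \<in> parabolic a b"
  shows "M + N \<in> parabolic a b" "M - N \<in> parabolic a b" "c \<cdot>\<^sub>m M \<in> parabolic a b" "M * N \<in> parabolic a b"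
proof -
  show "M * N \<in> parabolic a b"
    using assms unfolding parabolic_def
    by (auto simp: scalar_prod_def intro!: sum.neutral) (metis not_le_imp_less)
qed (use assms in \<open>auto simp: parabolic_def\<close>)

lemma parabolic_one: "1\<^sub>m (a + b) \<in> parabolic a b"
  by (auto simp: parabolic_def)

lemma mat_trace_block:
  assumes "X \<in> carrier_mat a a" "Y \<in> carrier_mat b b" "Z \<in> carrier_mat a b"
  shows "mat_trace (four_block_mat X Z (0\<^sub>m b a) Y) = mat_trace X + mat_trace Y"
  using assms by (simp add: mat_trace_def sum_split_nat)

lemma W_eq: "W a b = {M \<in> parabolic a b. mat_trace M = 0}"
proof (rule Set.set_eqI, rule iffI)
  fix M assume "M \<in> W a b"
  then show "M \<in> {M \<in> parabolic a b. mat_trace M = 0}"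
    unfolding W_def using parabolic_block mat_trace_block by auto
next
  fix M assume M: "M \<in> {M \<in> parabolic a b. mat_trace M = 0}"
  then obtain X Y Z where "X \<in> carrier_mat a a" "Y \<in> carrier_mat b b" "Z \<in> carrier_mat a b"
    "M = four_block_mat X Z (0\<^sub>m b a) Y" using parabolic_cases by blast
  then show "M \<in> W a b" using M mat_trace_block unfolding W_def by auto
qed

lemma mat_trace_simps:
  assumes "M \<in> carrier_mat n n" "N \<in> carrier_mat n n"
  shows "mat_trace (M + N) = mat_trace M + mat_trace N" "mat_trace (M - N) = mat_trace M - mat_trace N"
    "mat_trace (c \<cdot>\<^sub>m M) = c * mat_trace M" "mat_trace (1\<^sub>m n) = of_nat n"
  using assms by (simp_all add: mat_trace_def sum.distrib sum_subtractf sum_distrib_left)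

lemma mat_trace_mult:
  assumes "M \<in> carrier_mat m n" "N \<in> carrier_mat n m"
  shows "mat_trace (M * N) = (\<Sum>i<m. \<Sum>j<n. M $$ (i, j) * N $$ (j, i))"
  using assms by (simp add: mat_trace_def scalar_prod_def atLeast0LessThan)

lemma mat_trace_commute:
  assumes "M \<in> carrier_mat m n" "N \<in> carrier_mat n m"
  shows "mat_trace (M * N) = mat_trace (N * M)"
  unfolding mat_trace_mult[OF assms] mat_trace_mult[OF assms(2,1)]
  by (subst sum.swap) (simp add: mult.commute)

lemma commutator_closed:
  assumes "x \<in> parabolic a b" "y \<in> parabolic a b"
  shows "commutator x y \<in> W a b"
proof -
  have c: "x \<in> carrier_mat (a + b) (a + b)" "y \<in> carrier_mat (a + b) (a + b)"
    using assms by (auto simp: parabolic_def)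
  then show ?thesis
    unfolding W_eq commutator_def using parabolic_closed assms
    by (simp add: mat_trace_simps[of _ "a + b"] mat_trace_commute[of y "a + b" "a + b" x])
qed

definition matrix_unit :: "nat \<Rightarrow> nat \<times> nat \<Rightarrow> complex mat" where
  "matrix_unit n p = mat n n (\<lambda>q. of_bool (q = p))"

definition positions :: "nat \<Rightarrow> nat \<Rightarrow> (nat \<times> nat) set" where
  "positions a b = {(i, j). i < a + b \<and> j < a + b \<and> \<not> (a \<le> i \<and> j < a)}"

lemma finite_positions: "finite (positions a b)"
  by (rule finite_subset[of _ "{..<a + b} \<times> {..<a + b}"]) (auto simp: positions_def)

lemma matrix_unit_parabolic: "p \<in> positions a b \<Longrightarrow> matrix_unit (a + b) p \<in> parabolic a b"
  by (auto simp: positions_def parabolic_def matrix_unit_def)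

lemma linear_functional_expand:
  assumes g: "linear_functional (parabolic a b) g" and x: "x \<in> parabolic a b"
  shows "g x = (\<Sum>p\<in>positions a b. x $$ p * g (matrix_unit (a + b) p))"
proof -
  let ?m = "\<lambda>S. mat (a + b) (a + b) (\<lambda>p. if p \<in> S then x $$ p else 0)"
  have par: "?m S \<in> parabolic a b" for S using x by (auto simp: parabolic_def)
  have "g (?m S) = (\<Sum>p\<in>S. x $$ p * g (matrix_unit (a + b) p))" if "finite S" "S \<subseteq> positions a b" for S
    using that
  proof (induction S rule: finite_induct)
    case empty
    have e: "0 \<cdot>\<^sub>m ?m {} = ?m {}" by (intro eq_matI) auto
    have "g (0 \<cdot>\<^sub>m ?m {}) = 0 * g (?m {})" using g par unfolding linear_functional_def by blast
    then show ?case unfolding e by simp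
  next
    case (insert p S)
    have pp: "matrix_unit (a + b) p \<in> parabolic a b" using insert.prems matrix_unit_parabolic by auto
    have "?m (insert p S) = x $$ p \<cdot>\<^sub>m matrix_unit (a + b) p + ?m S"
      using insert.hyps by (intro eq_matI) (auto simp: matrix_unit_def)
    then have "g (?m (insert p S)) = g (x $$ p \<cdot>\<^sub>m matrix_unit (a + b) p) + g (?m S)"
      using g par[of S] parabolic_closed(3)[OF pp pp] unfolding linear_functional_def by simp
    also have "g (x $$ p \<cdot>\<^sub>m matrix_unit (a + b) p) = x $$ p * g (matrix_unit (a + b) p)"
      using g pp unfolding linear_functional_def by simp
    finally show ?case using insert by simp
  qed
  from this[OF finite_positions subset_refl]
  have "g (?m (positions a b)) = (\<Sum>p\<in>positions a b. x $$ p * g (matrix_unit (a + b) p))" .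
  moreover have "?m (positions a b) = x"
    using x by (intro eq_matI) (auto simp: parabolic_def positions_def)
  ultimately show ?thesis by simp
qed

lemma traceless_part:
  assumes x: "x \<in> parabolic a b" and "a + b > 0"
  defines "t \<equiv> mat_trace x / of_nat (a + b)"
  shows "x - t \<cdot>\<^sub>m 1\<^sub>m (a + b) \<in> W a b"
proof -
  have "x \<in> carrier_mat (a + b) (a + b)" using x by (auto simp: parabolic_def)
  then have "mat_trace (x - t \<cdot>\<^sub>m 1\<^sub>m (a + b)) = mat_trace x - t * of_nat (a + b)"
    by (subst mat_trace_simps(2)[of _ "a + b"]) (simp_all add: mat_trace_simps[of "1\<^sub>m (a + b)" "a + b" "1\<^sub>m (a + b)"] del: of_nat_add)
  also have "\<dots> = 0" using assms(2) unfolding t_def by (simp del: of_nat_add)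
  finally show ?thesis using x parabolic_closed parabolic_one unfolding W_eq by auto
qed

lemma commutator_shift:
  assumes "x \<in> carrier_mat n n" "y \<in> carrier_mat n n"
  shows "commutator (x - t \<cdot>\<^sub>m 1\<^sub>m n) y = commutator x y" "commutator y (x - t \<cdot>\<^sub>m 1\<^sub>m n) = commutator y x"
proof -
  have e: "t \<cdot>\<^sub>m 1\<^sub>m n * y = t \<cdot>\<^sub>m y" "y * (t \<cdot>\<^sub>m 1\<^sub>m n) = t \<cdot>\<^sub>m y"
    using assms mult_smult_assoc_mat[of "1\<^sub>m n" n n y n t] mult_smult_distrib[of y n n "1\<^sub>m n" n t] by simp_all
  show "commutator (x - t \<cdot>\<^sub>m 1\<^sub>m n) y = commutator x y" "commutator y (x - t \<cdot>\<^sub>m 1\<^sub>m n) = commutator y x"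
    unfolding commutator_def using assms
    by (simp_all add: mat_subl mat_subr e) (auto intro!: eq_matI simp del: index_mult_mat(1))
qed

text \<open>Functionals on the parabolic algebra are written as \<open>x \<mapsto> tr (G x)\<close> with \<open>G\<close> block lower
  triangular; such a \<open>G\<close> is determined by the functional.\<close>

lemma adjoint_system_iff_trace:
  assumes A: "A \<in> carrier_mat a a" and B: "B \<in> carrier_mat b b" and C: "C \<in> carrier_mat b a"
    and P: "P \<in> carrier_mat a a" and Q: "Q \<in> carrier_mat b b" and R: "R \<in> carrier_mat a b"
  defines "G \<equiv> four_block_mat A (0\<^sub>m a b) C B" and "h \<equiv> four_block_mat P R (0\<^sub>m b a) Q"
  shows "adjoint_system a b A B C P Q R e \<longleftrightarrow>
    (\<forall>x\<in>parabolic a b. mat_trace (G * commutator h x) = e * mat_trace (G * x))"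
proof -
  let ?n = "a + b"
  have G: "G \<in> carrier_mat ?n ?n" and h: "h \<in> carrier_mat ?n ?n"
    unfolding G_def h_def using A B P Q by auto
  \<comment> \<open>By cyclicity of the trace, the right hand side of the claim says that
    \<open>N\<close> is trace orthogonal to the block triangular algebra.\<close>
  define N where "N = G * h - h * G - e \<cdot>\<^sub>m G"
  have N: "N \<in> carrier_mat ?n ?n" unfolding N_def using G h by auto
  have blocks: "G * h = four_block_mat (A * P) (A * R) (C * P) (C * R + B * Q)"
    "h * G = four_block_mat (P * A + R * C) (R * B) (Q * C) (Q * B)"
    unfolding G_def h_def using A B C P Q R
    by (simp_all add: mult_four_block_mat[of _ a a _ b _ b _ _ a _ b])
  have Nb: "N = four_block_mat (A * P) (A * R) (C * P) (C * R + B * Q)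
      - four_block_mat (P * A + R * C) (R * B) (Q * C) (Q * B) - e \<cdot>\<^sub>m four_block_mat A (0\<^sub>m a b) C B"
    unfolding N_def blocks unfolding G_def ..
  have tr: "mat_trace (G * commutator h x) - e * mat_trace (G * x) = mat_trace (N * x)"
    if "x \<in> carrier_mat ?n ?n" for x
  proof -
    note dm = carrier_matD[OF G] carrier_matD[OF h] carrier_matD[OF that]
    have "mat_trace (G * commutator h x) = mat_trace (G * (h * x)) - mat_trace (G * (x * h))"
      unfolding commutator_def using G h that
      by (simp add: mat_subl mat_trace_simps(2)[of _ ?n])
    also have "mat_trace (G * (x * h)) = mat_trace (h * G * x)"
      using mat_trace_commute[of "G * x" ?n ?n h] G h that by (simp add: mat_assoc)
    finally have "mat_trace (G * commutator h x) = mat_trace (G * (h * x)) - mat_trace (h * (G * x))"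
      using G h that by (simp add: mat_assoc)
    moreover have "N * x = G * (h * x) - h * (G * x) - e \<cdot>\<^sub>m (G * x)"
      unfolding N_def using G h that by (simp add: mat_subr mat_assoc mult_smult_assoc_mat[of _ ?n ?n _ ?n])
    moreover have c: "G * (h * x) \<in> carrier_mat ?n ?n" "h * (G * x) \<in> carrier_mat ?n ?n" "G * x \<in> carrier_mat ?n ?n"
      using G h that by auto
    moreover have "mat_trace (G * (h * x) - h * (G * x) - e \<cdot>\<^sub>m (G * x))
        = mat_trace (G * (h * x)) - mat_trace (h * (G * x)) - e * mat_trace (G * x)"
      using mat_trace_simps(2)[of "G * (h * x) - h * (G * x)" ?n "e \<cdot>\<^sub>m (G * x)"]
        mat_trace_simps(2)[OF c(1,2)] mat_trace_simps(3)[OF c(3,3)] c minus_carrier_mat[OF c(2)] by simp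
    ultimately show ?thesis by simp
  qed
  have pos: "(\<forall>x\<in>parabolic a b. mat_trace (N * x) = 0) \<longleftrightarrow> (\<forall>(j, i)\<in>positions a b. N $$ (i, j) = 0)"
  proof (intro iffI ballI)
    fix p assume l: "\<forall>x\<in>parabolic a b. mat_trace (N * x) = 0" and p: "p \<in> positions a b"
    obtain j i where ji: "p = (j, i)" by (cases p)
    then have lt: "i < ?n" "j < ?n" using p by (auto simp: positions_def)
    have "mat_trace (N * matrix_unit ?n p) = (\<Sum>k<?n. \<Sum>l<?n. N $$ (k, l) * matrix_unit ?n p $$ (l, k))"
      by (rule mat_trace_mult[OF N]) (simp add: matrix_unit_def)
    also have "\<dots> = (\<Sum>k<?n. \<Sum>l<?n. if l = j then if k = i then N $$ (i, j) else 0 else 0)"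
      by (intro sum.cong refl) (auto simp: matrix_unit_def ji)
    also have "\<dots> = N $$ (i, j)" using lt by (simp add: sum.delta)
    finally show "case p of (j, i) \<Rightarrow> N $$ (i, j) = 0" using l matrix_unit_parabolic[OF p] ji by simp
  next
    fix x assume l: "\<forall>(j, i)\<in>positions a b. N $$ (i, j) = 0" and x: "x \<in> parabolic a b"
    have "mat_trace (N * x) = (\<Sum>i<?n. \<Sum>j<?n. N $$ (i, j) * x $$ (j, i))"
      by (rule mat_trace_mult[OF N]) (use x in \<open>simp add: parabolic_def\<close>)
    also have "\<dots> = 0"
      using l x by (intro sum.neutral ballI) (auto simp: parabolic_def positions_def)
    finally show "mat_trace (N * x) = 0" .
  qed
  have "adjoint_system a b A B C P Q R e \<longleftrightarrow> (\<forall>(j, i)\<in>positions a b. N $$ (i, j) = 0)"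
  proof
    assume s: "adjoint_system a b A B C P Q R e"
    then have e: "A * P - P * A - R * C = e \<cdot>\<^sub>m A" "C * P - Q * C = e \<cdot>\<^sub>m C" "C * R + (B * Q - Q * B) = e \<cdot>\<^sub>m B"
      by (auto simp: adjoint_system_def)
    show "\<forall>(j, i)\<in>positions a b. N $$ (i, j) = 0"
    proof (clarify)
      fix j i assume "(j, i) \<in> positions a b"
      then have ij: "i < ?n" "j < ?n" "i < a \<Longrightarrow> j < a" by (auto simp: positions_def)
      show "N $$ (i, j) = 0"
        using ij mat_eqD[OF e(1), of "(i, j)"] mat_eqD[OF e(2), of "(i - a, j)"] mat_eqD[OF e(3), of "(i - a, j - a)"]
          A B C P Q R
        unfolding Nb
        by (cases "i < a"; cases "j < a") (simp_all add: algebra_simps del: index_mult_mat(1))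
    qed
  next
    assume l: "\<forall>(j, i)\<in>positions a b. N $$ (i, j) = 0"
    have n: "N $$ (i, j) = 0" if "i < ?n" "j < ?n" "i < a \<Longrightarrow> j < a" for i j
      using l that by (force simp: positions_def)
    show "adjoint_system a b A B C P Q R e"
      unfolding adjoint_system_def
    proof (intro conjI P Q R)
      show "A * P - P * A - R * C = e \<cdot>\<^sub>m A"
      proof (rule eq_matI)
        fix i j assume "i < dim_row (e \<cdot>\<^sub>m A)" "j < dim_col (e \<cdot>\<^sub>m A)"
        then show "(A * P - P * A - R * C) $$ (i, j) = (e \<cdot>\<^sub>m A) $$ (i, j)"
          using n[of i j] A B C P Q R unfolding Nb
          by (simp add: algebra_simps del: index_mult_mat(1))
      qed (use A P R C in auto)
      show "C * P - Q * C = e \<cdot>\<^sub>m C"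
      proof (rule eq_matI)
        fix i j assume "i < dim_row (e \<cdot>\<^sub>m C)" "j < dim_col (e \<cdot>\<^sub>m C)"
        then show "(C * P - Q * C) $$ (i, j) = (e \<cdot>\<^sub>m C) $$ (i, j)"
          using n[of "i + a" j] A B C P Q R unfolding Nb
          by (simp add: algebra_simps del: index_mult_mat(1))
      qed (use Q C in auto)
      show "C * R + (B * Q - Q * B) = e \<cdot>\<^sub>m B"
      proof (rule eq_matI)
        fix i j assume "i < dim_row (e \<cdot>\<^sub>m B)" "j < dim_col (e \<cdot>\<^sub>m B)"
        then show "(C * R + (B * Q - Q * B)) $$ (i, j) = (e \<cdot>\<^sub>m B) $$ (i, j)"
          using n[of "i + a" "j + a"] A B C P Q R unfolding Nb
          by (simp add: algebra_simps del: index_mult_mat(1))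
      qed (use Q C B R in auto)
    qed
  qed
  also have "\<dots> \<longleftrightarrow> (\<forall>x\<in>parabolic a b. mat_trace (G * commutator h x) = e * mat_trace (G * x))"
    unfolding pos[symmetric]
    by (intro ball_cong refl) (simp flip: tr[OF parabolic_carrier])
  finally show ?thesis .
qed

lemma functional_trace:
  assumes "linear_functional (parabolic a b) g"
  obtains A B C where "A \<in> carrier_mat a a" "B \<in> carrier_mat b b" "C \<in> carrier_mat b a"
    "\<And>x. x \<in> parabolic a b \<Longrightarrow> g x = mat_trace (four_block_mat A (0\<^sub>m a b) C B * x)"
proof -
  let ?n = "a + b" and ?g = "\<lambda>p. g (matrix_unit (a + b) p)"
  let ?A = "mat a a (\<lambda>(i, j). ?g (j, i))" and ?C = "mat b a (\<lambda>(i, j). ?g (j, i + a))"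
    and ?B = "mat b b (\<lambda>(i, j). ?g (j + a, i + a))"
  define G where "G = four_block_mat ?A (0\<^sub>m a b) ?C ?B"
  have Gc: "G \<in> carrier_mat ?n ?n" by (simp add: G_def)
  have G: "G $$ (i, j) = ?g (j, i)" if "(j, i) \<in> positions a b" for i j
    using that by (auto simp: G_def positions_def)
  have G0: "G $$ (i, j) * x $$ (j, i) = 0"
    if "x \<in> parabolic a b" "(j, i) \<notin> positions a b" "i < ?n" "j < ?n" for i j x
    using that by (auto simp: positions_def parabolic_def)
  have "g x = mat_trace (G * x)" if x: "x \<in> parabolic a b" for x
  proof -
    have "mat_trace (G * x) = (\<Sum>i<?n. \<Sum>j<?n. G $$ (i, j) * x $$ (j, i))"
      by (rule mat_trace_mult[OF Gc parabolic_carrier[OF x]])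
    also have "\<dots> = (\<Sum>p\<in>{..<?n} \<times> {..<?n}. G $$ (fst p, snd p) * x $$ (snd p, fst p))"
      by (simp add: sum.cartesian_product case_prod_unfold)
    also have "\<dots> = (\<Sum>p\<in>{..<?n} \<times> {..<?n}. G $$ (snd p, fst p) * x $$ p)"
      by (rule sum.reindex_bij_witness[of _ prod.swap prod.swap]) auto
    also have "\<dots> = (\<Sum>p\<in>positions a b. G $$ (snd p, fst p) * x $$ p)"
      by (rule sum.mono_neutral_right)
        (use G0[OF x] in \<open>auto simp: positions_def simp del: mult_eq_0_iff\<close>)
    also have "\<dots> = (\<Sum>p\<in>positions a b. x $$ p * ?g p)"
      by (rule sum.cong) (auto simp: G)
    finally show ?thesis using linear_functional_expand[OF assms x] by simp
  qed
  then show ?thesis using that[of ?A ?B ?C] by (auto simp: G_def)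
qed

text \<open>The functional is given on \<open>W\<close> only and is extended by 0 on the identity,
  through the traceless part. Commutators ignore scalars, so the principal equation carries over,
  and a radical element of the extension has traceless part 0, that is, it is scalar.\<close>

theorem frobenius_adjoint_system:
  assumes fr: "frobenius_functional (a + b) (W a b) \<phi>" and pr: "principal_element (W a b) \<phi> h"
    and ab: "a + b > 0"
  obtains A B C P Q R where "nondegenerate a b A B C" "adjoint_system a b A B C P Q R 1"
    "h = four_block_mat P R (0\<^sub>m b a) Q"
proof -
  let ?n = "a + b"
  define tl where "tl x = x - (mat_trace x / of_nat ?n) \<cdot>\<^sub>m 1\<^sub>m ?n" for x
  define g where "g x = \<phi> (tl x)" for x
  have W: "x \<in> W a b \<Longrightarrow> x \<in> parabolic a b \<and> x \<in> carrier_mat ?n ?n" for x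
    unfolding W_eq by (simp add: parabolic_def)
  have tlW: "tl x \<in> W a b" if "x \<in> parabolic a b" for x
    unfolding tl_def using traceless_part[OF that ab] by simp
  have tl_id: "tl x = x" if "x \<in> W a b" for x
    using that W[OF that] unfolding W_eq tl_def by (auto intro!: eq_matI)
  have lin: "linear_functional (W a b) \<phi>" using fr by (simp add: frobenius_functional_def)
  have ling: "linear_functional (parabolic a b) g"
    unfolding linear_functional_def
  proof (intro conjI ballI allI)
    fix x y assume xy: "x \<in> parabolic a b" "y \<in> parabolic a b"
    note c = xy[THEN parabolic_carrier]
    have "tl (x + y) = tl x + tl y" using c
      by (auto intro!: eq_matI simp: tl_def mat_trace_simps[of _ ?n] add_divide_distrib algebra_simps simp del: of_nat_add)
    then show "g (x + y) = g x + g y" unfolding g_def using lin tlW[OF xy(1)] tlW[OF xy(2)]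
      by (simp add: linear_functional_def)
  next
    fix c x assume x: "x \<in> parabolic a b"
    note cc = parabolic_carrier[OF x]
    have "tl (c \<cdot>\<^sub>m x) = c \<cdot>\<^sub>m tl x" using cc
      by (auto intro!: eq_matI simp: tl_def mat_trace_simps[of _ ?n] algebra_simps simp del: of_nat_add)
    then show "g (c \<cdot>\<^sub>m x) = c * g x" unfolding g_def using lin tlW[OF x]
      by (simp add: linear_functional_def)
  qed
  obtain A B C where ABC: "A \<in> carrier_mat a a" "B \<in> carrier_mat b b" "C \<in> carrier_mat b a"
    and g: "\<And>x. x \<in> parabolic a b \<Longrightarrow> g x = mat_trace (four_block_mat A (0\<^sub>m a b) C B * x)"
    by (rule functional_trace[OF ling]) blast
  have gW: "g x = \<phi> x" if "x \<in> W a b" for x unfolding g_def tl_id[OF that] ..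
  have cW: "commutator x y \<in> parabolic a b" "g (commutator x y) = \<phi> (commutator x y)"
    if "x \<in> parabolic a b" "y \<in> parabolic a b" for x y
    using commutator_closed[OF that] W gW by blast+
  have h: "h \<in> W a b" "h \<in> parabolic a b" using pr W by (auto simp: principal_element_def)
  obtain P Q R where PQR: "P \<in> carrier_mat a a" "Q \<in> carrier_mat b b" "R \<in> carrier_mat a b"
    "h = four_block_mat P R (0\<^sub>m b a) Q" by (rule parabolic_cases[OF h(2)])
  have "adjoint_system a b A B C P Q R 1"
    unfolding adjoint_system_iff_trace[OF ABC PQR(1-3)] PQR(4)[symmetric]
  proof
    fix x assume x: "x \<in> parabolic a b"
    have "g (commutator h x) = \<phi> (commutator h (tl x))"
      unfolding tl_def using cW(2)[OF h(2) x] commutator_shift(2)[OF x[THEN parabolic_carrier] h(2)[THEN parabolic_carrier]] by simp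
    also have "\<dots> = g x" using pr tlW[OF x] unfolding g_def principal_element_def by blast
    finally show "mat_trace (four_block_mat A (0\<^sub>m a b) C B * commutator h x)
        = 1 * mat_trace (four_block_mat A (0\<^sub>m a b) C B * x)"
      using g[OF x] g[OF cW(1)[OF h(2) x]] by simp
  qed
  moreover have "nondegenerate a b A B C"
    unfolding nondegenerate_def
  proof (intro conjI allI impI ABC)
    fix P Q R assume s: "adjoint_system a b A B C P Q R 0"
    then have c: "P \<in> carrier_mat a a" "Q \<in> carrier_mat b b" "R \<in> carrier_mat a b"
      by (auto simp: adjoint_system_def)
    define k where "k = four_block_mat P R (0\<^sub>m b a) Q"
    have k: "k \<in> parabolic a b" unfolding k_def using parabolic_block c by blast
    note kc = parabolic_carrier[OF k]
    define t where "t = mat_trace k / of_nat ?n"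
    have "\<phi> (commutator (tl k) y) = 0" if y: "y \<in> W a b" for y
    proof -
      have "\<phi> (commutator (tl k) y) = g (commutator k y)"
        unfolding tl_def using cW(2)[OF k] W[OF y] commutator_shift(1)[OF kc] by simp
      also have "\<dots> = 0"
        using s[unfolded adjoint_system_iff_trace[OF ABC c]] g[OF cW(1)[OF k]] W[OF y] by (simp add: k_def)
      finally show ?thesis .
    qed
    then have z: "tl k = 0\<^sub>m ?n ?n" using fr tlW[OF k] unfolding frobenius_functional_def by blast
    have e: "k $$ (i, j) = t * of_bool (i = j)" if "i < ?n" "j < ?n" for i j
      using mat_eqD[OF z, of "(i, j)"] that kc by (auto simp: tl_def t_def)
    have "P = t \<cdot>\<^sub>m 1\<^sub>m a"
    proof (rule eq_matI)
      fix i j assume "i < dim_row (t \<cdot>\<^sub>m 1\<^sub>m a)" "j < dim_col (t \<cdot>\<^sub>m 1\<^sub>m a)"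
      then show "P $$ (i, j) = (t \<cdot>\<^sub>m 1\<^sub>m a) $$ (i, j)" using e[of i j] c by (auto simp: k_def)
    qed (use c in auto)
    moreover have "Q = t \<cdot>\<^sub>m 1\<^sub>m b"
    proof (rule eq_matI)
      fix i j assume "i < dim_row (t \<cdot>\<^sub>m 1\<^sub>m b)" "j < dim_col (t \<cdot>\<^sub>m 1\<^sub>m b)"
      then show "Q $$ (i, j) = (t \<cdot>\<^sub>m 1\<^sub>m b) $$ (i, j)" using e[of "i + a" "j + a"] c by (auto simp: k_def)
    qed (use c in auto)
    ultimately show "\<exists>c. P = c \<cdot>\<^sub>m 1\<^sub>m a \<and> Q = c \<cdot>\<^sub>m 1\<^sub>m b" by blast
    show "R = 0\<^sub>m a b"
    proof (rule eq_matI)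
      fix i j assume "i < dim_row (0\<^sub>m a b :: complex mat)" "j < dim_col (0\<^sub>m a b :: complex mat)"
      then show "R $$ (i, j) = 0\<^sub>m a b $$ (i, j)" using e[of i "j + a"] c by (auto simp: k_def)
    qed (use c in auto)
  qed
  ultimately show ?thesis using that PQR(4) by blast
qed

section \<open>The adjoint spectrum\<close>

lemma has_eigenvalues_proots:
  assumes "has_eigenvalues A E"
  shows "proots (char_poly A) = E"
proof -
  have "proots (\<Prod>x\<in>#E. [:- x, 1:]) = E" for E :: "complex multiset"
  proof (induction E)
    case (add x E)
    have "(\<Prod>x\<in>#E. [:- x, 1:]) \<noteq> 0" by (auto simp: prod_mset_zero_iff)
    then have "proots ([:- x, 1:] * (\<Prod>x\<in>#E. [:- x, 1:])) = {#x#} + E"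
      using add by (subst proots_mult) auto
    then show ?case by (simp del: mult_pCons_left)
  qed simp
  then show ?thesis using assms by (simp add: has_eigenvalues_def)
qed

lemma has_eigenvalues_exists:
  assumes "A \<in> carrier_mat n n"
  obtains E where "has_eigenvalues A E"
proof -
  obtain es where "char_poly A = (\<Prod>e\<leftarrow>es. [:- e, 1:])" using char_poly_factorized[OF assms] by blast
  then have "has_eigenvalues A (mset es)"
    unfolding has_eigenvalues_def by (simp add: prod_mset_prod_list[symmetric] flip: mset_map)
  then show ?thesis by (rule that)
qed

section \<open>Coordinates in spaces of matrices\<close>

lemma mat_lincomb_carrier [simp]: "mat_lincomb n bs c \<in> carrier_mat n n"
  by (simp add: mat_lincomb_def)

lemma mat_lincomb_snoc:
  assumes "x \<in> carrier_mat n n"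
  shows "mat_lincomb n (bs @ [x]) c = mat_lincomb n bs c + c $ length bs \<cdot>\<^sub>m x"
  using assms by (intro eq_matI) (auto simp: mat_lincomb_def nth_append)

lemma mat_lincomb_map:
  assumes "set bs \<subseteq> carrier_mat n n"
    and add: "\<And>x y. x \<in> carrier_mat n n \<Longrightarrow> y \<in> carrier_mat n n \<Longrightarrow> f (x + y) = f x + f y"
    and smult: "\<And>k x. x \<in> carrier_mat n n \<Longrightarrow> f (k \<cdot>\<^sub>m x) = k \<cdot>\<^sub>m f x"
    and car: "\<And>x. x \<in> carrier_mat n n \<Longrightarrow> f x \<in> carrier_mat n n"
  shows "f (mat_lincomb n bs c) = mat_lincomb n (map f bs) c"
  using assms(1)
proof (induction bs rule: rev_induct)
  case Nil
  have z: "0 \<cdot>\<^sub>m x = mat_lincomb n [] c" if "x \<in> carrier_mat n n" for x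
    using that by (intro eq_matI) (auto simp: mat_lincomb_def)
  show ?case using smult[of "0\<^sub>m n n" 0] z[OF zero_carrier_mat] z[OF car[OF zero_carrier_mat]] by simp
next
  case (snoc x bs)
  then show ?case by (simp add: mat_lincomb_snoc add smult car)
qed

lemma mat_lincomb_mult:
  assumes P: "P \<in> carrier_mat (length bs) (length cs)"
    and cs: "\<And>j. j < length cs \<Longrightarrow> cs ! j = mat_lincomb n bs (col P j)"
    and c: "c \<in> carrier_vec (length cs)"
  shows "mat_lincomb n cs c = mat_lincomb n bs (P *\<^sub>v c)"
proof (rule eq_matI)
  fix i j assume "i < dim_row (mat_lincomb n bs (P *\<^sub>v c))" "j < dim_col (mat_lincomb n bs (P *\<^sub>v c))"
  then have ij: "i < n" "j < n" by (auto simp: mat_lincomb_def)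
  have "mat_lincomb n cs c $$ (i, j) = (\<Sum>k<length cs. c $ k * cs ! k $$ (i, j))"
    using ij by (simp add: mat_lincomb_def)
  also have "\<dots> = (\<Sum>k<length cs. \<Sum>l<length bs. c $ k * (P $$ (l, k) * bs ! l $$ (i, j)))"
    using ij P by (intro sum.cong refl) (simp add: cs mat_lincomb_def sum_distrib_left)
  also have "\<dots> = (\<Sum>l<length bs. \<Sum>k<length cs. c $ k * (P $$ (l, k) * bs ! l $$ (i, j)))"
    by (rule sum.swap)
  also have "\<dots> = (\<Sum>l<length bs. (P *\<^sub>v c) $ l * bs ! l $$ (i, j))"
    using P c by (intro sum.cong refl) (simp add: scalar_prod_def sum_distrib_left atLeast0LessThan mult_ac)
  finally show "mat_lincomb n cs c $$ (i, j) = mat_lincomb n bs (P *\<^sub>v c) $$ (i, j)"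
    using ij by (simp add: mat_lincomb_def)
qed (simp_all add: mat_lincomb_def)

lemma ordered_basis_inject:
  assumes "ordered_basis n L bs" "mat_lincomb n bs c = mat_lincomb n bs d" "mat_lincomb n bs d \<in> L"
    "c \<in> carrier_vec (length bs)" "d \<in> carrier_vec (length bs)"
  shows "c = d"
  using assms unfolding ordered_basis_def by metis

lemma ordered_basis_coordinates:
  assumes "ordered_basis n L bs" "set cs \<subseteq> L"
  obtains P where "P \<in> carrier_mat (length bs) (length cs)"
    "\<And>j. j < length cs \<Longrightarrow> mat_lincomb n bs (col P j) = cs ! j"
proof -
  have "\<exists>c. c \<in> carrier_vec (length bs) \<and> mat_lincomb n bs c = x" if "x \<in> L" for x
    using assms(1) that unfolding ordered_basis_def by blast
  then obtain k where k: "\<And>x. x \<in> L \<Longrightarrow> k x \<in> carrier_vec (length bs)" "\<And>x. x \<in> L \<Longrightarrow> mat_lincomb n bs (k x) = x"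
    by metis
  let ?P = "mat (length bs) (length cs) (\<lambda>(i, j). k (cs ! j) $ i)"
  have "mat_lincomb n bs (col ?P j) = cs ! j" if "j < length cs" for j
  proof -
    have "cs ! j \<in> L" using that assms(2) by auto
    moreover from k(1)[OF this] have "col ?P j = k (cs ! j)" using that by (intro eq_vecI) auto
    ultimately show ?thesis using k(2) by simp
  qed
  then show ?thesis using that[of ?P] by simp
qed

lemma represents_similar:
  assumes L: "L \<subseteq> carrier_mat n n" and bs: "ordered_basis n L bs" and cs: "ordered_basis n L cs"
    and A: "represents n bs f A" and B: "represents n cs f B"
    and f: "\<And>x y. x \<in> carrier_mat n n \<Longrightarrow> y \<in> carrier_mat n n \<Longrightarrow> f (x + y) = f x + f y"
      "\<And>k x. x \<in> carrier_mat n n \<Longrightarrow> f (k \<cdot>\<^sub>m x) = k \<cdot>\<^sub>m f x"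
      "\<And>x. x \<in> carrier_mat n n \<Longrightarrow> f x \<in> carrier_mat n n" "\<And>x. x \<in> L \<Longrightarrow> f x \<in> L"
  shows "similar_mat A B"
proof -
  have bL: "set bs \<subseteq> L" "set cs \<subseteq> L" using bs cs by (auto simp: ordered_basis_def)
  obtain P where P: "P \<in> carrier_mat (length bs) (length cs)"
    "\<And>j. j < length cs \<Longrightarrow> mat_lincomb n bs (col P j) = cs ! j"
    using ordered_basis_coordinates[OF bs bL(2)] by blast
  obtain Q where Q: "Q \<in> carrier_mat (length cs) (length bs)"
    "\<And>j. j < length bs \<Longrightarrow> mat_lincomb n cs (col Q j) = bs ! j"
    using ordered_basis_coordinates[OF cs bL(1)] by blast
  have inv: "P * Q = 1\<^sub>m (length bs)"
    if bs: "ordered_basis n L bs" and bL: "set bs \<subseteq> L"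
      and P: "P \<in> carrier_mat (length bs) (length cs)"
        "\<And>j. j < length cs \<Longrightarrow> mat_lincomb n bs (col P j) = cs ! j"
      and Q: "Q \<in> carrier_mat (length cs) (length bs)"
        "\<And>j. j < length bs \<Longrightarrow> mat_lincomb n cs (col Q j) = bs ! j"
    for P Q bs cs
  proof (rule eq_matI)
    fix i j assume "i < dim_row (1\<^sub>m (length bs) :: complex mat)" "j < dim_col (1\<^sub>m (length bs) :: complex mat)"
    then have ij: "i < length bs" "j < length bs" by auto
    have bj: "bs ! j \<in> L" using bL ij by auto
    have u: "mat_lincomb n bs (unit_vec (length bs) j) = bs ! j"
    proof (rule eq_matI)
      fix k l assume "k < dim_row (bs ! j)" "l < dim_col (bs ! j)"
      moreover have "bs ! j \<in> carrier_mat n n" using bj L by auto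
      moreover have "(\<Sum>m<length bs. unit_vec (length bs) j $ m * bs ! m $$ (k, l))
          = (\<Sum>m<length bs. if m = j then bs ! m $$ (k, l) else 0)"
        using ij by (intro sum.cong refl) auto
      ultimately show "mat_lincomb n bs (unit_vec (length bs) j) $$ (k, l) = bs ! j $$ (k, l)"
        using ij by (simp add: mat_lincomb_def)
    qed (use bj L in \<open>auto simp: mat_lincomb_def\<close>)
    have "mat_lincomb n bs (P *\<^sub>v col Q j) = mat_lincomb n cs (col Q j)"
      by (rule mat_lincomb_mult[symmetric]) (use P Q(1) in \<open>auto intro!: carrier_vecI\<close>)
    then have e: "mat_lincomb n bs (P *\<^sub>v col Q j) = mat_lincomb n bs (unit_vec (length bs) j)"
      using Q(2)[OF ij(2)] u by simp
    have "P *\<^sub>v col Q j \<in> carrier_vec (length bs)"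
      by (rule mult_mat_vec_carrier[OF P(1)]) (use Q(1) in \<open>auto intro!: carrier_vecI\<close>)
    then have "P *\<^sub>v col Q j = unit_vec (length bs) j"
      by (rule ordered_basis_inject[OF bs e, rotated]) (use u bj in auto)
    then have "(P *\<^sub>v col Q j) $ i = unit_vec (length bs) j $ i" by simp
    then show "(P * Q) $$ (i, j) = 1\<^sub>m (length bs) $$ (i, j)" using ij P(1) Q(1) by auto
  qed (use P Q in auto)
  have PQ: "P * Q = 1\<^sub>m (length bs)" by (rule inv[OF bs bL(1) P Q])
  have QP: "Q * P = 1\<^sub>m (length cs)" by (rule inv[OF cs bL(2) Q P])
  \<comment> \<open>Equal traces of \<open>P * Q\<close> and \<open>Q * P\<close> show that the two
    bases have the same length.\<close>
  have "(of_nat (length bs) :: complex) = of_nat (length cs)"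
    using mat_trace_commute[OF P(1) Q(1)] unfolding PQ QP by (simp add: mat_trace_def)
  then have len: "length cs = length bs" by simp
  let ?m = "length bs"
  have Ac: "A \<in> carrier_mat ?m ?m" and Bc: "B \<in> carrier_mat ?m ?m"
    using A B len by (auto simp: represents_def)
  have f_bs: "f (mat_lincomb n bs c) = mat_lincomb n bs (A *\<^sub>v c)" if "c \<in> carrier_vec ?m" for c
  proof -
    have "f (mat_lincomb n bs c) = mat_lincomb n (map f bs) c"
      by (rule mat_lincomb_map) (use bL L f in auto)
    also have "\<dots> = mat_lincomb n bs (A *\<^sub>v c)"
      by (rule mat_lincomb_mult) (use A that in \<open>auto simp: represents_def\<close>)
    finally show ?thesis .
  qed
  have AP: "A * P = P * B"
  proof (rule eq_matI)
    fix i j assume "i < dim_row (P * B)" "j < dim_col (P * B)"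
    then have ij: "i < ?m" "j < ?m" using P Bc by auto
    have Pj: "col P j \<in> carrier_vec ?m" using P by (auto intro!: carrier_vecI)
    have cj: "cs ! j \<in> L" using ij len bL by auto
    have "mat_lincomb n bs (A *\<^sub>v col P j) = f (cs ! j)" using f_bs[OF Pj] P(2)[of j] ij len by simp
    also have "\<dots> = mat_lincomb n cs (col B j)" using B ij len by (simp add: represents_def)
    also have "\<dots> = mat_lincomb n bs (P *\<^sub>v col B j)"
      by (rule mat_lincomb_mult) (use P Bc len in \<open>auto intro!: carrier_vecI\<close>)
    finally have e: "mat_lincomb n bs (A *\<^sub>v col P j) = mat_lincomb n bs (P *\<^sub>v col B j)" .
    have PB: "P *\<^sub>v col B j \<in> carrier_vec ?m"
      by (rule mult_mat_vec_carrier[OF P(1)]) (use Bc len in \<open>auto intro!: carrier_vecI\<close>)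
    have "A *\<^sub>v col P j = P *\<^sub>v col B j"
      by (rule ordered_basis_inject[OF bs e])
        (use PB e f_bs[OF Pj] P(2)[of j] ij len f(4)[OF cj] Ac P(1) in auto)
    then have "(A *\<^sub>v col P j) $ i = (P *\<^sub>v col B j) $ i" by simp
    then show "(A * P) $$ (i, j) = (P * B) $$ (i, j)" using ij P(1) Ac Bc len by auto
  qed (use Ac Bc P len in auto)
  have "P * B * Q = A * P * Q" unfolding AP ..
  also have "\<dots> = A * (P * Q)" using Ac P(1) Q(1) len by (simp add: mat_assoc)
  finally have "P * B * Q = A * (P * Q)" .
  then have "A = P * B * Q" using PQ Ac by simp
  then show ?thesis using PQ QP len Ac Bc P(1) Q(1)
    by (intro similar_matI[of _ _ P Q ?m]) auto
qed

lemma commutator_linear: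
  assumes "h \<in> carrier_mat n n" "x \<in> carrier_mat n n" "y \<in> carrier_mat n n"
  shows "commutator h (x + y) = commutator h x + commutator h y"
    "commutator h (k \<cdot>\<^sub>m x) = k \<cdot>\<^sub>m commutator h x" "commutator h x \<in> carrier_mat n n"
  using assms unfolding commutator_def
  by (auto intro!: eq_matI simp: mat_addl mat_addr mult_smult_distrib[of h n n x n] mult_smult_assoc_mat[of x n n h n]
      algebra_simps simp del: index_mult_mat(1))

lemma mat_lincomb_W:
  assumes bs: "set bs \<subseteq> W a b"
  shows "mat_lincomb (a + b) bs c \<in> W a b"
proof -
  have p: "bs ! k \<in> parabolic a b" "mat_trace (bs ! k) = 0" if "k < length bs" for k
    using bs that nth_mem unfolding W_eq by blast+
  have "mat_trace (mat_lincomb (a + b) bs c) = (\<Sum>k<length bs. c $ k * mat_trace (bs ! k))"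
  proof -
    have "mat_trace (mat_lincomb (a + b) bs c) = (\<Sum>i<a + b. \<Sum>k<length bs. c $ k * bs ! k $$ (i, i))"
      by (simp add: mat_trace_def mat_lincomb_def)
    also have "\<dots> = (\<Sum>k<length bs. \<Sum>i<a + b. c $ k * bs ! k $$ (i, i))" by (rule sum.swap)
    also have "\<dots> = (\<Sum>k<length bs. c $ k * mat_trace (bs ! k))"
      using p(1)[THEN parabolic_carrier, THEN carrier_matD(1)]
      by (intro sum.cong refl) (simp add: mat_trace_def sum_distrib_left)
    finally show ?thesis .
  qed
  then have "mat_trace (mat_lincomb (a + b) bs c) = 0" using p by simp
  moreover have "mat_lincomb (a + b) bs c \<in> parabolic a b"
    using p(1) by (auto simp: parabolic_def mat_lincomb_def intro!: sum.neutral)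
  ultimately show ?thesis by (simp add: W_eq)
qed

text \<open>The identity spans a complement of \<open>W\<close> and is annihilated by ad h. It costs
  one extra eigenvalue 0, the origin of the term \<open>- of_bool (k = 0)\<close> in the
  multiplicities.\<close>

lemma extend_basis:
  assumes bs: "ordered_basis (a + b) (W a b) bs" and A: "represents (a + b) bs (commutator h) A"
    and h: "h \<in> carrier_mat (a + b) (a + b)" and ab: "a + b > 0"
  defines "m \<equiv> length bs"
  shows "ordered_basis (a + b) (parabolic a b) (bs @ [1\<^sub>m (a + b)])"
    and "represents (a + b) (bs @ [1\<^sub>m (a + b)]) (commutator h)
      (four_block_mat A (0\<^sub>m m 1) (0\<^sub>m 1 m) (0\<^sub>m 1 1))"
proof -
  let ?n = "a + b" and ?cs = "bs @ [1\<^sub>m (a + b)]"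
  have bW: "set bs \<subseteq> W a b" using bs by (simp add: ordered_basis_def)
  have Wp: "W a b \<subseteq> parabolic a b" by (auto simp: W_eq)
  have sn: "mat_lincomb ?n ?cs c = mat_lincomb ?n bs (vec m (($) c)) + c $ m \<cdot>\<^sub>m 1\<^sub>m ?n" for c
  proof -
    have "mat_lincomb ?n bs (vec m (($) c)) = mat_lincomb ?n bs c"
      unfolding mat_lincomb_def m_def by (rule arg_cong[of _ _ "mat _ _"]) (auto intro!: ext sum.cong)
    then show ?thesis by (simp add: mat_lincomb_snoc m_def)
  qed
  have Ac: "A \<in> carrier_mat m m" using A by (simp add: represents_def m_def)
  have coord: "c = d" if c: "c \<in> carrier_vec (length ?cs)" "d \<in> carrier_vec (length ?cs)"
    and e: "mat_lincomb ?n ?cs c = mat_lincomb ?n ?cs d" for c d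
  proof -
    let ?c = "vec m (($) c)" and ?d = "vec m (($) d)"
    \<comment> \<open>Elements of \<open>W\<close> are traceless, so the trace reads off the
      coefficient of the identity.\<close>
    have tr: "mat_trace (mat_lincomb ?n ?cs c) = c $ m * of_nat ?n" for c
      unfolding sn using mat_lincomb_W[OF bW, of "vec m (($) c)"] unfolding W_eq
      by (simp add: mat_trace_simps[of _ ?n] mat_trace_simps(3)[of "1\<^sub>m ?n" ?n "1\<^sub>m ?n"]
          mat_trace_simps(4)[of "1\<^sub>m ?n" ?n "1\<^sub>m ?n"] del: of_nat_add)
    have cm: "c $ m = d $ m" using tr[of c] tr[of d] e ab by (auto simp del: of_nat_add)
    have e2: "mat_lincomb ?n bs ?c = mat_lincomb ?n bs ?d"
    proof (rule eq_matI)
      fix i j assume "i < dim_row (mat_lincomb ?n bs ?d)" "j < dim_col (mat_lincomb ?n bs ?d)"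
      then show "mat_lincomb ?n bs ?c $$ (i, j) = mat_lincomb ?n bs ?d $$ (i, j)"
        using mat_eqD[OF e[unfolded sn cm], of "(i, j)"] by (simp add: mat_lincomb_def)
    qed (simp_all add: mat_lincomb_def)
    have "?c = ?d"
      by (rule ordered_basis_inject[OF bs e2 mat_lincomb_W[OF bW]]) (auto simp: m_def)
    then have "c $ k = d $ k" if "k < m" for k using that by (metis index_vec)
    with cm have "c $ k = d $ k" if "k < Suc m" for k using that by (cases "k = m") auto
    then show "c = d" using c by (intro eq_vecI) (auto simp: m_def)
  qed
  show "ordered_basis ?n (parabolic a b) ?cs"
    unfolding ordered_basis_def
  proof (intro conjI ballI ex_ex1I)
    show "set ?cs \<subseteq> parabolic a b" using bW Wp parabolic_one by auto
  next
    fix x assume x: "x \<in> parabolic a b"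
    define t where "t = mat_trace x / of_nat ?n"
    have "x - t \<cdot>\<^sub>m 1\<^sub>m ?n \<in> W a b" unfolding t_def by (rule traceless_part[OF x ab])
    then obtain c where c: "c \<in> carrier_vec m" "mat_lincomb ?n bs c = x - t \<cdot>\<^sub>m 1\<^sub>m ?n"
      using bs unfolding ordered_basis_def m_def by blast
    let ?c = "vec (Suc m) (\<lambda>k. if k < m then c $ k else t)"
    have "vec m (($) ?c) = c" using c by (intro eq_vecI) auto
    then have "mat_lincomb ?n ?cs ?c = x - t \<cdot>\<^sub>m 1\<^sub>m ?n + t \<cdot>\<^sub>m 1\<^sub>m ?n" unfolding sn using c by simp
    also have "\<dots> = x" using parabolic_carrier[OF x] by (intro eq_matI) auto
    finally show "\<exists>c. c \<in> carrier_vec (length ?cs) \<and> mat_lincomb ?n ?cs c = x"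
      by (intro exI[of _ ?c]) (simp add: m_def)
  qed (use coord in blast)
  show "represents ?n ?cs (commutator h) (four_block_mat A (0\<^sub>m m 1) (0\<^sub>m 1 m) (0\<^sub>m 1 1))"
    (is "represents _ _ _ ?A")
    unfolding represents_def
  proof (intro conjI allI impI)
    show "?A \<in> carrier_mat (length ?cs) (length ?cs)" using Ac by (auto simp: m_def)
    fix j assume "j < length ?cs"
    then consider "j < m" | "j = m" by (auto simp: m_def less_Suc_eq)
    then show "commutator h (?cs ! j) = mat_lincomb ?n ?cs (col ?A j)"
    proof cases
      case 1
      have "vec m (($) (col ?A j)) = col A j" using 1 Ac by (intro eq_vecI) auto
      moreover have "col ?A j $ m = 0" using 1 Ac by simp
      ultimately have "mat_lincomb ?n ?cs (col ?A j) = mat_lincomb ?n bs (col A j)"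
        unfolding sn by (intro eq_matI) (auto simp: mat_lincomb_def)
      then show ?thesis using A 1 by (simp add: represents_def nth_append m_def)
    next
      case 2
      have "mat_lincomb ?n ?cs (col ?A j) = 0\<^sub>m ?n ?n"
        unfolding sn using 2 Ac by (intro eq_matI) (auto simp: mat_lincomb_def m_def)
      then show ?thesis using 2 h by (simp add: commutator_def m_def)
    qed
  qed
qed

text \<open>Conjugation is an automorphism that carries ad h to the adjoint of the conjugate, so the
  matrix \<open>A\<close> itself is unchanged.\<close>

lemma conjugate_basis:
  assumes bs: "ordered_basis n L bs" and A: "represents n bs (commutator h) A"
    and ST: "S \<in> carrier_mat n n" "T \<in> carrier_mat n n" "S * T = 1\<^sub>m n" "T * S = 1\<^sub>m n"
    and h: "h \<in> carrier_mat n n" and L: "L \<subseteq> carrier_mat n n"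
    and cl: "\<And>x. x \<in> L \<Longrightarrow> T * x * S \<in> L" "\<And>x. x \<in> L \<Longrightarrow> S * x * T \<in> L"
  shows "ordered_basis n L (map (\<lambda>x. T * x * S) bs)"
    and "represents n (map (\<lambda>x. T * x * S) bs) (commutator (T * h * S)) A"
proof -
  let ?g = "\<lambda>x. T * x * S"
  have bL: "set bs \<subseteq> L" using bs by (simp add: ordered_basis_def)
  have lc: "mat_lincomb n (map ?g bs) c = ?g (mat_lincomb n bs c)" for c
    by (rule mat_lincomb_map[symmetric])
      (use bL L ST in \<open>auto simp: mat_addl mat_addr mult_smult_distrib[of T n n _ n] mult_smult_assoc_mat[of _ n n S n]\<close>)
  have inv: "S * (T * x * S) * T = x" "T * (S * x * T) * S = x" if "x \<in> carrier_mat n n" for x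
  proof -
    have "S * (T * x * S) * T = (S * T) * x * (S * T)" using that ST(1,2) by (simp add: mat_assoc)
    then show "S * (T * x * S) * T = x" using that ST by simp
    have "T * (S * x * T) * S = (T * S) * x * (T * S)" using that ST(1,2) by (simp add: mat_assoc)
    then show "T * (S * x * T) * S = x" using that ST by simp
  qed
  show "ordered_basis n L (map ?g bs)"
    unfolding ordered_basis_def
  proof (intro conjI ballI)
    show "set (map ?g bs) \<subseteq> L" using bL cl by auto
    fix x assume x: "x \<in> L"
    have "mat_lincomb n (map ?g bs) c = x \<longleftrightarrow> mat_lincomb n bs c = S * x * T" for c
      unfolding lc using inv[of x] inv[of "mat_lincomb n bs c"] x L by auto
    moreover have "\<exists>!c. c \<in> carrier_vec (length bs) \<and> mat_lincomb n bs c = S * x * T"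
      using bs cl(2)[OF x] unfolding ordered_basis_def by blast
    ultimately show "\<exists>!c. c \<in> carrier_vec (length (map ?g bs)) \<and> mat_lincomb n (map ?g bs) c = x" by simp
  qed
  show "represents n (map ?g bs) (commutator (T * h * S)) A"
    unfolding represents_def
  proof (intro conjI allI impI)
    show "A \<in> carrier_mat (length (map ?g bs)) (length (map ?g bs))" using A by (simp add: represents_def)
    fix j assume j: "j < length (map ?g bs)"
    then have "bs ! j \<in> set bs" by simp
    then have x: "bs ! j \<in> carrier_mat n n" using bL L by blast
    have prod: "?g u * ?g v = ?g (u * v)" if "u \<in> carrier_mat n n" "v \<in> carrier_mat n n" for u v
    proof -
      have "?g u * ?g v = T * u * (S * T) * v * S" using that ST(1,2) by (simp add: mat_assoc)
      then show ?thesis using that ST by (simp add: mat_assoc)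
    qed
    have "commutator (?g h) (?g (bs ! j)) = ?g (commutator h (bs ! j))"
      unfolding commutator_def prod[OF h x] prod[OF x h] using h x ST by (simp add: mat_subl mat_subr)
    then show "commutator (?g h) (map ?g bs ! j) = mat_lincomb n (map ?g bs) (col A j)"
      unfolding lc using A j by (simp add: represents_def)
  qed
qed

section \<open>Triangular form of the adjoint action\<close>

text \<open>Rows ascend, and columns descend within a row. For upper triangular h the bracket of h
  with the unit at (i, j) involves only units at (k, j) with k <= i and at (i, l) with l >= j. None
  of these comes later in this order, so ad h becomes upper triangular.\<close>

definition position_list :: "nat \<Rightarrow> nat \<Rightarrow> (nat \<times> nat) list" where
  "position_list a b = filter (\<lambda>p. p \<in> positions a b)
     (map (\<lambda>k. (k div (a + b), a + b - 1 - k mod (a + b))) [0..<(a + b) * (a + b)])"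

lemma position_list:
  "set (position_list a b) = positions a b" "distinct (position_list a b)"
  "sorted_wrt (\<lambda>p q. fst p < fst q \<or> fst p = fst q \<and> snd q < snd p) (position_list a b)"
proof -
  let ?n = "a + b"
  show sorted: "sorted_wrt (\<lambda>p q. fst p < fst q \<or> fst p = fst q \<and> snd q < snd p) (position_list a b)"
    unfolding position_list_def
  proof (rule sorted_wrt_filter, unfold sorted_wrt_map, rule sorted_wrt_mono_rel[OF _ sorted_wrt_upt])
    fix x y assume "x \<in> set [0..<?n * ?n]" "y \<in> set [0..<?n * ?n]" "x < y"
    then have n: "?n > 0" "x < y" by (cases ?n; simp)+
    have "x div ?n \<le> y div ?n" using n by (simp add: div_le_mono)
    moreover have "x mod ?n < y mod ?n" if "x div ?n = y div ?n"
      using n(2) that by (metis div_mult_mod_eq nat_add_left_cancel_less)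
    moreover have "y mod ?n < ?n" using n by simp
    ultimately show "fst (x div ?n, ?n - 1 - x mod ?n) < fst (y div ?n, ?n - 1 - y mod ?n) \<or>
        fst (x div ?n, ?n - 1 - x mod ?n) = fst (y div ?n, ?n - 1 - y mod ?n) \<and>
        snd (y div ?n, ?n - 1 - y mod ?n) < snd (x div ?n, ?n - 1 - x mod ?n)"
      by (auto simp del: mod_less_divisor)
  qed
  show "distinct (position_list a b)"
    unfolding distinct_conv_nth
  proof (intro allI impI)
    fix i j assume "i < length (position_list a b)" "j < length (position_list a b)" "i \<noteq> j"
    then show "position_list a b ! i \<noteq> position_list a b ! j"
      using sorted_wrt_nth_less[OF sorted, of i j] sorted_wrt_nth_less[OF sorted, of j i]
      by (cases "i < j") auto
  qed
  have dm: "(i * N + r) div N = i \<and> (i * N + r) mod N = r" if "r < N" for i N r :: nat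
    using that by simp
  have "(i, j) \<in> (\<lambda>k. (k div ?n, ?n - 1 - k mod ?n)) ` {0..<?n * ?n}" if "i < ?n" "j < ?n" for i j
  proof (rule image_eqI[of _ _ "i * ?n + (?n - 1 - j)"])
    have l: "?n - 1 - j < ?n" using that by simp
    have "i * ?n + (?n - 1 - j) < Suc i * ?n" using l by simp
    also have "\<dots> \<le> ?n * ?n" using that by (intro mult_le_mono1) simp
    finally show "i * ?n + (?n - 1 - j) \<in> {0..<?n * ?n}" by simp
    have "(i * ?n + (?n - 1 - j)) div ?n = i" "(i * ?n + (?n - 1 - j)) mod ?n = ?n - 1 - j"
      using dm[OF l] by auto
    then show "(i, j) = ((i * ?n + (?n - 1 - j)) div ?n, ?n - 1 - (i * ?n + (?n - 1 - j)) mod ?n)"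
      using that by simp
  qed
  then show "set (position_list a b) = positions a b"
    unfolding position_list_def by (auto simp: positions_def)
qed

lemma matrix_unit_basis:
  assumes h: "h \<in> parabolic a b" "upper_triangular h"
  obtains bs U where "ordered_basis (a + b) (parabolic a b) bs" "represents (a + b) bs (commutator h) U"
    "has_eigenvalues U (image_mset (\<lambda>(i, j). h $$ (i, i) - h $$ (j, j)) (mset_set (positions a b)))"
proof -
  define n where "n = a + b"
  define ps where "ps = position_list a b"
  note ps = position_list[of a b, folded ps_def]
  define bs where "bs = map (matrix_unit n) ps"
  have len: "length bs = length ps" by (simp add: bs_def)
  have lt: "fst p < n" "snd p < n" if "p \<in> positions a b" for p
    using that by (cases p, simp add: positions_def n_def)+
  have pk: "ps ! k \<in> positions a b" if "k < length ps" for k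
    using nth_mem[OF that] unfolding ps(1) .
  have hc: "h \<in> carrier_mat n n" using h by (simp add: parabolic_def n_def)
  have lc: "mat_lincomb n bs c $$ p = (\<Sum>k<length ps. if ps ! k = p then c $ k else 0)" if "fst p < n" "snd p < n" for c p
  proof -
    obtain i j where p: "p = (i, j)" by (cases p)
    then have "mat_lincomb n bs c $$ p = (\<Sum>k<length ps. c $ k * matrix_unit n (ps ! k) $$ (i, j))"
      using that by (simp add: mat_lincomb_def bs_def)
    also have "\<dots> = (\<Sum>k<length ps. if ps ! k = p then c $ k else 0)"
      by (intro sum.cong refl) (use that p in \<open>auto simp: matrix_unit_def\<close>)
    finally show ?thesis .
  qed
  have lck: "mat_lincomb n bs c $$ (ps ! k) = c $ k" if "k < length ps" for c k
  proof -
    have "mat_lincomb n bs c $$ (ps ! k) = (\<Sum>l<length ps. if ps ! l = ps ! k then c $ l else 0)"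
      using lc lt[OF pk[OF that]] by blast
    also have "\<dots> = (\<Sum>l<length ps. if l = k then c $ l else 0)"
      using that by (intro sum.cong refl) (auto simp: nth_eq_iff_index_eq[OF ps(2)])
    finally show ?thesis using that by simp
  qed
  define coords where "coords x = vec (length ps) (\<lambda>k. x $$ (ps ! k))" for x :: "complex mat"
  have ex: "mat_lincomb n bs (coords x) = x" if x: "x \<in> parabolic a b" for x
  proof (rule eq_matI)
    have xc: "x \<in> carrier_mat n n" using parabolic_carrier[OF x] by (simp add: n_def)
    then show "dim_row (mat_lincomb n bs (coords x)) = dim_row x" "dim_col (mat_lincomb n bs (coords x)) = dim_col x"
      by (auto simp: mat_lincomb_def)
    fix i j assume "i < dim_row x" "j < dim_col x"
    then have ij: "i < n" "j < n" using xc by auto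
    show "mat_lincomb n bs (coords x) $$ (i, j) = x $$ (i, j)"
    proof (cases "(i, j) \<in> positions a b")
      case True
      then obtain k where k: "k < length ps" "ps ! k = (i, j)" using ps(1) by (metis in_set_conv_nth)
      then show ?thesis using lck[OF k(1), of "coords x"] by (simp add: coords_def)
    next
      case False
      then have "x $$ (i, j) = 0" using x ij by (auto simp: parabolic_def positions_def n_def)
      moreover have "ps ! k \<noteq> (i, j)" if "k < length ps" for k using pk[OF that] False by metis
      ultimately show ?thesis using lc[of "(i, j)" "coords x"] ij by simp
    qed
  qed
  have ob: "ordered_basis n (parabolic a b) bs"
    unfolding ordered_basis_def
  proof (intro conjI ballI ex_ex1I)
    show "set bs \<subseteq> parabolic a b" using ps(1) matrix_unit_parabolic by (auto simp: bs_def n_def)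
    fix x assume "x \<in> parabolic a b"
    then show "\<exists>c. c \<in> carrier_vec (length bs) \<and> mat_lincomb n bs c = x"
      using ex len by (intro exI[of _ "coords x"]) (simp add: coords_def)
  next
    fix x c d
    assume "c \<in> carrier_vec (length bs) \<and> mat_lincomb n bs c = x" "d \<in> carrier_vec (length bs) \<and> mat_lincomb n bs d = x"
    then show "c = d" using len lck by (intro eq_vecI) (auto, metis)
  qed
  define U where "U = mat (length ps) (length ps) (\<lambda>(r, s). commutator h (bs ! s) $$ (ps ! r))"
  have Uc: "U \<in> carrier_mat (length ps) (length ps)" by (simp add: U_def)
  have rep: "represents n bs (commutator h) U"
    unfolding represents_def
  proof (intro conjI allI impI)
    show "U \<in> carrier_mat (length bs) (length bs)" by (simp add: U_def len)
    fix s assume s: "s < length bs"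
    have "bs ! s \<in> parabolic a b" using s ob by (auto simp: ordered_basis_def)
    then have "commutator h (bs ! s) \<in> parabolic a b" using commutator_closed[OF h(1)] by (auto simp: W_eq)
    moreover have "col U s = coords (commutator h (bs ! s))"
      using s len by (intro eq_vecI) (auto simp: U_def coords_def)
    ultimately show "commutator h (bs ! s) = mat_lincomb n bs (col U s)" using ex by simp
  qed
  have entry: "commutator h (matrix_unit n (i, j)) $$ (k, l)
      = of_bool (l = j) * h $$ (k, i) - of_bool (k = i) * h $$ (j, l)"
    if "i < n" "j < n" "k < n" "l < n" for i j k l
  proof -
    have "(\<Sum>m<n. h $$ (k, m) * matrix_unit n (i, j) $$ (m, l)) = (\<Sum>m<n. if m = i then of_bool (l = j) * h $$ (k, i) else 0)"
      using that by (intro sum.cong refl) (auto simp: matrix_unit_def)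
    moreover have "(\<Sum>m<n. matrix_unit n (i, j) $$ (k, m) * h $$ (m, l)) = (\<Sum>m<n. if m = j then of_bool (k = i) * h $$ (j, l) else 0)"
      using that by (intro sum.cong refl) (auto simp: matrix_unit_def)
    moreover have "matrix_unit n (i, j) \<in> carrier_mat n n" by (simp add: matrix_unit_def)
    ultimately show ?thesis using that hc
      by (simp add: commutator_def scalar_prod_def atLeast0LessThan)
  qed
  have Urs: "U $$ (r, s) = of_bool (snd (ps ! r) = snd (ps ! s)) * h $$ (fst (ps ! r), fst (ps ! s))
      - of_bool (fst (ps ! r) = fst (ps ! s)) * h $$ (snd (ps ! s), snd (ps ! r))"
    if "r < length ps" "s < length ps" for r s
    using entry[OF lt[OF pk[OF that(2)]] lt[OF pk[OF that(1)]]] that by (simp add: U_def bs_def)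
  have up: "h $$ (i, j) = 0" if "j < i" "i < n" for i j
    using h(2) hc that by (auto simp: upper_triangular_def)
  have "upper_triangular U"
    unfolding upper_triangular_def
  proof (intro allI impI)
    fix r s assume r: "r < dim_row U" "s < r"
    then have rs: "r < length ps" "s < length ps" "s < r" by (auto simp: U_def)
    have "fst (ps ! s) < fst (ps ! r) \<or> fst (ps ! s) = fst (ps ! r) \<and> snd (ps ! r) < snd (ps ! s)"
      using sorted_wrt_nth_less[OF ps(3) rs(3,1)] by simp
    then consider "fst (ps ! s) < fst (ps ! r)" | "fst (ps ! s) = fst (ps ! r)" "snd (ps ! r) < snd (ps ! s)"
      by blast
    then show "U $$ (r, s) = 0"
    proof cases
      case 1
      then show ?thesis unfolding Urs[OF rs(1,2)] up[OF 1 lt(1)[OF pk[OF rs(1)]]] by simp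
    next
      case 2
      then show ?thesis unfolding Urs[OF rs(1,2)] up[OF 2(2) lt(2)[OF pk[OF rs(2)]]] by simp
    qed
  qed
  from upper_triangular_eigenvalues[OF Uc this]
  have "has_eigenvalues U (mset (diag_mat U))" .
  moreover have "diag_mat U = map (\<lambda>(i, j). h $$ (i, i) - h $$ (j, j)) ps"
    by (rule nth_equalityI) (auto simp: diag_mat_def U_def[THEN arg_cong[of _ _ dim_row]] Urs case_prod_unfold)
  moreover have "mset ps = mset_set (positions a b)" using ps(1,2) mset_set_set by metis
  ultimately have "has_eigenvalues U (image_mset (\<lambda>(i, j). h $$ (i, i) - h $$ (j, j)) (mset_set (positions a b)))"
    by simp
  with ob rep show ?thesis using that unfolding n_def by blast
qed

section \<open>Multiplicities as counts of differences\<close>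

definition diff_count :: "'a :: ab_group_add multiset \<Rightarrow> 'a multiset \<Rightarrow> 'a \<Rightarrow> nat" where
  "diff_count E F z = (\<Sum>x\<in>#E. \<Sum>y\<in>#F. of_bool (x - y = z))"

lemma count_image_mset_sum: "count (image_mset f M) z = (\<Sum>x\<in>#M. of_bool (f x = z))"
  by (induction M) auto

lemma sum_diag_mat:
  assumes "B \<in> carrier_mat n n"
  shows "(\<Sum>x\<in>#mset (diag_mat B). g x) = (\<Sum>i<n. g (B $$ (i, i)))"
proof -
  have "(\<Sum>x\<in>#mset (diag_mat B). g x) = sum_list (map g (diag_mat B))"
    by (simp add: sum_mset_sum_list[symmetric] flip: mset_map)
  also have "\<dots> = (\<Sum>i<n. g (B $$ (i, i)))"
    using assms by (simp add: diag_mat_def comp_def interv_sum_list_conv_sum_set_nat atLeast0LessThan)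
  finally show ?thesis .
qed

text \<open>The diagonal blocks are triangularised separately, so the block diagonal conjugation
  \<open>S\<close> stays in the algebra. The diagonal of the adjoint action then lists
  \<open>k $$ (i, i) - k $$ (j, j)\<close> over all positions, split into the three nonzero
  blocks.\<close>

theorem adjoint_spectrum:
  assumes bs: "ordered_basis (a + b) (W a b) bs" and A: "represents (a + b) bs (commutator h) A"
    and PQR: "P \<in> carrier_mat a a" "Q \<in> carrier_mat b b" "R \<in> carrier_mat a b"
      "h = four_block_mat P R (0\<^sub>m b a) Q"
    and E: "has_eigenvalues P E" and F: "has_eigenvalues Q F" and ab: "a + b > 0"
  shows "count (proots (char_poly A) + {#0#}) z = diff_count E E z + diff_count F F z + diff_count E F z"
proof -
  define n where "n = a + b"
  have hp: "h \<in> parabolic a b" unfolding PQR(4) using PQR parabolic_block by blast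
  note hc = parabolic_carrier[OF hp]
  obtain B1 S1 T1 where B1: "similar_mat_wit P B1 S1 T1" "upper_triangular B1" "mset (diag_mat B1) = E"
    by (rule triangular_form[OF PQR(1) E])
  obtain B2 S2 T2 where B2: "similar_mat_wit Q B2 S2 T2" "upper_triangular B2" "mset (diag_mat B2) = F"
    by (rule triangular_form[OF PQR(2) F])
  have w1: "S1 * T1 = 1\<^sub>m a" "T1 * S1 = 1\<^sub>m a" "P = S1 * B1 * T1" "B1 \<in> carrier_mat a a" "S1 \<in> carrier_mat a a" "T1 \<in> carrier_mat a a"
    using similar_mat_witD2[OF PQR(1) B1(1)] by auto
  have w2: "S2 * T2 = 1\<^sub>m b" "T2 * S2 = 1\<^sub>m b" "Q = S2 * B2 * T2" "B2 \<in> carrier_mat b b" "S2 \<in> carrier_mat b b" "T2 \<in> carrier_mat b b"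
    using similar_mat_witD2[OF PQR(2) B2(1)] by auto
  define S where "S = four_block_mat S1 (0\<^sub>m a b) (0\<^sub>m b a) S2"
  define T where "T = four_block_mat T1 (0\<^sub>m a b) (0\<^sub>m b a) T2"
  define k where "k = four_block_mat B1 (T1 * R * S2) (0\<^sub>m b a) B2"
  have Sp: "S \<in> parabolic a b" and Tp: "T \<in> parabolic a b" and kp: "k \<in> parabolic a b"
    unfolding S_def T_def k_def using w1 w2 PQR by (auto intro!: parabolic_block)
  have ST: "S * T = 1\<^sub>m n" "T * S = 1\<^sub>m n"
    unfolding S_def T_def n_def using w1 w2
    by (simp_all add: mult_four_block_mat[of _ a a _ b _ b _ _ a _ b] four_block_one_mat)
  have TPS: "T1 * P * S1 = B1"
  proof -
    have "T1 * P * S1 = (T1 * S1) * B1 * (T1 * S1)" unfolding w1(3) using w1(4-6) by (simp add: mat_assoc)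
    then show ?thesis using w1 by simp
  qed
  have TQS: "T2 * Q * S2 = B2"
  proof -
    have "T2 * Q * S2 = (T2 * S2) * B2 * (T2 * S2)" unfolding w2(3) using w2(4-6) by (simp add: mat_assoc)
    then show ?thesis using w2 by simp
  qed
  have Th: "T * h = four_block_mat (T1 * P) (T1 * R) (0\<^sub>m b a) (T2 * Q)"
    unfolding T_def PQR(4) using w1(6) w2(6) PQR(1-3)
    by (simp add: mult_four_block_mat[of _ a a _ b _ b _ _ a _ b])
  have ThS: "T * h * S = k"
    unfolding Th S_def k_def TPS[symmetric] TQS[symmetric] using w1(5,6) w2(5,6) PQR(1-3)
    by (simp add: mult_four_block_mat[of _ a a _ b _ b _ _ a _ b])
  have kut: "upper_triangular k"
    using B1(2) B2(2) w1(4) w2(4) by (auto simp: upper_triangular_def k_def)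
  let ?cs = "bs @ [1\<^sub>m (a + b)]"
  define m where "m = length bs"
  let ?A = "four_block_mat A (0\<^sub>m m 1) (0\<^sub>m 1 m) (0\<^sub>m 1 1)"
  have ext1: "ordered_basis (a + b) (parabolic a b) ?cs" by (rule extend_basis(1)[OF bs A hc ab])
  have ext2: "represents (a + b) ?cs (commutator h) ?A"
    unfolding m_def by (rule extend_basis(2)[OF bs A hc ab])
  have cl: "T * x * S \<in> parabolic a b" "S * x * T \<in> parabolic a b" if "x \<in> parabolic a b" for x
    by (rule parabolic_closed(4)[OF parabolic_closed(4)[OF Tp that] Sp])
      (rule parabolic_closed(4)[OF parabolic_closed(4)[OF Sp that] Tp])
  have car: "parabolic a b \<subseteq> carrier_mat (a + b) (a + b)" using parabolic_carrier by blast
  note Sc = parabolic_carrier[OF Sp] and Tc = parabolic_carrier[OF Tp] and kc = parabolic_carrier[OF kp]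
  have conj1: "ordered_basis (a + b) (parabolic a b) (map (\<lambda>x. T * x * S) ?cs)"
    by (rule conjugate_basis(1)[OF ext1 ext2 Sc Tc ST[unfolded n_def] hc car]) (rule cl; assumption)+
  have conj2: "represents (a + b) (map (\<lambda>x. T * x * S) ?cs) (commutator k) ?A"
    unfolding ThS[symmetric]
    by (rule conjugate_basis(2)[OF ext1 ext2 Sc Tc ST[unfolded n_def] hc car]) (rule cl; assumption)+
  obtain us U where U: "ordered_basis (a + b) (parabolic a b) us" "represents (a + b) us (commutator k) U"
    "has_eigenvalues U (image_mset (\<lambda>(i, j). k $$ (i, i) - k $$ (j, j)) (mset_set (positions a b)))"
    by (rule matrix_unit_basis[OF kp kut])
  have kcl: "commutator k x \<in> parabolic a b" if "x \<in> parabolic a b" for x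
    using commutator_closed[OF kp that] by (simp add: W_eq)
  have "similar_mat ?A U"
    by (rule represents_similar[OF car conj1 U(1) conj2 U(2) commutator_linear(1)[OF kc]
          commutator_linear(2)[OF kc] commutator_linear(3)[OF kc] kcl]; assumption)
  then have eA: "has_eigenvalues ?A (image_mset (\<lambda>(i, j). k $$ (i, i) - k $$ (j, j)) (mset_set (positions a b)))"
    using U(3) has_eigenvalues_similar by blast
  have Ac: "A \<in> carrier_mat m m" using A by (simp add: represents_def m_def)
  obtain M where M: "has_eigenvalues A M" by (rule has_eigenvalues_exists[OF Ac])
  have "has_eigenvalues (0\<^sub>m 1 1) {#0#}" using has_eigenvalues_one[of "0\<^sub>m 1 1"] by simp
  from has_eigenvalues_block[OF Ac _ _ M this, of "0\<^sub>m m 1"] have "has_eigenvalues ?A (M + {#0#})" by simp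
  then have D: "proots (char_poly A) + {#0#} = image_mset (\<lambda>(i, j). k $$ (i, i) - k $$ (j, j)) (mset_set (positions a b))"
    using has_eigenvalues_proots[OF eA] has_eigenvalues_proots[of ?A] has_eigenvalues_proots[OF M] by simp
  let ?g = "\<lambda>i j. of_bool (k $$ (i, i) - k $$ (j, j) = z) :: nat"
  have "count (proots (char_poly A) + {#0#}) z = (\<Sum>p\<in>positions a b. ?g (fst p) (snd p))"
    unfolding D count_image_mset_sum by (simp add: sum_unfold_sum_mset case_prod_unfold)
  also have "\<dots> = (\<Sum>p\<in>{..<n} \<times> {..<n}. if p \<in> positions a b then ?g (fst p) (snd p) else 0)"
    by (rule sum.mono_neutral_cong_left) (auto simp: positions_def n_def)
  also have "\<dots> = (\<Sum>i<n. \<Sum>j<n. if (i, j) \<in> positions a b then ?g i j else 0)"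
    by (simp add: sum.cartesian_product case_prod_unfold)
  also have "\<dots> = (\<Sum>i<a. \<Sum>j<a. ?g i j) + (\<Sum>i<a. \<Sum>j<b. ?g i (j + a)) + (\<Sum>i<b. \<Sum>j<b. ?g (i + a) (j + a))"
    unfolding n_def sum_split_nat sum.distrib by (simp add: positions_def)
  also have "(\<Sum>i<a. \<Sum>j<a. ?g i j) = diff_count E E z"
    unfolding diff_count_def B1(3)[symmetric] sum_diag_mat[OF w1(4)] using w1(4) w2(4)
    by (intro sum.cong refl) (simp add: k_def)
  also have "(\<Sum>i<a. \<Sum>j<b. ?g i (j + a)) = diff_count E F z"
    unfolding diff_count_def B1(3)[symmetric] B2(3)[symmetric] sum_diag_mat[OF w1(4)] sum_diag_mat[OF w2(4)]
    using w1(4) w2(4) by (intro sum.cong refl) (simp add: k_def)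
  also have "(\<Sum>i<b. \<Sum>j<b. ?g (i + a) (j + a)) = diff_count F F z"
    unfolding diff_count_def B2(3)[symmetric] sum_diag_mat[OF w2(4)] using w1(4) w2(4)
    by (intro sum.cong refl) (simp add: k_def)
  finally show ?thesis by (simp add: add_ac)
qed

lemma diff_count_add:
  "diff_count (A + B) C k = diff_count A C k + diff_count B C k"
  "diff_count C (A + B) k = diff_count C A k + diff_count C B k"
  by (simp_all add: diff_count_def sum_mset.distrib)

lemma diff_count_uminus: "diff_count A B (- k) = diff_count B A k"
proof -
  have "diff_count A B (- k) = (\<Sum>y\<in>#B. \<Sum>x\<in>#A. of_bool (x - y = - k))"
    unfolding diff_count_def by (rule sum_mset.swap)
  also have "\<dots> = diff_count B A k"
    unfolding diff_count_def
    by (intro arg_cong[of _ _ sum_mset] image_mset_cong) (auto simp: algebra_simps)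
  finally show ?thesis .
qed

lemma diff_count_image:
  assumes "\<And>x y. x \<in># A \<Longrightarrow> y \<in># B \<Longrightarrow> f x - g y = k \<longleftrightarrow> x - y = l"
  shows "diff_count (image_mset f A) (image_mset g B) k = diff_count A B l"
  unfolding diff_count_def image_mset.compositionality comp_def
  by (intro arg_cong[of _ _ sum_mset] image_mset_cong) (use assms in simp)

lemma heights_state:
  "heights a b E F \<Longrightarrow>
    state a b (\<lambda>k. int (diff_count E E k)) (\<lambda>k. int (diff_count F F k)) (\<lambda>k. int (diff_count E F k))"
proof (induction rule: heights.induct)
  case unit
  have "(\<lambda>k. int (diff_count {#1::int#} {#1#} k)) = (\<lambda>k. of_bool (k = 0))"
    "(\<lambda>k. int (diff_count {#0::int#} {#0#} k)) = (\<lambda>k. of_bool (k = 0))"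
    "(\<lambda>k. int (diff_count {#1::int#} {#0#} k)) = (\<lambda>k. of_bool (k = 1))"
    by (auto simp: diff_count_def)
  then show ?case using state.unit by (simp only:)
next
  case (left a b E F)
  have "diff_count (image_mset (\<lambda>x. x + 1) E) (image_mset (\<lambda>x. x + 1) E) k = diff_count E E k" for k
    by (rule diff_count_image) simp
  moreover have "diff_count (image_mset (\<lambda>x. x + 1) E) G k = diff_count E G (k - 1)" for G k
    using diff_count_image[of E G "\<lambda>x. x + 1" "\<lambda>x. x" k "k - 1"] by (simp add: algebra_simps)
  moreover have "diff_count F E k = diff_count E F (- k)" for k by (rule diff_count_uminus[symmetric])
  ultimately show ?case using state.left[OF left.IH] by (simp add: diff_count_add add_ac)
next
  case (right a b E F)
  have "diff_count (image_mset (\<lambda>x. x - 1) F) (image_mset (\<lambda>x. x - 1) F) k = diff_count F F k" for k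
    by (rule diff_count_image) simp
  moreover have "diff_count G (image_mset (\<lambda>x. x - 1) F) k = diff_count G F (k - 1)" for G k
    using diff_count_image[of G F "\<lambda>x. x" "\<lambda>x. x - 1" k "k - 1"] by (simp add: algebra_simps)
  moreover have "diff_count F E k = diff_count E F (- k)" for k by (rule diff_count_uminus[symmetric])
  ultimately show ?case using state.right[OF right.IH] by (simp add: diff_count_add add_ac)
qed

section \<open>From the jumps to the multiplicities\<close>

text \<open>For k >= 1 the multiplicity is a tail sum of d, and tail sums of a log-concave sequence
  are strictly log-concave up to the end of the support. The reflection
  \<open>c (1 - k) = c k\<close> carries this to k <= 0.\<close>

lemma multiplicities_log_concave:
  assumes st: "state a b P Q U" and lc: "lc_profile (\<lambda>k. U k - U (- k))"
  defines "c \<equiv> \<lambda>k. P k + Q k + U k - of_bool (k = 0)"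
  obtains K where "1 \<le> K" "\<And>k. 1 - K \<le> k \<Longrightarrow> k \<le> K \<Longrightarrow> 0 < c k" "\<And>k. k < 1 - K \<or> K < k \<Longrightarrow> c k = 0"
    "\<And>k. 1 - K < k \<Longrightarrow> k < K \<Longrightarrow> c (k - 1) * c (k + 1) < (c k)\<^sup>2"
proof -
  define d where "d k = U k - U (- k)" for k
  have d0: "d 0 = 0" by (simp add: d_def)
  have step: "c (k + 1) = c k - d k" for k
    using state_dim_step[OF st, of k] unfolding c_def d_def by simp
  have refl: "c (1 - k) = c k" for k
  proof -
    have "c (1 - (k + 1)) - c (k + 1) = c (1 - k) - c k" for k
      using step[of k] step[of "- k"] by (simp add: d_def)
    from int_fun_const[of "\<lambda>k. c (1 - k) - c k", OF this, of k] show ?thesis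
      using step[of 0] d0 by simp
  qed
  obtain K where K: "1 \<le> K" "\<And>k. 1 \<le> k \<Longrightarrow> k \<le> K \<Longrightarrow> 0 < d k" "\<And>k. K < k \<Longrightarrow> d k = 0"
    and dlc: "\<And>k. 2 \<le> k \<Longrightarrow> d (k - 1) * d (k + 1) \<le> (d k)\<^sup>2"
    using lc unfolding lc_profile_def d_def by blast
  obtain n where n: "\<And>k. n < \<bar>k\<bar> \<Longrightarrow> P k = 0 \<and> Q k = 0 \<and> U k = 0" using state_finite[OF st] by blast
  have zero: "c k = 0" if "K < k" for k
  proof -
    have "c (k + int j) = c k" for j
    proof (induction j)
      case (Suc j)
      have "d (k + int j) = 0" by (rule K(3)) (use that in simp)
      then show ?case using step[of "k + int j"] Suc by (simp add: algebra_simps)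
    qed simp
    from this[of "nat (\<bar>n\<bar> + 1)"] have "c k = c (k + \<bar>n\<bar> + 1)" by (simp add: add.assoc)
    also have "\<dots> = 0" using n[of "k + \<bar>n\<bar> + 1"] that K(1) by (simp add: c_def)
    finally show ?thesis .
  qed
  have pos': "0 < c (K - int j)" if "int j < K" for j
    using that
  proof (induction j)
    case 0
    then show ?case using step[of K] zero[of "K + 1"] K(2)[of K] K(1) by simp
  next
    case (Suc j)
    have "K - int (Suc j) + 1 = K - int j" by simp
    then show ?case using step[of "K - int (Suc j)"] Suc K(2)[of "K - int (Suc j)"] by simp
  qed
  have pos1: "0 < c k" if "1 \<le> k" "k \<le> K" for k
    using pos'[of "nat (K - k)"] that by simp
  \<comment> \<open>Put k = K - j. Expanding \<open>c (k - 1) = c k + d (k - 1)\<close> and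
    \<open>c k = c (k + 1) + d k\<close> shows that this is strict log-concavity at k. The downward
    induction starts strictly because \<open>c (K + 1) = 0\<close>.\<close>
  have key': "c (K - int j + 1) * d (K - int j - 1) < c (K - int j) * d (K - int j)" if "int j + 2 \<le> K" for j
    using that
  proof (induction j)
    case 0
    then show ?case using zero[of "K + 1"] pos1[of K] K(2)[of K] by simp
  next
    case (Suc j)
    define k where "k = K - int (Suc j)"
    have k: "2 \<le> k" "k + 1 \<le> K" "K - int j = k + 1" using Suc.prems by (auto simp: k_def)
    have IH: "c (k + 2) * d k < c (k + 1) * d (k + 1)" using Suc k(3) by (simp add: add.assoc)
    have p: "0 < d (k - 1)" "0 < d k" "0 < c (k + 1)" using K(2) pos1 k by auto
    have "c (k + 2) * d k * d (k - 1) < c (k + 1) * d (k + 1) * d (k - 1)" using IH p(1) by simp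
    also have "\<dots> = c (k + 1) * (d (k - 1) * d (k + 1))" by simp
    also have "\<dots> \<le> c (k + 1) * (d k)\<^sup>2" using dlc[OF k(1)] p(3) by simp
    finally have "(c (k + 2) * d (k - 1)) * d k < (c (k + 1) * d k) * d k" by (simp add: power2_eq_square mult_ac)
    then have "c (k + 2) * d (k - 1) < c (k + 1) * d k" using p(2) by simp
    moreover have "c (k + 1) = c (k + 2) + d (k + 1)" using step[of "k + 1"] by (simp add: add.assoc)
    then have "c (k + 1) * d (k - 1) = c (k + 2) * d (k - 1) + d (k - 1) * d (k + 1)" by (simp add: algebra_simps)
    moreover have ck: "c k = c (k + 1) + d k" using step[of k] by simp
    have "c k * d k = c (k + 1) * d k + (d k)\<^sup>2"
      unfolding ck by (simp add: algebra_simps power2_eq_square)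
    ultimately have "c (k + 1) * d (k - 1) < c k * d k" using dlc[OF k(1)] by linarith
    then show ?case unfolding k_def .
  qed
  have slc: "c (k - 1) * c (k + 1) < (c k)\<^sup>2" if k: "1 \<le> k" "k < K" for k
  proof -
    have lt: "c (k + 1) * d (k - 1) < c k * d k"
    proof (cases "k = 1")
      case True
      then show ?thesis using d0 pos1[of 1] K by simp
    next
      case False
      then show ?thesis using key'[of "nat (K - k)"] k by simp
    qed
    have ck: "c (k + 1) + d k = c k" "c (k - 1) = c k + d (k - 1)" using step[of k] step[of "k - 1"] by auto
    have "c (k - 1) * c (k + 1) = c k * c (k + 1) + c (k + 1) * d (k - 1)"
      unfolding ck(2) by (simp add: algebra_simps)
    also have "\<dots> < c k * c (k + 1) + c k * d k" using lt by simp
    also have "\<dots> = c k * (c (k + 1) + d k)" by (simp add: algebra_simps)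
    finally show ?thesis unfolding ck(1) by (simp add: power2_eq_square)
  qed
  show ?thesis
  proof (rule that[OF K(1)])
    show "0 < c k" if "1 - K \<le> k" "k \<le> K" for k
      using pos1[of k] pos1[of "1 - k"] refl[of k] that by (cases "1 \<le> k") auto
    show "c k = 0" if "k < 1 - K \<or> K < k" for k
      using zero[of k] zero[of "1 - k"] refl[of k] that by auto
    show "c (k - 1) * c (k + 1) < (c k)\<^sup>2" if "1 - K < k" "k < K" for k
    proof (cases "1 \<le> k")
      case True
      then show ?thesis using slc that by simp
    next
      case False
      have "c (1 - k - 1) * c (1 - k + 1) < (c (1 - k))\<^sup>2" using slc[of "1 - k"] that False by simp
      moreover have "c (1 - k - 1) = c (k + 1)" "c (1 - k + 1) = c (k - 1)"
        using refl[of "k + 1"] refl[of "k - 1"] by (simp_all add: algebra_simps)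
      ultimately show ?thesis using refl[of k] by (simp add: mult.commute)
    qed
  qed
qed

lemma spectrum_log_concaveI:
  assumes K: "1 \<le> K" and pos: "\<And>k. 1 - K \<le> k \<Longrightarrow> k \<le> K \<Longrightarrow> 0 < c k"
    and zero: "\<And>k. k < 1 - K \<or> K < k \<Longrightarrow> c k = 0"
    and lc: "\<And>k. 1 - K < k \<Longrightarrow> k < K \<Longrightarrow> c (k - 1) * c (k + 1) < (c k)\<^sup>2"
    and M: "\<And>k. int (count M (of_int k)) = c k" "\<And>z. z \<notin> range of_int \<Longrightarrow> count M z = 0"
  shows "strictly_internally_log_concave_spectrum M"
proof -
  let ?f = "\<lambda>k. count M (of_int k)" and ?ks = "[1 - K..K]"
  have set: "set_mset M = of_int ` set ?ks"
  proof (rule Set.set_eqI)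
    fix z show "z \<in> set_mset M \<longleftrightarrow> z \<in> of_int ` set ?ks"
    proof (cases "z \<in> range (of_int :: int \<Rightarrow> complex)")
      case True
      then obtain k where z: "z = of_int k" by blast
      have "z \<in> set_mset M \<longleftrightarrow> c k \<noteq> 0" unfolding z M(1)[of k, symmetric] by (simp add: count_eq_zero_iff)
      also have "\<dots> \<longleftrightarrow> k \<in> {1 - K..K}" using pos[of k] zero[of k]
        by (cases "k < 1 - K \<or> K < k") auto
      finally show ?thesis unfolding z by auto
    next
      case False
      then show ?thesis using M(2)[of z] by (auto simp: count_eq_zero_iff)
    qed
  qed
  have "sorted_wrt (<) ?ks" by (simp add: strict_sorted_iff)
  then have "multiplicity_sequence M (map ?f ?ks)"
    unfolding multiplicity_sequence_def using set by blast
  moreover have "strictly_internally_log_concave (map ?f ?ks)"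
    unfolding strictly_internally_log_concave_def
  proof (intro conjI ballI allI impI)
    fix m assume "m \<in> set (map ?f ?ks)"
    then obtain k where k: "1 - K \<le> k" "k \<le> K" "m = ?f k" by auto
    then show "0 < m" using pos[of k] M(1)[of k] by (simp del: count_greater_zero_iff)
  next
    fix j assume j: "1 \<le> j \<and> j + 1 < length (map ?f ?ks)"
    define k where "k = 1 - K + int j"
    have k: "1 - K < k" "k < K" using j by (auto simp: k_def)
    have "map ?f ?ks ! j = ?f k" "map ?f ?ks ! (j - 1) = ?f (k - 1)" "map ?f ?ks ! (j + 1) = ?f (k + 1)"
      using j by (auto simp: k_def nth_upto of_nat_diff algebra_simps)
    moreover have "int (?f (k - 1) * ?f (k + 1)) < int ((?f k)\<^sup>2)"
      using lc[OF k] by (simp add: M(1) del: of_int_add of_int_diff)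
    then have "?f (k - 1) * ?f (k + 1) < (?f k)\<^sup>2" by (simp only: of_nat_less_iff)
    ultimately show "map ?f ?ks ! (j - 1) * map ?f ?ks ! (j + 1) < (map ?f ?ks ! j)\<^sup>2" by simp
  qed
  ultimately show ?thesis unfolding strictly_internally_log_concave_spectrum_def by blast
qed

text \<open>The common shift \<open>s\<close> need not be an integer; it cancels in differences,
  which makes the spectrum integral.\<close>

lemma diff_count_shift:
  fixes s :: complex and E F :: "int multiset"
  defines "g \<equiv> \<lambda>x. s + of_int x"
  shows "diff_count (image_mset g E) (image_mset g F) (of_int k) = diff_count E F k"
    and "z \<notin> range of_int \<Longrightarrow> diff_count (image_mset g E) (image_mset g F) z = 0"
proof -
  have e: "g x - g y = of_int (x - y)" for x y by (simp add: g_def)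
  show "diff_count (image_mset g E) (image_mset g F) (of_int k) = diff_count E F k"
    by (rule diff_count_image) (simp add: e del: of_int_diff)
  assume "z \<notin> range of_int"
  then have "g x - g y \<noteq> z" for x y unfolding e by blast
  then show "diff_count (image_mset g E) (image_mset g F) z = 0"
    by (simp add: diff_count_def image_mset.compositionality comp_def)
qed

theorem corollary1p6:
  fixes a b :: nat and M :: "complex multiset"
  assumes "a > 0" and "b > 0" and "gcd a b = 1" and "min a b \<le> 128"
    and "ooms_spectrum (a + b) (W a b) M"
  shows "strictly_internally_log_concave_spectrum M"
proof -
  obtain \<phi> h bs A where fr: "frobenius_functional (a + b) (W a b) \<phi>" and pr: "principal_element (W a b) \<phi> h"
    and bs: "ordered_basis (a + b) (W a b) bs" "represents (a + b) bs (commutator h) A"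
    and M: "M = proots (char_poly A)"
    using assms(5) unfolding ooms_spectrum_def eigenvalue_multiset_def by blast
  have ab: "a + b > 0" using assms(1) by simp
  obtain A' B C P Q R where nd: "nondegenerate a b A' B C" and ad: "adjoint_system a b A' B C P Q R 1"
    and h: "h = four_block_mat P R (0\<^sub>m b a) Q"
    by (rule frobenius_adjoint_system[OF fr pr ab])
  have PQR: "P \<in> carrier_mat a a" "Q \<in> carrier_mat b b" "R \<in> carrier_mat a b"
    using ad by (auto simp: adjoint_system_def)
  have "coprime a b" using assms(3) by (simp add: coprime_iff_gcd_eq_1)
  from principal_heights[OF nd ad assms(1,2) this] obtain s E F where ht: "heights a b E F"
    and E: "has_eigenvalues P (image_mset (\<lambda>x. s + of_int x) E)"
    and F: "has_eigenvalues Q (image_mset (\<lambda>x. s + of_int x) F)" by blast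
  note sp = adjoint_spectrum[OF bs PQR h E F ab, folded M]
  define p q u where "p k = int (diff_count E E k)" and "q k = int (diff_count F F k)"
    and "u k = int (diff_count E F k)" for k
  have st: "state a b p q u" unfolding p_def q_def u_def by (rule heights_state[OF ht])
  \<comment> \<open>Whichever block is the smaller one, swapping the blocks leaves \<open>u\<close>
    unchanged.\<close>
  have "lc_profile (\<lambda>k. u k - u (- k))"
    using state_profile[OF st] state_profile[OF state_swap[OF st]] assms(4) by (cases "a \<le> b") auto
  then obtain K where K: "1 \<le> K" "\<And>k. 1 - K \<le> k \<Longrightarrow> k \<le> K \<Longrightarrow> 0 < p k + q k + u k - of_bool (k = 0)"
    "\<And>k. k < 1 - K \<or> K < k \<Longrightarrow> p k + q k + u k - of_bool (k = 0) = 0"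
    "\<And>k. 1 - K < k \<Longrightarrow> k < K \<Longrightarrow> (p (k - 1) + q (k - 1) + u (k - 1) - of_bool (k - 1 = 0)) *
      (p (k + 1) + q (k + 1) + u (k + 1) - of_bool (k + 1 = 0)) < (p k + q k + u k - of_bool (k = 0))\<^sup>2"
    by (rule multiplicities_log_concave[OF st]) blast
  show ?thesis
  proof (rule spectrum_log_concaveI[OF K])
    show "int (count M (of_int k)) = p k + q k + u k - of_bool (k = 0)" for k
      using sp[of "of_int k"] unfolding p_def q_def u_def diff_count_shift by (cases "k = 0") auto
    show "count M z = 0" if "z \<notin> range of_int" for z
      using sp[of z] unfolding diff_count_shift(2)[OF that] by (simp split: if_splits)
  qed
qed

end
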